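(* Let $\Omega\subset\mathbb{R}^2$ be a bounded convex planar domain with area $V=|\Omega|$, and let $\lambda_k$ denote its $k$-th Dirichlet eigenvalue. Then for all $k\in\mathbb{N}=\{1,2,\dots\}$, $$\lambda_k > 2\sqrt{3}\,\pi\,\frac{k}{V}.$$
   Context: A domain is a nonempty connected open set. The Dirichlet eigenvalues $0<\lambda_1<\lambda_2\le\cdots$ of $\Omega$ are the eigenvalues, listed in nondecreasing order with multiplicity, of the Laplace operator $\Delta=-\partial_1^2-\partial_2^2$ in $\Omega$ with Dirichlet boundary conditions. *)

theory Defs
  imports "HOL-Analysis.Analysis"
begin

definition partial :: "2 \<Rightarrow> (real^2 \<Rightarrow> real) \<Rightarrow> real^2 \<Rightarrow> real" where
  "partial i f x = frechet_derivative f (at x) (axis i 1)"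

primrec Ck :: "nat \<Rightarrow> (real^2 \<Rightarrow> real) \<Rightarrow> bool" where
  "Ck 0 f \<longleftrightarrow> continuous_on UNIV f"
| "Ck (Suc n) f \<longleftrightarrow> (\<forall>x. f differentiable (at x)) \<and> (\<forall>i. Ck n (partial i f))"

(* Positive sign convention: the eigenvalues of this operator are positive. *)
definition laplace :: "(real^2 \<Rightarrow> real) \<Rightarrow> real^2 \<Rightarrow> real" where
  "laplace f x = - partial 1 (partial 1 f) x - partial 2 (partial 2 f) x"

definition test_function :: "(real^2) set \<Rightarrow> (real^2 \<Rightarrow> real) \<Rightarrow> bool" where
  "test_function \<Omega> \<phi> \<longleftrightarrow> (\<forall>n. Ck n \<phi>) \<and>
     compact (closure {x. \<phi> x \<noteq> 0}) \<and> closure {x. \<phi> x \<noteq> 0} \<subseteq> \<Omega>"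

(* Elements of L2, H10 and the eigenspaces are functions, not classes modulo a.e. equality;
   values outside \<Omega> are irrelevant. *)
definition L2 :: "(real^2) set \<Rightarrow> (real^2 \<Rightarrow> real) set" where
  "L2 \<Omega> = {u \<in> borel_measurable (lebesgue_on \<Omega>). integrable (lebesgue_on \<Omega>) (\<lambda>x. (u x)\<^sup>2)}"

(* The closure of the test functions in the Sobolev space H^1; g is then the weak gradient of u. *)
definition H10 :: "(real^2) set \<Rightarrow> (real^2 \<Rightarrow> real) set" where
  "H10 \<Omega> = {u \<in> L2 \<Omega>. \<exists>g \<phi>. (\<forall>i. g i \<in> L2 \<Omega>) \<and> (\<forall>n. test_function \<Omega> (\<phi> n)) \<and>
     (\<lambda>n. \<integral>x. (\<phi> n x - u x)\<^sup>2 \<partial>lebesgue_on \<Omega>) \<longlonglongrightarrow> 0 \<and>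
     (\<forall>i. (\<lambda>n. \<integral>x. (partial i (\<phi> n) x - g i x)\<^sup>2 \<partial>lebesgue_on \<Omega>) \<longlonglongrightarrow> 0)}"

(* All u in H10 with "laplace u = \<mu> u" in the sense of distributions on \<Omega>, i.e. the kernel of
   the Dirichlet Laplacian minus \<mu>. *)
definition dirichlet_eigenspace :: "(real^2) set \<Rightarrow> real \<Rightarrow> (real^2 \<Rightarrow> real) set" where
  "dirichlet_eigenspace \<Omega> \<mu> = {u \<in> H10 \<Omega>. \<forall>\<phi>. test_function \<Omega> \<phi> \<longrightarrow>
     (\<integral>x. u x * laplace \<phi> x \<partial>lebesgue_on \<Omega>) = \<mu> * (\<integral>x. u x * \<phi> x \<partial>lebesgue_on \<Omega>)}"

(* The linear space E has dimension d modulo a.e. equality on \<Omega>: the family b is a basis. *)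
definition has_ae_dim :: "(real^2) set \<Rightarrow> (real^2 \<Rightarrow> real) set \<Rightarrow> nat \<Rightarrow> bool" where
  "has_ae_dim \<Omega> E d \<longleftrightarrow> (\<exists>b. (\<forall>i<d. b i \<in> E) \<and>
     (\<forall>c :: nat \<Rightarrow> real. (AE x in lebesgue_on \<Omega>. (\<Sum>i<d. c i * b i x) = 0) \<longrightarrow> (\<forall>i<d. c i = 0)) \<and>
     (\<forall>u\<in>E. \<exists>c :: nat \<Rightarrow> real. AE x in lebesgue_on \<Omega>. u x = (\<Sum>i<d. c i * b i x)))"

(* \<Lambda> 1, \<Lambda> 2, ... lists the Dirichlet eigenvalues of \<Omega> in nondecreasing order, each as often as
   its multiplicity; \<mu> is not an eigenvalue iff its eigenspace has dimension 0, in which case it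
   is not listed. The value \<Lambda> 0 is not used. *)
definition dirichlet_eigenvalues :: "(real^2) set \<Rightarrow> (nat \<Rightarrow> real) \<Rightarrow> bool" where
  "dirichlet_eigenvalues \<Omega> \<Lambda> \<longleftrightarrow> mono_on {1..} \<Lambda> \<and>
     (\<forall>\<mu>. finite {k. 1 \<le> k \<and> \<Lambda> k = \<mu>} \<and>
          has_ae_dim \<Omega> (dirichlet_eigenspace \<Omega> \<mu>) (card {k. 1 \<le> k \<and> \<Lambda> k = \<mu>}))"

end

theory Submission imports Defs begin

text \<open>
  Polya's tiling argument, applied to a packing. Suppose that translates of \<open>\<Omega>\<close> and of \<open>-\<Omega>\<close> pack the plane
  periodically, one of each per period cell of area \<open>A\<close>. A large square of side \<open>M\<close> then contains about
  \<open>2 M^2 / A\<close> disjoint copies. The first \<open>k\<close> eigenfunctions, transplanted to every copy, span a space of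
  dimension about \<open>2 k M^2 / A\<close> on which the Rayleigh quotient is at most \<open>\<Lambda> k\<close>, whereas the square has at most
  \<open>\<Lambda> k M^2 / (4 \<pi>)\<close> Dirichlet modes up to \<open>\<Lambda> k\<close>. Hence \<open>\<Lambda> k \<ge> 8 \<pi> k / A\<close>.

  A packing with \<open>A < 4 V / \<surd>3\<close> exists for every convex \<open>\<Omega>\<close> (a sharpening of the double-lattice theorem of
  G. and W. Kuperberg). Let \<open>v\<close> be the longest chord of its direction, and let \<open>a, a + v/2, d, d + v/2\<close> be
  boundary points; then \<open>v\<close> and \<open>2 (d - a)\<close> span the lattice of a packing with \<open>A = 4 |p|\<close>, where \<open>p\<close> is the
  parallelogram with these corners. Suppose that \<open>|p| \<ge> \<kappa> = V / \<surd>3\<close> for all choices of \<open>v\<close>. Let \<open>L (d - a)\<close> be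
  the longest chord parallel to \<open>d - a\<close>, and \<open>q\<close> the parallelogram belonging to it. The convex hull of \<open>p\<close>, \<open>q\<close>
  and the two longest chords has area at least \<open>\<kappa> (3 L / 4 + 1 / L) \<ge> \<surd>3 \<kappa> = V\<close>, so equality holds for all \<open>v\<close>.
  If \<open>v\<close> starts at a smooth boundary point, equality forces an edge of \<open>\<Omega>\<close> there that is parallel to \<open>d - a\<close>, and
  moving the starting point of \<open>v\<close> along this edge leads to a contradiction.
\<close>

section \<open>Areas of convex regions in the plane\<close>

text \<open>The limit of large squares preserves only a weak inequality, so the strict sign has to
  come from the packing. Therefore equality must be refuted, and the estimate by
  \<open>sqrt 3\<close> is not enough. That estimate is AM-GM, tight at
  \<open>L = 2 / sqrt 3\<close>; its term \<open>1 / L\<close> comes from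
  \<open>|q| \<ge> \<kappa>\<close>, which bounds from below the width between the half-length
  chords of q. The area is computed in coordinates in which p is the unit square. There the
  positions of v and of the longest chord parallel to \<open>d - a\<close> cancel, and only L and
  the width remain. The last contradiction arises as follows. All points of the edge, joined to one
  opposite point, yield the same \<open>d - a\<close>. The far side of p stays fixed, so the near
  side must move by half the shift of the starting point; only the edge itself leaves room for this.
  Then the longest chord lies on the edge line too, and sliding half of it gives two further
  parallelograms whose equality conditions exclude each other. Eigenfunctions are replaced by test
  functions before they are glued, so that integration by parts leaves no boundary terms.\<close>

definition cross2 :: "real^2 \<Rightarrow> real^2 \<Rightarrow> real" where
  "cross2 u w = u$1 * w$2 - u$2 * w$1"

lemma cross2_simps [simp]:
  "cross2 (u + v) w = cross2 u w + cross2 v w" "cross2 w (u + v) = cross2 w u + cross2 w v"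
  "cross2 (u - v) w = cross2 u w - cross2 v w" "cross2 w (u - v) = cross2 w u - cross2 w v"
  "cross2 (r *\<^sub>R u) w = r * cross2 u w" "cross2 w (r *\<^sub>R u) = r * cross2 w u"
  "cross2 (- u) w = - cross2 u w" "cross2 w (- u) = - cross2 w u"
  "cross2 u u = 0" "cross2 0 u = 0" "cross2 u 0 = 0"
  by (auto simp: cross2_def algebra_simps)

lemma cross2_commute: "cross2 u w = - cross2 w u"
  by (simp add: cross2_def)

lemma continuous_on_cross2 [continuous_intros]:
  assumes "continuous_on S f" "continuous_on S g"
  shows "continuous_on S (\<lambda>x. cross2 (f x) (g x))"
  unfolding cross2_def by (intro continuous_intros assms)

lemma cross2_inner: "cross2 u w = u \<bullet> (vector [w$2, - w$1])"
  by (simp add: cross2_def inner_vec_def sum_2)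

lemma cross2_decompose:
  assumes "cross2 B E \<noteq> 0"
  shows "z = (cross2 z E / cross2 B E) *\<^sub>R B + (cross2 B z / cross2 B E) *\<^sub>R E"
  using assms by (simp add: vec_eq_iff forall_2 cross2_def divide_simps) (simp add: algebra_simps)

lemma content_triangle_cross2:
  "measure lebesgue (convex hull {A, B, C}) = \<bar>cross2 (B - A) (C - A)\<bar> / 2"
proof -
  have "compact (convex hull {A, B, C})"
    by (intro compact_convex_hull finite_imp_compact) auto
  then have "measure lebesgue (convex hull {A, B, C}) = measure lborel (convex hull {A, B, C})"
    by (intro measure_completion) (simp add: borel_closed compact_imp_closed)
  also have "\<dots> = \<bar>cross2 (B - A) (C - A)\<bar> / 2"
    unfolding content_triangle cross2_def
    by (simp add: algebra_simps abs_minus_commute)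
  finally show ?thesis .
qed

text \<open>Levels are measured by the determinant with \<open>E\<close>. A difference of levels
  times a chord length counted in multiples of \<open>E\<close> is then an area, without any
  normalisation of \<open>E\<close>.\<close>

definition area_left :: "(real^2) set \<Rightarrow> real^2 \<Rightarrow> real \<Rightarrow> real" where
  "area_left S E \<alpha> = measure lebesgue (S \<inter> {z. cross2 z E < \<alpha>})"

lemma cross2_halfspaces:
  "open {z. cross2 z E < \<alpha>}" "closed {z. cross2 z E \<le> \<alpha>}" "closed {z. \<alpha> \<le> cross2 z E}"
  by (auto intro!: open_Collect_less closed_Collect_le continuous_intros)

lemma lmeasurable_strip:
  assumes "compact S"
  shows "S \<inter> {z. cross2 z E < \<alpha>} \<in> lmeasurable"
  using assms lmeasurable_compact cross2_halfspaces(1)[of E \<alpha>]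
  by (intro fmeasurable_Int_fmeasurable) auto

lemma negligible_cross2_line:
  assumes "E \<noteq> 0"
  shows "negligible {z. cross2 z E = \<alpha>}"
proof -
  have "(vector [E$2, - E$1] :: real^2) \<noteq> 0"
    using assms by (auto simp: vec_eq_iff forall_2)
  then have "negligible {z. (vector [E$2, - E$1] :: real^2) \<bullet> z = \<alpha>}"
    by (intro negligible_hyperplane) auto
  then show ?thesis by (simp add: cross2_inner inner_commute)
qed

lemma convex_cross2_le: "convex {z. cross2 (z - p) u \<le> 0}" "convex {z. cross2 (z - p) u \<ge> 0}"
  "convex {z. cross2 z u \<le> r}" "convex {z. cross2 z u \<ge> r}" 
proof -
  have *: "{z. cross2 (z - p) u \<le> 0} = {z. (vector [u$2, - u$1]::real^2) \<bullet> z \<le> cross2 p u}"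
          "{z. cross2 (z - p) u \<ge> 0} = {z. (vector [u$2, - u$1]::real^2) \<bullet> z \<ge> cross2 p u}"
          "{z. cross2 z u \<le> r} = {z. (vector [u$2, - u$1]::real^2) \<bullet> z \<le> r}"
          "{z. cross2 z u \<ge> r} = {z. (vector [u$2, - u$1]::real^2) \<bullet> z \<ge> r}"
    by (auto simp: cross2_inner inner_commute inner_diff_left inner_diff_right)
  show "convex {z. cross2 (z - p) u \<le> 0}" "convex {z. cross2 (z - p) u \<ge> 0}"
  "convex {z. cross2 z u \<le> r}" "convex {z. cross2 z u \<ge> r}" 
    unfolding * by (auto intro: convex_halfspace_le convex_halfspace_ge)
qed

text \<open>The two parallel chords span a trapezoid inside \<open>S\<close>, cut by a diagonal into
  the triangles \<open>T1\<close> and \<open>T2\<close>. A chord of length 0 is allowed, so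
  triangles with a tip are covered as well.\<close>

lemma area_left_trapezoid:
  assumes S: "compact S" "convex S"
    and P: "P0 \<in> S" "P0 + m0 *\<^sub>R E \<in> S" "P1 \<in> S" "P1 + m1 *\<^sub>R E \<in> S"
    and m: "0 \<le> m0" "0 \<le> m1" and d: "cross2 P0 E \<le> cross2 P1 E"
  shows "area_left S E (cross2 P0 E) + (cross2 P1 E - cross2 P0 E) * (m0 + m1) / 2
    \<le> area_left S E (cross2 P1 E)"
proof (cases "cross2 P0 E = cross2 P1 E")
  case True then show ?thesis by simp
next
  case False
  define \<delta> where "\<delta> = cross2 P1 E - cross2 P0 E"
  have \<delta>: "\<delta> > 0" using False d by (simp add: \<delta>_def)
  then have E0: "E \<noteq> 0" by (auto simp: \<delta>_def)
  define Q where "Q = P0 + m0 *\<^sub>R E"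
  define T1 where "T1 = convex hull {P0, Q, P1}"
  define T2 where "T2 = convex hull {Q, P1, P1 + m1 *\<^sub>R E}"
  have comp: "compact T1" "compact T2"
    unfolding T1_def T2_def by (auto intro!: compact_convex_hull)
  have a1: "measure lebesgue T1 = m0 * \<delta> / 2"
  proof -
    have "cross2 (Q - P0) (P1 - P0) = - (m0 * \<delta>)"
      by (simp add: Q_def \<delta>_def cross2_commute[of E]) (simp add: algebra_simps)
    then show ?thesis unfolding T1_def content_triangle_cross2 using m \<delta> by simp
  qed
  have a2: "measure lebesgue T2 = m1 * \<delta> / 2"
  proof -
    have "cross2 (P1 - Q) (P1 + m1 *\<^sub>R E - Q) = m1 * \<delta>"
      by (simp add: Q_def \<delta>_def cross2_commute[of E]) (simp add: algebra_simps cross2_def)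
    then show ?thesis unfolding T2_def content_triangle_cross2 using m \<delta> by simp
  qed
  have sub: "T1 \<subseteq> S" "T2 \<subseteq> S"
    unfolding T1_def T2_def Q_def using S P by (simp_all add: subset_hull)
  have strip: "T \<subseteq> {z. cross2 z E \<le> cross2 P1 E} \<inter> {z. cross2 z E \<ge> cross2 P0 E}"
    if "T = T1 \<or> T = T2" for T
    using that d unfolding T1_def T2_def Q_def
    by (elim disjE) (simp_all add: subset_hull convex_cross2_le)
  \<comment> \<open>The diagonal separating the two triangles; their intersection lies on its line
    and is null.\<close>
  define u where "u = P1 - Q"
  have u0: "u \<noteq> 0"
  proof
    assume "u = 0"
    then have "cross2 u E = 0" by simp
    then show False using \<delta> by (simp add: u_def Q_def \<delta>_def)
  qed
  have "cross2 (P0 - P1) u = m0 * \<delta>" "cross2 (Q - P1) u = 0" "cross2 E u = - \<delta>"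
    by (simp_all add: u_def Q_def \<delta>_def cross2_def algebra_simps)
  moreover have "m0 * \<delta> \<ge> 0" "m1 * \<delta> \<ge> 0" using m \<delta> by simp_all
  ultimately have "T1 \<subseteq> {z. cross2 (z - P1) u \<ge> 0}" "T2 \<subseteq> {z. cross2 (z - P1) u \<le> 0}"
    unfolding T1_def T2_def by (simp_all add: subset_hull convex_cross2_le)
  then have "T1 \<inter> T2 \<subseteq> {z. cross2 z u = cross2 P1 u}" by fastforce
  then have neg: "negligible (T1 \<inter> T2)"
    using negligible_cross2_line[OF u0] negligible_subset by blast
  have lm: "T1 \<in> lmeasurable" "T2 \<in> lmeasurable"
    using comp by (auto intro: lmeasurable_compact)
  have un: "measure lebesgue (T1 \<union> T2) = (m0 + m1) * \<delta> / 2"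
    using measure_Un3[OF lm] neg a1 a2 by (simp add: negligible_imp_measure0 algebra_simps add_divide_distrib)
  define A0 where "A0 = S \<inter> {z. cross2 z E < cross2 P0 E}"
  define A1 where "A1 = S \<inter> {z. cross2 z E < cross2 P1 E}"
  define N where "N = {z. cross2 z E = cross2 P1 E}"
  have N: "negligible N" unfolding N_def by (rule negligible_cross2_line[OF E0])
  have mA: "A0 \<in> lmeasurable" "A1 \<in> lmeasurable"
    unfolding A0_def A1_def using S by (auto intro: lmeasurable_strip)
  \<comment> \<open>The trapezoid reaches the closing level line, which the open half-plane of
    \<open>A1\<close> omits; the null set \<open>N\<close> repairs this.\<close>
  have sub': "A0 \<union> (T1 \<union> T2) \<subseteq> A1 \<union> N"
    using sub strip[of T1] strip[of T2] d unfolding A0_def A1_def N_def by fastforce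
  have "measure lebesgue A0 + measure lebesgue (T1 \<union> T2) = measure lebesgue (A0 \<union> (T1 \<union> T2))"
  proof -
    have "A0 \<inter> (T1 \<union> T2) = {}"
      using strip[of T1] strip[of T2] unfolding A0_def by fastforce
    then show ?thesis using measure_Un3[of A0 lebesgue "T1 \<union> T2"] mA fmeasurable.Un[OF lm] by simp
  qed
  also have "\<dots> \<le> measure lebesgue (A1 \<union> N)"
    using sub' mA lm N by (intro measure_mono_fmeasurable) (auto simp: negligible_imp_measurable)
  also have "\<dots> = measure lebesgue A1"
    using N mA by (intro measure_Un_null_set) (auto simp: negligible_iff_null_sets)
  finally show ?thesis
    unfolding un by (simp add: area_left_def A0_def A1_def \<delta>_def mult.commute)
qed

section \<open>Half-length parallelograms\<close>

lemma open_ray: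
  fixes z w :: "'a::real_normed_vector"
  assumes "open K" "z \<in> K"
  shows "\<exists>\<delta>>0. \<forall>s. \<bar>s\<bar> \<le> \<delta> \<longrightarrow> z + s *\<^sub>R w \<in> K"
proof -
  obtain \<epsilon> where \<epsilon>: "\<epsilon> > 0" "ball z \<epsilon> \<subseteq> K" using assms openE by blast
  show ?thesis
  proof (intro exI[of _ "\<epsilon> / (2 * (norm w + 1))"] conjI allI impI)
    show "0 < \<epsilon> / (2 * (norm w + 1))" using \<epsilon>(1) by (smt (verit) divide_pos_pos norm_ge_zero)
    fix s assume s: "\<bar>s\<bar> \<le> \<epsilon> / (2 * (norm w + 1))"
    have n: "0 < 2 * (norm w + 1)" by (smt (verit) norm_ge_zero)
    have "\<bar>s\<bar> * norm w \<le> \<bar>s\<bar> * (norm w + 1)" by (simp add: mult_left_mono)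
    also have "\<dots> \<le> \<epsilon> / 2" using s n by (simp add: field_simps)
    finally have "norm (s *\<^sub>R w) < \<epsilon>" using \<epsilon>(1) by simp
    then show "z + s *\<^sub>R w \<in> K" using \<epsilon>(2) by (auto simp: dist_norm)
  qed
qed

lemma convex_open_mix:
  fixes K :: "'a::euclidean_space set"
  assumes "open K" "convex K" "x \<in> K" "y \<in> closure K" "0 < u" "u \<le> 1"
  shows "u *\<^sub>R x + (1 - u) *\<^sub>R y \<in> K"
  using mem_interior_closure_convex_shrink[of K x y u] assms
  by (simp add: interior_open algebra_simps)

text \<open>The corners are \<open>a\<close>, \<open>a + v/2\<close>, \<open>d + v/2\<close>, \<open>d\<close>, in positive orientation, and the longest chord \<open>v\<close>
  of \<open>K\<close> starts at \<open>e\<close>. The last clause bounds the width of \<open>K\<close> across \<open>v\<close> by twice that of the parallelogram.\<close>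

definition half_par :: "(real^2) set \<Rightarrow> real^2 \<Rightarrow> real^2 \<Rightarrow> real^2 \<Rightarrow> real^2 \<Rightarrow> bool" where
  "half_par K v a d e \<longleftrightarrow> e \<in> closure K \<and> e + v \<in> closure K \<and> (\<forall>x\<in>K. x + v \<notin> K) \<and>
     {a, a + (1/2) *\<^sub>R v, d, d + (1/2) *\<^sub>R v} \<subseteq> closure K - K \<and>
     0 < cross2 v (d - a) \<and>
     (\<forall>x\<in>closure K. \<forall>y\<in>closure K. cross2 v (x - y) \<le> 2 * cross2 v (d - a))"

lemma cross2_ray:
  assumes "v \<noteq> 0"
  obtains r where "cross2 v r > 0"
proof
  have "cross2 v (vector [- v$2, v$1]) = (v$1)\<^sup>2 + (v$2)\<^sup>2"
    by (simp add: cross2_def power2_eq_square)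
  moreover have "\<dots> > 0" using assms by (simp add: vec_eq_iff forall_2 sum_power2_gt_zero_iff)
  ultimately show "cross2 v (vector [- v$2, v$1]) > 0" by simp
qed

text \<open>If \<open>z\<close> is interior, moving the other end towards the interior point
  \<open>z + \<epsilon> *\<^sub>R r\<close> displaces it by
  \<open>t *\<^sub>R (\<epsilon> *\<^sub>R r - w)\<close>, and \<open>z\<close> has room for the
  same displacement. So a chord with an interior end can be moved in any direction \<open>r\<close>,
  up to a multiple of itself; an extreme half chord has both ends on the boundary.\<close>

lemma half_chord_push:
  fixes K :: "(real^2) set"
  assumes K: "open K" "convex K" and z: "z \<in> closure K" "z + w \<in> closure K" "z \<in> K \<or> z + w \<in> K"
  obtains z' t q where "z' \<in> closure K" "z' + w \<in> closure K" "t > 0"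
    "z' - z = t *\<^sub>R r + q *\<^sub>R w"
proof -
  have cc: "convex (closure K)" using K convex_closure by blast
  from z(3) show thesis
  proof
    assume zK: "z \<in> K"
    obtain \<epsilon> where \<epsilon>: "\<epsilon> > 0" "\<And>s. \<bar>s\<bar> \<le> \<epsilon> \<Longrightarrow> z + s *\<^sub>R r \<in> K" using open_ray[OF K(1) zK, where w = "r"] by blast
    obtain \<delta> where \<delta>: "\<delta> > 0" "\<And>s. \<bar>s\<bar> \<le> \<delta> \<Longrightarrow> z + s *\<^sub>R (\<epsilon> *\<^sub>R r - w) \<in> K"
      using open_ray[OF K(1) zK, where w = "\<epsilon> *\<^sub>R r - w"] by blast
    define t where "t = min \<delta> 1"
    have t: "0 < t" "t \<le> 1" "t \<le> \<delta>" using \<delta> by (auto simp: t_def)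
    have 1: "z + t *\<^sub>R (\<epsilon> *\<^sub>R r - w) \<in> closure K"
      using \<delta>(2)[of t] t closure_subset by auto
    have "(1 - t) *\<^sub>R (z + w) + t *\<^sub>R (z + \<epsilon> *\<^sub>R r) \<in> closure K"
      using z \<epsilon>(2)[of \<epsilon>] \<epsilon>(1) t closure_subset by (intro convexD[OF cc]) auto
    also have "(1 - t) *\<^sub>R (z + w) + t *\<^sub>R (z + \<epsilon> *\<^sub>R r) = z + t *\<^sub>R (\<epsilon> *\<^sub>R r - w) + w"
      by (simp add: algebra_simps)
    finally have 2: "z + t *\<^sub>R (\<epsilon> *\<^sub>R r - w) + w \<in> closure K" .
    show thesis
      by (rule that[OF 1 2, of "t * \<epsilon>" "- t"]) (use t \<epsilon> in \<open>auto simp: algebra_simps\<close>)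
  next
    assume zK: "z + w \<in> K"
    obtain \<epsilon> where \<epsilon>: "\<epsilon> > 0" "\<And>s. \<bar>s\<bar> \<le> \<epsilon> \<Longrightarrow> (z + w) + s *\<^sub>R r \<in> K" using open_ray[OF K(1) zK, where w = "r"] by blast
    obtain \<delta> where \<delta>: "\<delta> > 0" "\<And>s. \<bar>s\<bar> \<le> \<delta> \<Longrightarrow> (z + w) + s *\<^sub>R (\<epsilon> *\<^sub>R r + w) \<in> K"
      using open_ray[OF K(1) zK, where w = "\<epsilon> *\<^sub>R r + w"] by blast
    define t where "t = min \<delta> 1"
    have t: "0 < t" "t \<le> 1" "t \<le> \<delta>" using \<delta> by (auto simp: t_def)
    have 1: "z + t *\<^sub>R (\<epsilon> *\<^sub>R r + w) + w \<in> closure K"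
      using \<delta>(2)[of t] t closure_subset by (auto simp: algebra_simps)
    have "(1 - t) *\<^sub>R z + t *\<^sub>R (z + w + \<epsilon> *\<^sub>R r) \<in> closure K"
      using z \<epsilon>(2)[of \<epsilon>] \<epsilon>(1) t closure_subset by (intro convexD[OF cc]) auto
    also have "(1 - t) *\<^sub>R z + t *\<^sub>R (z + w + \<epsilon> *\<^sub>R r) = z + t *\<^sub>R (\<epsilon> *\<^sub>R r + w)"
      by (simp add: algebra_simps)
    finally have 2: "z + t *\<^sub>R (\<epsilon> *\<^sub>R r + w) \<in> closure K" .
    show thesis
      by (rule that[OF 2 1, of "t * \<epsilon>" t]) (use t \<epsilon> in \<open>auto simp: algebra_simps\<close>)
  qed
qed

text \<open>The starting points of half chords form a compact set \<open>M\<close>. The two sides of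
  the parallelogram are its extreme members across \<open>v\<close>, and
  \<open>half_chord_push\<close> puts their ends on the boundary.\<close>

lemma half_par_exists:
  assumes K: "open K" "convex K" "bounded K" "K \<noteq> {}"
    and e: "e \<in> closure K" "e + v \<in> closure K" and v: "\<And>x. x \<in> K \<Longrightarrow> x + v \<notin> K"
  obtains a d where "half_par K v a d e"
    "\<And>z. z \<in> closure K \<Longrightarrow> z + (1/2) *\<^sub>R v \<in> closure K \<Longrightarrow> cross2 v a \<le> cross2 v z \<and> cross2 v z \<le> cross2 v d"
proof -
  have cc: "convex (closure K)" "compact (closure K)"
    using K by (auto simp: compact_closure intro: convex_closure)
  have v0: "v \<noteq> 0" using K(4) v by fastforce
  obtain r where r: "cross2 v r > 0" using cross2_ray[OF v0] .
  define M where "M = {z \<in> closure K. z + (1/2) *\<^sub>R v \<in> closure K}"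
  have "M = closure K \<inter> (\<lambda>z. z + (1/2) *\<^sub>R v) -` closure K" by (auto simp: M_def)
  moreover have "closed ((\<lambda>z. z + (1/2) *\<^sub>R v) -` closure K)"
    by (intro closed_vimage) (auto intro!: continuous_intros)
  ultimately have M: "compact M" using cc by (simp add: compact_Int_closed)
  \<comment> \<open>Contracting by 1/2 towards \<open>e\<close> maps the closure into
    \<open>M\<close>, since \<open>e\<close> and \<open>e + v\<close> both belong to the closure.
    This is the source of the factor 2 in the width clause.\<close>
  have mid: "(1/2) *\<^sub>R (x + e) \<in> M" if "x \<in> closure K" for x
  proof -
    have "(1/2) *\<^sub>R x + (1/2) *\<^sub>R e \<in> closure K" "(1/2) *\<^sub>R x + (1/2) *\<^sub>R (e + v) \<in> closure K"
      using that e by (auto intro!: convexD[OF cc(1)])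
    then show ?thesis by (simp add: M_def algebra_simps)
  qed
  have M0: "M \<noteq> {}" using mid e by blast
  have cont: "continuous_on M (cross2 v)" by (intro continuous_intros)
  obtain d where d: "d \<in> M" "\<And>z. z \<in> M \<Longrightarrow> cross2 v z \<le> cross2 v d"
    using continuous_attains_sup[OF M M0 cont] by blast
  obtain a where a: "a \<in> M" "\<And>z. z \<in> M \<Longrightarrow> cross2 v a \<le> cross2 v z"
    using continuous_attains_inf[OF M M0 cont] by blast
  have push: "\<exists>z'\<in>M. \<exists>t>0. cross2 v z' = cross2 v z + t * cross2 v u"
    if "z \<in> M" "z \<in> K \<or> z + (1/2) *\<^sub>R v \<in> K" for z u
  proof -
    note zi = that(2)
    have zz: "z \<in> closure K" "z + (1/2) *\<^sub>R v \<in> closure K" using that(1) by (auto simp: M_def)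
    obtain z' t q where *: "z' \<in> closure K" "z' + (1/2) *\<^sub>R v \<in> closure K" "t > 0"
       "z' - z = t *\<^sub>R u + q *\<^sub>R ((1/2) *\<^sub>R v)"
      by (rule half_chord_push[OF K(1,2) zz zi])
    have "cross2 v z' = cross2 v z + cross2 v (z' - z)" by simp
    also have "cross2 v (z' - z) = t * cross2 v u" by (subst *(4)) simp
    finally show ?thesis using * by (auto simp: M_def)
  qed
  have dn: "d \<notin> K \<and> d + (1/2) *\<^sub>R v \<notin> K"
  proof (rule ccontr)
    assume "\<not> ?thesis"
    then obtain z' t where "z' \<in> M" "t > 0" "cross2 v z' = cross2 v d + t * cross2 v r"
      using push[of d r] d by blast
    then show False using d(2)[of z'] r by (smt (verit) mult_pos_pos)
  qed
  have an: "a \<notin> K \<and> a + (1/2) *\<^sub>R v \<notin> K"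
  proof (rule ccontr)
    assume "\<not> ?thesis"
    then obtain z' t where "z' \<in> M" "t > 0" "cross2 v z' = cross2 v a + t * cross2 v (- r)"
      using push[of a "- r"] a by blast
    then show False using a(2)[of z'] r by (smt (verit) mult_pos_pos cross2_simps(8) mult_minus_right)
  qed
  have ext: "cross2 v (x - y) \<le> 2 * cross2 v (d - a)" if "x \<in> closure K" "y \<in> closure K" for x y
    using d(2)[OF mid[OF that(1)]] a(2)[OF mid[OF that(2)]] by simp
  have "0 < cross2 v (d - a)"
  proof -
    obtain x where x: "x \<in> K" using K by auto
    obtain \<delta> where \<delta>: "\<delta> > 0" "\<And>s. \<bar>s\<bar> \<le> \<delta> \<Longrightarrow> x + s *\<^sub>R r \<in> K" using open_ray[OF K(1) x, where w = "r"] by blast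
    have "0 < cross2 v ((x + \<delta> *\<^sub>R r) - x)" using r \<delta> by simp
    also have "\<dots> \<le> 2 * cross2 v (d - a)"
      using x \<delta>(2)[of \<delta>] \<delta>(1) closure_subset by (intro ext) auto
    finally show ?thesis by simp
  qed
  then have "half_par K v a d e"
    unfolding half_par_def using e v a(1) d(1) an dn ext by (auto simp: M_def)
  then show thesis using that a(2) d(2) unfolding M_def by blast
qed

lemma half_par_strict_width:
  assumes K: "open K" "convex K" and h: "half_par K v a d e" and x: "x \<in> K" "y \<in> closure K"
  shows "\<bar>cross2 v (x - y)\<bar> < 2 * cross2 v (d - a)"
proof -
  have v0: "v \<noteq> 0" using h by (auto simp: half_par_def)
  obtain r where r: "cross2 v r > 0" using cross2_ray[OF v0] .
  obtain \<delta> where \<delta>: "\<delta> > 0" "\<And>s. \<bar>s\<bar> \<le> \<delta> \<Longrightarrow> x + s *\<^sub>R r \<in> K" using open_ray[OF K(1) x(1), where w = r] by blast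
  have "x + \<delta> *\<^sub>R r \<in> closure K" "x + (-\<delta>) *\<^sub>R r \<in> closure K"
    using \<delta>(2)[of \<delta>] \<delta>(2)[of "-\<delta>"] \<delta>(1) closure_subset by auto
  then have "cross2 v (x + \<delta> *\<^sub>R r - y) \<le> 2 * cross2 v (d - a)" 
     "cross2 v (y - (x + (-\<delta>) *\<^sub>R r)) \<le> 2 * cross2 v (d - a)"
    using h x unfolding half_par_def by blast+
  moreover have "\<delta> * cross2 v r > 0" using \<delta> r by simp
  ultimately show ?thesis by simp
qed

text \<open>Otherwise \<open>p + w\<close> (for \<open>i \<ge> 2\<close>) or \<open>p\<close> (for
  negative \<open>i\<close>) would lie strictly between a point of \<open>K\<close> and a point of
  the closure, hence in \<open>K\<close>.\<close>

lemma boundary_progression: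
  fixes K :: "(real^2) set"
  assumes K: "open K" "convex K" and p: "p \<in> closure K - K" "p + w \<in> closure K - K"
  shows "p + of_int i *\<^sub>R w \<notin> K"
proof
  assume A: "p + of_int i *\<^sub>R w \<in> K"
  consider "i = 0" | "i = 1" | "i \<ge> 2" | "i \<le> -1" by linarith
  then show False
  proof cases
    case 3
    then have "(1 / of_int i) *\<^sub>R (p + of_int i *\<^sub>R w) + (1 - 1 / of_int i) *\<^sub>R p \<in> K"
      using p by (intro convex_open_mix[OF K A]) auto
    also have "(1 / of_int i) *\<^sub>R (p + of_int i *\<^sub>R w) + (1 - 1 / of_int i) *\<^sub>R p = p + w"
      using 3 by (simp add: algebra_simps)
    finally show False using p by simp
  next
    case 4
    define u where "u = 1 / (1 - real_of_int i)"
    have u: "0 < u" "u \<le> 1" "u * (1 - of_int i) = 1" using 4 by (auto simp: u_def)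
    have "u *\<^sub>R (p + of_int i *\<^sub>R w) + (1 - u) *\<^sub>R (p + w) \<in> K"
      using p u by (intro convex_open_mix[OF K A]) auto
    also have "u *\<^sub>R (p + of_int i *\<^sub>R w) + (1 - u) *\<^sub>R (p + w) = p + (1 - u * (1 - of_int i)) *\<^sub>R w"
      by (simp add: algebra_simps)
    finally show False using p u by simp
  qed (use A p in auto)
qed

text \<open>By convexity, \<open>K\<close> meets a copy reflected in a point \<open>c\<close> only if \<open>c \<in> K\<close>; here \<open>c\<close> runs through the
  points \<open>a + i v/2 + j (d - a)\<close>.\<close>

lemma half_par_packing:
  assumes K: "open K" "convex K" and h: "half_par K v a d e"
  shows "\<And>x i j. \<lbrakk>x \<in> K; (i, j) \<noteq> (0, 0)\<rbrakk> \<Longrightarrow> x + of_int i *\<^sub>R v + of_int j *\<^sub>R (2 *\<^sub>R (d - a)) \<notin> K"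
    and "\<And>x y i j. \<lbrakk>x \<in> K; y \<in> K\<rbrakk> \<Longrightarrow> x + y \<noteq> 2 *\<^sub>R a + of_int i *\<^sub>R v + of_int j *\<^sub>R (2 *\<^sub>R (d - a))"
proof -
  have clK: "x \<in> K \<Longrightarrow> x \<in> closure K" for x using closure_subset by auto
  have v: "x + v \<notin> K" if "x \<in> K" for x using h that by (auto simp: half_par_def)
  have v0: "cross2 v (d - a) > 0" using h by (auto simp: half_par_def)
  note w = half_par_strict_width[OF K h]
  \<comment> \<open>A chord that is a multiple of \<open>v\<close> would contain, by convexity, a
    chord equal to \<open>v\<close>.\<close>
  have vv: "x + of_int i *\<^sub>R v \<notin> K" if "x \<in> K" "i \<ge> 1" for x i
  proof
    assume A: "x + of_int i *\<^sub>R v \<in> K"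
    have "(1 / of_int i) *\<^sub>R (x + of_int i *\<^sub>R v) + (1 - 1 / of_int i) *\<^sub>R x \<in> K"
      using that clK by (intro convex_open_mix[OF K A]) auto
    also have "(1 / of_int i) *\<^sub>R (x + of_int i *\<^sub>R v) + (1 - 1 / of_int i) *\<^sub>R x = x + v"
      using that by (simp add: algebra_simps)
    finally show False using v that by simp
  qed
  show "x + of_int i *\<^sub>R v + of_int j *\<^sub>R (2 *\<^sub>R (d - a)) \<notin> K" if x: "x \<in> K" and ij: "(i, j) \<noteq> (0, 0)" for x i j
  proof
    define y where "y = x + of_int i *\<^sub>R v + of_int j *\<^sub>R (2 *\<^sub>R (d - a))"
    assume "x + of_int i *\<^sub>R v + of_int j *\<^sub>R (2 *\<^sub>R (d - a)) \<in> K"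
    then have y: "y \<in> K" by (simp add: y_def)
    show False
    proof (cases "j = 0")
      case True
      show False
      proof (cases "i \<ge> 1")
        case True then show ?thesis using vv[OF x True] y \<open>j = 0\<close> by (simp add: y_def)
      next
        case False
        then have "- i \<ge> 1" using ij True by auto
        from vv[OF y this] show ?thesis using x \<open>j = 0\<close> by (simp add: y_def)
      qed
    next
      case False
      \<comment> \<open>Different rows: one row shift across \<open>v\<close> already equals the
        bound on the width of \<open>K\<close>, which is strict for points of
        \<open>K\<close>.\<close>
      define h where "h = cross2 v (d - a)"
      have "cross2 v (y - x) = 2 * real_of_int j * h" by (simp add: y_def h_def algebra_simps)
      then have "\<bar>2 * real_of_int j * h\<bar> < 2 * h"
        using w[OF y clK[OF x]] by (simp only: h_def)
      moreover have "\<bar>2 * real_of_int j * h\<bar> = 2 * (\<bar>real_of_int j\<bar> * h)"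
        using v0 by (simp add: abs_mult h_def)
      moreover have "1 * h \<le> \<bar>real_of_int j\<bar> * h"
        using False v0 unfolding h_def by (intro mult_right_mono) auto
      ultimately show False by linarith
    qed
  qed
  show "x + y \<noteq> 2 *\<^sub>R a + of_int i *\<^sub>R v + of_int j *\<^sub>R (2 *\<^sub>R (d - a))" if xy: "x \<in> K" "y \<in> K" for x y i j
  proof
    assume A: "x + y = 2 *\<^sub>R a + of_int i *\<^sub>R v + of_int j *\<^sub>R (2 *\<^sub>R (d - a))"
    define m where "m = (1/2) *\<^sub>R x + (1/2) *\<^sub>R y"
    have m: "m \<in> K" unfolding m_def using xy K by (intro convexD) auto
    have "2 *\<^sub>R m = x + y" by (simp add: m_def algebra_simps)
    then have "2 *\<^sub>R m = 2 *\<^sub>R (a + of_int i *\<^sub>R ((1/2) *\<^sub>R v) + of_int j *\<^sub>R (d - a))"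
      unfolding A by (simp add: algebra_simps)
    then have me: "m = a + of_int i *\<^sub>R ((1/2) *\<^sub>R v) + of_int j *\<^sub>R (d - a)" by simp
    have bd: "a \<in> closure K - K" "a + (1/2) *\<^sub>R v \<in> closure K - K"
      "d \<in> closure K - K" "d + (1/2) *\<^sub>R v \<in> closure K - K"
      using h by (auto simp: half_par_def)
    consider "j = 0" | "j = 1" | "j \<ge> 2" | "j \<le> -1" by linarith
    then show False
    proof cases
      case 1 then show False using boundary_progression[OF K bd(1,2), of i] m me by simp
    next
      case 2 then show False using boundary_progression[OF K bd(3,4), of i] m me by (simp add: algebra_simps)
    next
      case 3
      have "cross2 v (m - a) = real_of_int j * cross2 v (d - a)" by (simp add: me)
      moreover have "real_of_int j * cross2 v (d - a) \<ge> 2 * cross2 v (d - a)"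
        using 3 v0 by (intro mult_right_mono) auto
      ultimately show False using w[OF m] bd(1) by fastforce
    next
      case 4
      have "cross2 v (d - m) = (1 - real_of_int j) * cross2 v (d - a)" by (simp add: me algebra_simps)
      moreover have "(1 - real_of_int j) * cross2 v (d - a) \<ge> 2 * cross2 v (d - a)"
        using 4 v0 by (intro mult_right_mono) auto
      moreover have "cross2 v (d - m) = - cross2 v (m - d)" by simp
      ultimately show False using w[OF m, of d] bd(3) by fastforce
    qed
  qed
qed

section \<open>The area inequality and the numbers forced by equality\<close>

lemma tight_equality_case:
  fixes \<kappa> D L W \<sigma> :: real
  assumes "\<kappa> > 0" "D \<ge> \<kappa>" "L \<ge> 1" "L * W * D \<ge> 2 * \<kappa>" "\<sigma> \<ge> 0"
    and le: "D * (3 * L / 4 + W / 2) + \<sigma> \<le> sqrt 3 * \<kappa>"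
  shows "\<sigma> = 0" "L = 2 / sqrt 3" "D = \<kappa>" "W = sqrt 3"
proof -
  have "D * W / 2 \<ge> \<kappa> / L" using assms by (simp add: field_simps)
  then have "\<kappa> * (3 * L / 4 + 1 / L - sqrt 3) + (D - \<kappa>) * (3 * L / 4) + \<sigma> \<le> 0"
  proof -
    have "L > 0" using assms by simp
    then have "\<kappa> * (3 * L / 4 + 1 / L - sqrt 3) = 3 * \<kappa> * L / 4 + \<kappa> / L - sqrt 3 * \<kappa>"
      "(D - \<kappa>) * (3 * L / 4) = 3 * D * L / 4 - 3 * \<kappa> * L / 4"
      "D * (3 * L / 4 + W / 2) = 3 * D * L / 4 + D * W / 2"
      by (simp_all add: field_simps)
    then show ?thesis using le \<open>D * W / 2 \<ge> \<kappa> / L\<close> by linarith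
  qed
  \<comment> \<open>The defect in AM-GM is a square, which vanishes only at
    \<open>2 / sqrt 3\<close>. The hypothesis now says that three nonnegative terms have a sum at
    most 0.\<close>
  moreover have "3 * L / 4 + 1 / L - sqrt 3 = (sqrt 3 * L - 2)\<^sup>2 / (4 * L)"
    using assms by (simp add: field_simps power2_eq_square)
  ultimately have le2: "\<kappa> * ((sqrt 3 * L - 2)\<^sup>2 / (4 * L)) + (D - \<kappa>) * (3 * L / 4) + \<sigma> \<le> 0" by simp
  have nn: "0 \<le> \<kappa> * ((sqrt 3 * L - 2)\<^sup>2 / (4 * L))" "0 \<le> (D - \<kappa>) * (3 * L / 4)"
    using assms by auto
  show s: "\<sigma> = 0" using le2 nn assms by linarith
  have "\<kappa> * ((sqrt 3 * L - 2)\<^sup>2 / (4 * L)) = 0" "(D - \<kappa>) * (3 * L / 4) = 0"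
    using le2 nn assms by linarith+
  then show L: "L = 2 / sqrt 3" and D: "D = \<kappa>" using assms by (auto simp: field_simps)
  have "3 * L / 4 = sqrt 3 / 2" unfolding L by (simp add: field_simps)
  then have "\<kappa> * (sqrt 3 / 2 + W / 2) \<le> \<kappa> * sqrt 3" using le by (simp add: D s mult.commute)
  then have "W \<le> sqrt 3" using assms(1) by simp
  moreover have "W \<ge> sqrt 3"
    using assms(1,4) unfolding D L by (simp add: field_simps)
  ultimately show "W = sqrt 3" by simp
qed

text \<open>In the main use \<open>B\<close> is half of the longest chord \<open>v\<close> and
  \<open>E = d - a\<close>: the parallelogram becomes the unit square and \<open>v\<close> is the
  horizontal vector of length 2.\<close>

definition pt :: "real^2 \<Rightarrow> real^2 \<Rightarrow> real^2 \<Rightarrow> real \<Rightarrow> real \<Rightarrow> real^2" where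
  "pt a B E x y = a + x *\<^sub>R B + y *\<^sub>R E"

lemma pt_step:
  assumes S: "compact S" "convex S" and D: "cross2 B E > 0"
    and P: "pt a B E x0 y0 \<in> S" "pt a B E x0 (y0 + m0) \<in> S" "pt a B E x1 y1 \<in> S" "pt a B E x1 (y1 + m1) \<in> S"
    and m: "0 \<le> m0" "0 \<le> m1" and x: "x0 \<le> x1"
  shows "area_left S E (cross2 a E + x0 * cross2 B E) + cross2 B E * ((x1 - x0) * (m0 + m1) / 2)
     \<le> area_left S E (cross2 a E + x1 * cross2 B E)"
proof -
  have "area_left S E (cross2 (pt a B E x0 y0) E) + (cross2 (pt a B E x1 y1) E - cross2 (pt a B E x0 y0) E) * (m0 + m1) / 2
    \<le> area_left S E (cross2 (pt a B E x1 y1) E)"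
    using P m x D by (intro area_left_trapezoid S) (auto simp: pt_def algebra_simps)
  then show ?thesis by (simp add: pt_def algebra_simps)
qed

lemma area_left_bounds:
  assumes "compact S"
  shows "0 \<le> area_left S E \<alpha>" "area_left S E \<alpha> \<le> measure lebesgue S"
  using assms lmeasurable_strip[OF assms, of E \<alpha>] unfolding area_left_def
  by (auto intro!: measure_mono_fmeasurable lmeasurable_compact)

lemma pt_convex:
  assumes "convex S" "pt a B E x y \<in> S" "pt a B E x' y' \<in> S" "0 \<le> u" "u \<le> 1"
  shows "pt a B E ((1 - u) * x + u * x') ((1 - u) * y + u * y') \<in> S"
proof -
  have "(1 - u) *\<^sub>R pt a B E x y + u *\<^sub>R pt a B E x' y' \<in> S"
    using assms by (intro convexD) auto
  also have "(1 - u) *\<^sub>R pt a B E x y + u *\<^sub>R pt a B E x' y' = pt a B E ((1 - u) * x + u * x') ((1 - u) * y + u * y')"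
    by (simp add: pt_def algebra_simps)
  finally show ?thesis .
qed

text \<open>Chord lengths parallel to \<open>E\<close> are a concave function of \<open>x\<close>. The numbers \<open>\<sigma>1\<close>, \<open>\<sigma>2\<close>, \<open>\<sigma>3\<close> record what
  the resulting bound loses to the left of \<open>xl\<close>, to the right of \<open>xr\<close>, and in between.\<close>

lemma polygon_area:
  fixes S :: "(real^2) set" and a B E :: "real^2"
  defines "F \<equiv> \<lambda>x. area_left S E (cross2 a E + x * cross2 B E)" and "D \<equiv> cross2 B E"
  assumes S: "compact S" "convex S" and D: "D > 0"
    and ad: "pt a B E 0 n0 \<in> S" "pt a B E 0 (n0 + m0) \<in> S" "m0 \<ge> 1"
    and bc: "pt a B E 1 0 \<in> S" "pt a B E 1 1 \<in> S"
    and tip: "pt a B E (-s) y0 \<in> S" "pt a B E (2 - s) y0 \<in> S"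
    and pk: "pt a B E t \<beta> \<in> S" "pt a B E t (\<beta> + L) \<in> S" "L \<ge> 1"
    and l: "pt a B E xl yl \<in> S" "pt a B E xl (yl + L/2) \<in> S" "xl \<le> 0" "xl \<le> t"
    and r: "pt a B E xr yr \<in> S" "pt a B E xr (yr + L/2) \<in> S" "1 \<le> xr" "t \<le> xr"
  obtains \<sigma>1 \<sigma>2 \<sigma>3 where "D * (3 * L / 4 + (xr - xl) / 2) + (\<sigma>1 + \<sigma>2 + \<sigma>3) \<le> measure lebesgue S"
    "\<sigma>1 \<ge> 0" "\<sigma>2 \<ge> 0" "\<sigma>3 \<ge> 0" "\<sigma>1 \<ge> F xl - D * ((xl + s) * L / 4)" "\<sigma>2 \<ge> - D * ((2 - s - xr) * L / 4)"
    "0 \<le> t \<and> t \<le> 1 \<Longrightarrow> \<sigma>3 \<ge> D * ((m0 - 1) * (t - xl) / 2)" "\<not> (0 \<le> t \<and> t \<le> 1) \<Longrightarrow> \<sigma>3 > 0"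
proof -
  have F: "0 \<le> F x" "F x \<le> measure lebesgue S" for x
    unfolding F_def using area_left_bounds[OF S(1)] by auto
  have step: "F x0 + D * ((x1 - x0) * (p + q) / 2) \<le> F x1"
    if "pt a B E x0 y0 \<in> S" "pt a B E x0 (y0 + p) \<in> S" "pt a B E x1 y1 \<in> S" "pt a B E x1 (y1 + q) \<in> S"
       "0 \<le> p" "0 \<le> q" "x0 \<le> x1" for x0 x1 y0 y1 p q
    using pt_step[OF S D[unfolded D_def] that] unfolding F_def D_def .
  define \<sigma>1 where "\<sigma>1 = F xl - D * ((xl + s) * L / 4)"
  define \<sigma>2 where "\<sigma>2 = measure lebesgue S - F xr - D * ((2 - s - xr) * L / 4)"
  \<comment> \<open>The triangle over the half chord at \<open>xl\<close> with its tip at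
    \<open>-s\<close> has area \<open>D * ((xl + s) * L / 4)\<close>. If the tip lies to the right
    of \<open>xl\<close>, this number is negative and nothing is to be shown.\<close>
  have s1: "\<sigma>1 \<ge> 0"
  proof (cases "-s \<le> xl")
    case True
    have "F (-s) + D * ((xl - (-s)) * (0 + L/2) / 2) \<le> F xl"
      using tip(1) l True pk by (intro step[of _ y0 _ _ yl]) auto
    moreover have e: "(xl - (-s)) * (0 + L/2) / 2 = (xl + s) * L / 4" by simp
    ultimately show ?thesis using F(1)[of "-s"] unfolding \<sigma>1_def e by linarith
  next
    case False
    then have "D * ((xl + s) * L / 4) \<le> 0" using D pk by (simp add: mult_nonneg_nonpos mult_nonpos_nonneg)
    then show ?thesis using F(1)[of xl] by (simp add: \<sigma>1_def)
  qed
  have s2: "\<sigma>2 \<ge> 0"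
  proof (cases "xr \<le> 2 - s")
    case True
    have "F xr + D * ((2 - s - xr) * (L/2 + 0) / 2) \<le> F (2 - s)"
      using tip(2) r True pk by (intro step[of _ yr _ _ y0]) auto
    moreover have e: "(2 - s - xr) * (L/2 + 0) / 2 = (2 - s - xr) * L / 4" by simp
    ultimately show ?thesis using F(2)[of "2 - s"] unfolding \<sigma>2_def e by linarith
  next
    case False
    then have "D * ((2 - s - xr) * L / 4) \<le> 0" using D pk by (simp add: mult_nonneg_nonpos mult_nonpos_nonneg)
    then show ?thesis using F(2)[of xr] by (simp add: \<sigma>2_def)
  qed
  have ad1: "pt a B E 0 n0 \<in> S" "pt a B E 0 (n0 + 1) \<in> S"
  proof -
    show "pt a B E 0 n0 \<in> S" by fact
    have "pt a B E ((1 - 1 / m0) * 0 + (1 / m0) * 0) ((1 - 1 / m0) * n0 + (1 / m0) * (n0 + m0)) \<in> S"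
      using ad by (intro pt_convex S) auto
    moreover have "(1 - 1 / m0) * n0 + (1 / m0) * (n0 + m0) = n0 + 1" using ad(3) by (simp add: field_simps)
    ultimately show "pt a B E 0 (n0 + 1) \<in> S" by simp
  qed
  consider "0 \<le> t \<and> t \<le> 1" | "t < 0" | "t > 1" by linarith
  then obtain \<sigma>3 where s3: "\<sigma>3 \<ge> 0" "F xl + D * (3 * L / 4 + (xr - xl) / 2 - (xl + s) * L / 4 - (2 - s - xr) * L / 4) + \<sigma>3 \<le> F xr"
    "0 \<le> t \<and> t \<le> 1 \<Longrightarrow> \<sigma>3 \<ge> D * ((m0 - 1) * (t - xl) / 2)" "\<not> (0 \<le> t \<and> t \<le> 1) \<Longrightarrow> \<sigma>3 > 0"
  proof cases
    case 1
    have "F xl + D * ((0 - xl) * (L/2 + m0) / 2) \<le> F 0"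
      using l ad pk by (intro step[of _ yl _ _ n0]) auto
    moreover have "F 0 + D * ((t - 0) * (m0 + L) / 2) \<le> F t"
      using ad pk 1 by (intro step[of _ n0 _ _ \<beta>]) auto
    moreover have "F t + D * ((1 - t) * (L + 1) / 2) \<le> F 1"
      using bc pk 1 by (intro step[of _ \<beta> _ _ 0]) auto
    moreover have "F 1 + D * ((xr - 1) * (1 + L/2) / 2) \<le> F xr"
      using bc pk r by (intro step[of _ 0 _ _ yr]) auto
    ultimately have "F xl + D * ((0 - xl) * (L/2 + m0) / 2) + D * ((t - 0) * (m0 + L) / 2) + D * ((1 - t) * (L + 1) / 2)
       + D * ((xr - 1) * (1 + L/2) / 2) \<le> F xr" by linarith
    \<comment> \<open>With the tip triangles added, \<open>s\<close> and \<open>t\<close> cancel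
      from the total, which leaves \<open>L\<close>, the width \<open>xr - xl\<close> and the
      surplus due to a chord at 0 longer than 1.\<close>
    moreover have "D * ((0 - xl) * (L/2 + m0) / 2) + D * ((t - 0) * (m0 + L) / 2) + D * ((1 - t) * (L + 1) / 2)
       + D * ((xr - 1) * (1 + L/2) / 2) = D * (3 * L / 4 + (xr - xl) / 2 - (xl + s) * L / 4 - (2 - s - xr) * L / 4) + D * ((m0 - 1) * (t - xl) / 2)"
      by (simp add: field_simps)
    ultimately have "F xl + D * (3 * L / 4 + (xr - xl) / 2 - (xl + s) * L / 4 - (2 - s - xr) * L / 4) + D * ((m0 - 1) * (t - xl) / 2) \<le> F xr" by linarith
    moreover have "D * ((m0 - 1) * (t - xl) / 2) \<ge> 0" using D ad(3) l by simp
    ultimately show thesis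
      using 1 by (intro that[of "D * ((m0 - 1) * (t - xl) / 2)"]) auto
  next
    case 2
    have "F xl + D * ((t - xl) * (L/2 + L) / 2) \<le> F t"
      using l pk by (intro step[of _ yl _ _ \<beta>]) auto
    moreover have "F t + D * ((1 - t) * (L + 1) / 2) \<le> F 1"
      using bc pk 2 by (intro step[of _ \<beta> _ _ 0]) auto
    moreover have "F 1 + D * ((xr - 1) * (1 + L/2) / 2) \<le> F xr"
      using bc pk r by (intro step[of _ 0 _ _ yr]) auto
    ultimately have "F xl + D * ((t - xl) * (L/2 + L) / 2) + D * ((1 - t) * (L + 1) / 2)
       + D * ((xr - 1) * (1 + L/2) / 2) \<le> F xr" by linarith
    \<comment> \<open>With the peak to the left of the unit square the chord at 0 is skipped. These
      two terms are the excess over the bound, and the second is strictly positive, so equality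
      excludes this position.\<close>
    moreover have "0 \<le> D * ((L/2 - 1/2) * (t - xl))" "0 < D * (L/4 * (-t))"
      using D pk(3) l(4) 2 by (intro mult_nonneg_nonneg mult_pos_pos; simp)+
    moreover have "D * ((t - xl) * (L/2 + L) / 2) + D * ((1 - t) * (L + 1) / 2)
       + D * ((xr - 1) * (1 + L/2) / 2) = D * (3 * L / 4 + (xr - xl) / 2 - (xl + s) * L / 4 - (2 - s - xr) * L / 4) + (D * ((L/2 - 1/2) * (t - xl)) + D * (L/4 * (-t)))"
      by (simp add: field_simps)
    ultimately show thesis
      using 2 by (intro that[of "D * ((L/2 - 1/2) * (t - xl)) + D * (L/4 * (-t))"]) linarith+
  next
    case 3
    have "F xl + D * ((0 - xl) * (L/2 + 1) / 2) \<le> F 0"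
      using l ad1 pk by (intro step[of _ yl _ _ n0]) auto
    moreover have "F 0 + D * ((t - 0) * (1 + L) / 2) \<le> F t"
      using ad1 pk 3 by (intro step[of _ n0 _ _ \<beta>]) auto
    moreover have "F t + D * ((xr - t) * (L + L/2) / 2) \<le> F xr"
      using pk r by (intro step[of _ \<beta> _ _ yr]) auto
    ultimately have "F xl + D * ((0 - xl) * (L/2 + 1) / 2) + D * ((t - 0) * (1 + L) / 2)
       + D * ((xr - t) * (L + L/2) / 2) \<le> F xr" by linarith
    moreover have "0 \<le> D * ((L/2 - 1/2) * (xr - t))" "0 < D * (L/4 * (t - 1))"
      using D pk(3) r(4) 3 by (intro mult_nonneg_nonneg mult_pos_pos; simp)+
    moreover have "D * ((0 - xl) * (L/2 + 1) / 2) + D * ((t - 0) * (1 + L) / 2)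
       + D * ((xr - t) * (L + L/2) / 2) = D * (3 * L / 4 + (xr - xl) / 2 - (xl + s) * L / 4 - (2 - s - xr) * L / 4) + (D * ((L/2 - 1/2) * (xr - t)) + D * (L/4 * (t - 1)))"
      by (simp add: field_simps)
    ultimately show thesis
      using 3 by (intro that[of "D * ((L/2 - 1/2) * (xr - t)) + D * (L/4 * (t - 1))"]) linarith+
  qed
  show thesis
  proof (rule that[of \<sigma>1 \<sigma>2 \<sigma>3])
    show "D * (3 * L / 4 + (xr - xl) / 2) + (\<sigma>1 + \<sigma>2 + \<sigma>3) \<le> measure lebesgue S"
      using s3(2) unfolding \<sigma>1_def \<sigma>2_def by (simp add: algebra_simps)
    show "\<sigma>2 \<ge> - D * ((2 - s - xr) * L / 4)" using F(2)[of xr] by (simp add: \<sigma>2_def)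
  qed (use s1 s2 s3 in \<open>auto simp: \<sigma>1_def\<close>)
qed

section \<open>The equality case\<close>

text \<open>The negation of the packing theorem: no half-length parallelogram beats density \<open>\<surd>3 / 2\<close>.\<close>

definition loose :: "(real^2) set \<Rightarrow> bool" where
  "loose K \<longleftrightarrow> (\<forall>v a d e. half_par K v a d e \<longrightarrow> 2 * (measure lebesgue K / sqrt 3) \<le> cross2 v (d - a))"

lemma measure_closure_convex:
  fixes K :: "'a::euclidean_space set"
  assumes "open K" "convex K" "bounded K"
  shows "measure lebesgue (closure K) = measure lebesgue K"
proof -
  have "measure lebesgue (K \<union> frontier K) = measure lebesgue K"
    using negligible_convex_frontier[OF assms(2)] assms
    by (intro measure_Un_null_set) (auto simp: negligible_iff_null_sets)
  then show ?thesis by (simp add: closure_Un_frontier)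
qed

lemma measure_open_pos:
  fixes K :: "'a::euclidean_space set"
  assumes "open K" "bounded K" "K \<noteq> {}"
  shows "measure lebesgue K > 0"
proof -
  have "K \<in> lmeasurable" using assms by (simp add: bounded_set_imp_lmeasurable)
  moreover have "\<not> negligible K" using assms open_not_negligible by blast
  ultimately show ?thesis by (simp add: negligible_iff_measure zero_less_measure_iff)
qed

lemma pt_coords:
  assumes "cross2 B E \<noteq> 0"
  shows "\<exists>x y. z = pt a B E x y"
proof -
  have "z - a = (cross2 (z - a) E / cross2 B E) *\<^sub>R B + (cross2 B (z - a) / cross2 B E) *\<^sub>R E"
    by (rule cross2_decompose[OF assms])
  then have "z = a + ((cross2 (z - a) E / cross2 B E) *\<^sub>R B + (cross2 B (z - a) / cross2 B E) *\<^sub>R E)"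
    by (metis add.commute diff_add_cancel)
  then show ?thesis unfolding pt_def by (metis add.assoc)
qed

text \<open>Compactness is applied to the pairs of points on a common line parallel to
  \<open>E\<close>; the determinant with \<open>B\<close> reads off their signed distance in
  multiples of \<open>E\<close>.\<close>

lemma longest_chord:
  assumes C: "compact C" and D: "cross2 B E > 0" and z: "z0 \<in> C"
  obtains z l where "z \<in> C" "z + l *\<^sub>R E \<in> C" "\<And>z' l'. z' \<in> C \<Longrightarrow> z' + l' *\<^sub>R E \<in> C \<Longrightarrow> l' \<le> l"
proof -
  define P where "P = (C \<times> C) \<inter> {p. cross2 (snd p - fst p) E = 0}"
  have "closed {p :: (real^2) \<times> (real^2). cross2 (snd p - fst p) E = 0}"
    by (intro closed_Collect_eq continuous_intros)
  then have P: "compact P" unfolding P_def by (intro compact_Int_closed compact_Times C)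
  have P0: "P \<noteq> {}" using z by (auto simp: P_def intro!: exI[of _ z0])
  have "continuous_on P (\<lambda>p. cross2 B (snd p - fst p))" by (intro continuous_intros)
  from continuous_attains_sup[OF P P0 this]
  obtain p where p: "p \<in> P" "\<And>q. q \<in> P \<Longrightarrow> cross2 B (snd q - fst q) \<le> cross2 B (snd p - fst p)" by blast
  define l where "l = cross2 B (snd p - fst p) / cross2 B E"
  have "snd p - fst p = l *\<^sub>R E"
    using cross2_decompose[of B E "snd p - fst p"] D p(1) by (simp add: l_def P_def)
  then have e: "snd p = fst p + l *\<^sub>R E" by (simp add: algebra_simps)
  show thesis
  proof (rule that[of "fst p" l])
    show "fst p \<in> C" "fst p + l *\<^sub>R E \<in> C" using p(1) e by (auto simp: P_def mem_Times_iff)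
    fix z' l' assume "z' \<in> C" "z' + l' *\<^sub>R E \<in> C"
    then have "(z', z' + l' *\<^sub>R E) \<in> P" by (simp add: P_def)
    from p(2)[OF this] have "l' * cross2 B E \<le> l * cross2 B E" by (simp add: e)
    then show "l' \<le> l" using D by simp
  qed
qed

text \<open>Looseness makes the polygon at least as large as \<open>K\<close> itself, so every
  surplus in \<open>polygon_area\<close> vanishes and \<open>tight_equality_case\<close> fixes all
  sizes. On the left this means that \<open>C\<close> is no larger than the triangle with tip
  \<open>e\<close>. In the middle it means that a chord at 0 longer than \<open>E\<close> is
  possible only if the longest chord sits at \<open>xl\<close>.\<close>

lemma loose_half_par:
  fixes K :: "(real^2) set" and v a d e
  defines "B \<equiv> (1/2) *\<^sub>R v" and "E \<equiv> d - a" and "C \<equiv> closure K" and "\<kappa> \<equiv> measure lebesgue K / sqrt 3"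
    and "L \<equiv> 2 / sqrt 3"
  assumes K: "open K" "convex K" "bounded K" "K \<noteq> {}" and lo: "loose K" and h: "half_par K v a d e"
  obtains s y0 t \<beta> xl yl xr yr where
    "cross2 B E = \<kappa>" "e = pt a B E (-s) y0" "e + v = pt a B E (2-s) y0" 
    "pt a B E t \<beta> \<in> C" "pt a B E t (\<beta> + L) \<in> C"
    "0 \<le> t" "t \<le> 1" "xl \<le> 0" "1 \<le> xr" "xr - xl = sqrt 3" "0 \<le> xl + s" "0 \<le> 2 - s - xr"
    "pt a B E xl yl \<in> C" "pt a B E xl (yl + L/2) \<in> C" "pt a B E xr yr \<in> C" "pt a B E xr (yr + L/2) \<in> C"
    "\<And>x y. pt a B E x y \<in> C \<Longrightarrow> pt a B E x (y + L/2) \<in> C \<Longrightarrow> xl \<le> x \<and> x \<le> xr"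
    "area_left C E (cross2 a E + xl * \<kappa>) \<le> \<kappa> * ((xl + s) * L / 4)"
    "\<And>n m. pt a B E 0 n \<in> C \<Longrightarrow> pt a B E 0 (n + m) \<in> C \<Longrightarrow> (m - 1) * (t - xl) \<le> 0"
    "half_par K (L *\<^sub>R E) (pt a B E xr yr) (pt a B E xl yl) (pt a B E t \<beta>)"
    "\<And>z l. z \<in> C \<Longrightarrow> z + l *\<^sub>R E \<in> C \<Longrightarrow> l \<le> L"
proof -
  have C: "compact C" "convex C" unfolding C_def using K by (auto simp: compact_closure intro: convex_closure)
  have mC: "measure lebesgue C = sqrt 3 * \<kappa>"
    unfolding C_def \<kappa>_def by (simp add: measure_closure_convex[OF K(1-3)])
  have \<kappa>: "\<kappa> > 0" unfolding \<kappa>_def using measure_open_pos[OF K(1,3,4)] by simp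
  define D where "D = cross2 B E"
  have vD: "cross2 v E = 2 * D" by (simp add: D_def B_def)
  have "2 * \<kappa> \<le> cross2 v (d - a)" using lo h unfolding loose_def \<kappa>_def by blast
  then have D\<kappa>: "D \<ge> \<kappa>" using vD by (simp only: E_def)
  have D: "D > 0" using D\<kappa> \<kappa> by simp
  have D': "cross2 B E > 0" using D by (simp add: D_def)
  have corners: "pt a B E 0 0 \<in> C" "pt a B E 0 1 \<in> C" "pt a B E 1 0 \<in> C" "pt a B E 1 1 \<in> C"
    using h by (auto simp: half_par_def pt_def B_def E_def C_def algebra_simps)
  obtain s y0 where e: "e = pt a B E (-s) y0" 
    using pt_coords[of B E e a] D' by (metis less_irrefl minus_minus)
  have ev: "e + v = pt a B E (2-s) y0" by (simp add: e pt_def B_def vec_eq_iff field_simps)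
  have eC: "pt a B E (-s) y0 \<in> C" "pt a B E (2-s) y0 \<in> C"
    unfolding e[symmetric] ev[symmetric] using h by (auto simp: half_par_def C_def)
  obtain z l where z: "z \<in> C" "z + l *\<^sub>R E \<in> C" "\<And>z' l'. z' \<in> C \<Longrightarrow> z' + l' *\<^sub>R E \<in> C \<Longrightarrow> l' \<le> l"
    by (rule longest_chord[OF C(1) D' corners(1)]) blast
  obtain t \<beta> where zt: "z = pt a B E t \<beta>" using pt_coords[of B E z a] D' by (metis less_irrefl)
  have l1: "l \<ge> 1" by (rule z(3)[of "pt a B E 0 0"]) (use corners in \<open>auto simp: pt_def\<close>)
  \<comment> \<open>Half of the longest chord is then no longer than the sides of the unit square,
    which therefore contain half chords; this yields \<open>xl \<le> 0\<close> and
    \<open>1 \<le> xr\<close> below.\<close>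
  have l2: "l \<le> 2"
  proof -
    have "cross2 v ((z + l *\<^sub>R E) - z) \<le> 2 * cross2 v (d - a)"
      using h z(1,2) unfolding half_par_def C_def by blast
    then have "l * (2 * D) \<le> 2 * (2 * D)" by (simp add: vD flip: E_def)
    then show ?thesis using D by simp
  qed
  have nl: "x + l *\<^sub>R E \<notin> K" if "x \<in> K" for x
  proof
    assume "x + l *\<^sub>R E \<in> K"
    from open_ray[OF K(1) this, of E] obtain \<delta> where \<delta>: "\<delta> > 0" "x + l *\<^sub>R E + \<delta> *\<^sub>R E \<in> K" by force
    then have "x + (l + \<delta>) *\<^sub>R E \<in> C" "x \<in> C" using that closure_subset by (auto simp: C_def algebra_simps)
    from z(3)[OF this(2,1)] \<delta> show False by simp
  qed
  obtain a' d' where h': "half_par K (l *\<^sub>R E) a' d' z"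
    and ext: "\<And>w. w \<in> C \<Longrightarrow> w + (1/2) *\<^sub>R (l *\<^sub>R E) \<in> C \<Longrightarrow>
      cross2 (l *\<^sub>R E) a' \<le> cross2 (l *\<^sub>R E) w \<and> cross2 (l *\<^sub>R E) w \<le> cross2 (l *\<^sub>R E) d'"
    unfolding C_def
    by (rule half_par_exists[OF K z(1)[unfolded C_def] z(2)[unfolded C_def] nl]) blast+
  \<comment> \<open>The pair \<open>E\<close>, \<open>B\<close> is negatively oriented, so
    \<open>a'\<close> becomes the right and \<open>d'\<close> the left half chord.\<close>
  obtain xr yr where a': "a' = pt a B E xr yr" using pt_coords[of B E a' a] D' by (metis less_irrefl)
  obtain xl yl where d': "d' = pt a B E xl yl" using pt_coords[of B E d' a] D' by (metis less_irrefl)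
  have cE: "cross2 (l *\<^sub>R E) (pt a B E x y) = l * (cross2 E a - x * D)" for x y
    by (simp add: pt_def D_def cross2_commute[of E B]) (simp add: algebra_simps)
  have ext': "xl \<le> x \<and> x \<le> xr" if "pt a B E x y \<in> C" "pt a B E x (y + l/2) \<in> C" for x y
  proof -
    have "pt a B E x y + (1/2) *\<^sub>R (l *\<^sub>R E) = pt a B E x (y + l/2)" by (simp add: pt_def algebra_simps)
    with ext[OF that(1)] that(2) show ?thesis unfolding a' d' cE using l1 D by simp
  qed
  have lr: "pt a B E xl yl \<in> C" "pt a B E xl (yl + l/2) \<in> C" "pt a B E xr yr \<in> C" "pt a B E xr (yr + l/2) \<in> C"
    using h' unfolding half_par_def a' d' C_def by (auto simp: pt_def algebra_simps)
  have x0: "xl \<le> 0"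
  proof -
    have "pt a B E ((1 - l/2) * 0 + (l/2) * 0) ((1 - l/2) * 0 + (l/2) * 1) \<in> C"
      using corners l1 l2 by (intro pt_convex C) auto
    then show ?thesis using ext'[of 0 0] corners by simp
  qed
  have x1: "1 \<le> xr"
  proof -
    have "pt a B E ((1 - l/2) * 1 + (l/2) * 1) ((1 - l/2) * 0 + (l/2) * 1) \<in> C"
      using corners l1 l2 by (intro pt_convex C) auto
    then show ?thesis using ext'[of 1 0] corners by simp
  qed
  have tz: "pt a B E t \<beta> \<in> C" "pt a B E t (\<beta> + l) \<in> C"
    using z zt by (auto simp: pt_def algebra_simps)
  have xt: "xl \<le> t" "t \<le> xr"
  proof -
    have "pt a B E ((1 - 1/2) * t + (1/2) * t) ((1 - 1/2) * \<beta> + (1/2) * (\<beta> + l)) \<in> C"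
      using tz by (intro pt_convex C) auto
    then have "pt a B E t (\<beta> + l/2) \<in> C" by (simp add: field_simps)
    then show "xl \<le> t" "t \<le> xr" using ext'[of t \<beta>] tz by auto
  qed
  \<comment> \<open>Looseness of the second parallelogram, written as a lower bound on the
    width.\<close>
  have lWD: "l * (xr - xl) * D \<ge> 2 * \<kappa>"
  proof -
    have "2 * \<kappa> \<le> cross2 (l *\<^sub>R E) (d' - a')" using lo h' unfolding loose_def \<kappa>_def by blast
    also have "\<dots> = l * (cross2 E a - xl * D) - l * (cross2 E a - xr * D)"
      unfolding cE[of xl yl, folded d', symmetric] cE[of xr yr, folded a', symmetric] by simp
    also have "\<dots> = l * (xr - xl) * D" by (simp add: algebra_simps)
    finally show ?thesis .
  qed
  note pa = polygon_area[OF C D' _ _ _ corners(3,4) eC tz l1 lr(1,2) x0 xt(1) lr(3,4) x1 xt(2), folded D_def, unfolded mC]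
  note ec = tight_equality_case[OF \<kappa> D\<kappa> l1 lWD]
  obtain \<sigma>1 \<sigma>2 \<sigma>3 where \<sigma>: "D * (3 * l / 4 + (xr - xl) / 2) + (\<sigma>1 + \<sigma>2 + \<sigma>3) \<le> sqrt 3 * \<kappa>"
    "\<sigma>1 \<ge> 0" "\<sigma>2 \<ge> 0" "\<sigma>3 \<ge> 0" 
    "\<sigma>1 \<ge> area_left C E (cross2 a E + xl * D) - D * ((xl + s) * l / 4)" "\<sigma>2 \<ge> - D * ((2 - s - xr) * l / 4)"
     "\<not> (0 \<le> t \<and> t \<le> 1) \<Longrightarrow> \<sigma>3 > 0"
    by (rule pa[of 0 1]) (use corners in auto)
  have \<sigma>0: "\<sigma>1 + \<sigma>2 + \<sigma>3 = 0" and lL: "l = L" and D_\<kappa>: "D = \<kappa>" and W: "xr - xl = sqrt 3"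
    using ec[OF _ \<sigma>(1)] \<sigma>(2-4) unfolding L_def by auto
  have s0: "\<sigma>1 = 0" "\<sigma>2 = 0" "\<sigma>3 = 0" using \<sigma>0 \<sigma>(2-4) by linarith+
  have t: "0 \<le> t \<and> t \<le> 1" using s0 \<sigma>(7) by force
  have a1: "area_left C E (cross2 a E + xl * D) \<le> D * ((xl + s) * l / 4)" using s0 \<sigma>(5) by simp
  have "D * ((xl + s) * l / 4) \<ge> 0" using a1 area_left_bounds(1)[OF C(1), of E "cross2 a E + xl * D"] by linarith
  then have xls: "0 \<le> xl + s" using D l1 by (simp add: zero_le_mult_iff)
  have "D * ((2 - s - xr) * l / 4) \<ge> 0" using s0 \<sigma>(6) by simp
  then have xrs: "0 \<le> 2 - s - xr" using D l1 by (simp add: zero_le_mult_iff)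
  \<comment> \<open>The polygon is formed once more, with the longer chord at 0; its surplus has to
    vanish too.\<close>
  have mm: "(m - 1) * (t - xl) \<le> 0" if m: "pt a B E 0 n \<in> C" "pt a B E 0 (n + m) \<in> C" for n m
  proof (cases "m \<ge> 1")
    case True
    obtain \<sigma>1 \<sigma>2 \<sigma>3 where \<sigma>: "D * (3 * l / 4 + (xr - xl) / 2) + (\<sigma>1 + \<sigma>2 + \<sigma>3) \<le> sqrt 3 * \<kappa>"
      "\<sigma>1 \<ge> 0" "\<sigma>2 \<ge> 0" "\<sigma>3 \<ge> 0" "\<sigma>3 \<ge> D * ((m - 1) * (t - xl) / 2)"
      by (rule pa[OF m True]) (use t in auto)
    have "\<sigma>1 + \<sigma>2 + \<sigma>3 = 0" using ec(1)[OF _ \<sigma>(1)] \<sigma>(2-4) by simp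
    then have "D * ((m - 1) * (t - xl) / 2) \<le> 0" using \<sigma>(2-5) by linarith
    then show ?thesis using D by (simp add: mult_le_0_iff)
  next
    case False then show ?thesis using xt by (simp add: mult_nonpos_nonneg)
  qed
  show thesis
    by (rule that[of s y0 t \<beta> xl xr yl yr])
      (use D_\<kappa> D_def e ev tz lL t x0 x1 W xls xrs lr ext' a1 mm h' z(3) in \<open>simp_all add: a' d' zt\<close>)
qed

text \<open>The tangent at \<open>e\<close> has direction \<open>w\<close>, and \<open>K\<close> lies to its left.\<close>

definition smooth_at :: "(real^2) set \<Rightarrow> real^2 \<Rightarrow> real^2 \<Rightarrow> bool" where
  "smooth_at K w e \<longleftrightarrow> e \<in> closure K - K \<and> w \<noteq> 0 \<and>
     (\<forall>u. cross2 w u > 0 \<longrightarrow> (\<exists>\<delta>>0. \<forall>s. 0 < s \<and> s \<le> \<delta> \<longrightarrow> e + s *\<^sub>R u \<in> K))"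

text \<open>At the point of the complement nearest to some \<open>p\<close> in \<open>K\<close>, a
  ball inside \<open>K\<close> touches the boundary. Every direction pointing into the ball enters
  \<open>K\<close>.\<close>

lemma smooth_at_exists:
  assumes K: "open K" "bounded K" "K \<noteq> {}"
  obtains w e where "smooth_at K w e"
proof -
  obtain p where p: "p \<in> K" using K by auto
  have "K \<noteq> UNIV" using K(2) not_bounded_UNIV[where 'a = "real^2"] by blast
  then have "closed (- K)" "- K \<noteq> {}" using K by auto
  from distance_attains_inf[OF this, of p] obtain e where e: "e \<in> - K" "\<And>y. y \<in> - K \<Longrightarrow> dist p e \<le> dist p y"
    by blast
  define r where "r = dist p e"
  have r: "r > 0" using e(1) p unfolding r_def by force
  have sub: "ball p r \<subseteq> K" using e(2) unfolding r_def by (force simp: subset_eq)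
  have "e \<in> closure (ball p r)" using r by (simp add: r_def)
  then have eC: "e \<in> closure K" using sub closure_mono by blast
  define n where "n = p - e"
  have nr: "norm n = r" by (simp add: n_def r_def dist_norm)
  \<comment> \<open>The inward normal turned clockwise by a right angle, so that the determinant
    with \<open>w\<close> is the inner product with \<open>n\<close>.\<close>
  define w :: "real^2" where "w = vector [n$2, - n$1]"
  have wu: "cross2 w u = n \<bullet> u" for u by (simp add: w_def cross2_def inner_vec_def sum_2)
  have w0: "w \<noteq> 0" using r nr wu[of n] by (metis cross2_simps(10) inner_eq_zero_iff norm_eq_zero less_irrefl)
  show thesis
  proof (rule that[of w e], unfold smooth_at_def, intro conjI allI impI w0)
    show "e \<in> closure K - K" using eC e by simp
    fix u assume "cross2 w u > 0"
    then have nu: "n \<bullet> u > 0" by (simp add: wu)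
    define \<delta> where "\<delta> = n \<bullet> u / (u \<bullet> u)"
    have u0: "u \<bullet> u > 0" using nu by (metis inner_gt_zero_iff inner_zero_right less_irrefl)
    show "\<exists>\<delta>>0. \<forall>s. 0 < s \<and> s \<le> \<delta> \<longrightarrow> e + s *\<^sub>R u \<in> K"
    proof (intro exI[of _ \<delta>] conjI allI impI)
      show "0 < \<delta>" using nu u0 by (simp add: \<delta>_def)
      fix s assume s: "0 < s \<and> s \<le> \<delta>"
      have "s * (u \<bullet> u) \<le> n \<bullet> u" using s u0 by (simp add: \<delta>_def field_simps)
      then have "s * (s * (u \<bullet> u)) \<le> s * (n \<bullet> u)" using s by simp
      moreover have "s * (n \<bullet> u) > 0" using s nu by simp
      ultimately have "(n - s *\<^sub>R u) \<bullet> (n - s *\<^sub>R u) < n \<bullet> n"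
        by (simp add: inner_diff_left inner_diff_right inner_commute algebra_simps)
      then have "norm (n - s *\<^sub>R u) < norm n" by (simp add: norm_lt)
      also have "n - s *\<^sub>R u = p - (e + s *\<^sub>R u)" by (simp add: n_def algebra_simps)
      finally have "e + s *\<^sub>R u \<in> ball p r" by (simp add: nr dist_norm)
      then show "e + s *\<^sub>R u \<in> K" using sub by blast
    qed
  qed
qed

text \<open>A point on the wrong side can be moved to a point \<open>y\<close> of \<open>K\<close>
  strictly beyond the tangent. Then \<open>e - y\<close> points inwards, and \<open>e\<close> lies
  between \<open>y\<close> and another point of \<open>K\<close>.\<close>

lemma smooth_at_halfplane:
  assumes K: "open K" "convex K" and s: "smooth_at K w e" and x: "x \<in> K"
  shows "cross2 w (x - e) > 0"
proof (rule ccontr)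
  assume A: "\<not> cross2 w (x - e) > 0"
  have w0: "w \<noteq> 0" using s by (simp add: smooth_at_def)
  obtain r where r: "cross2 w r > 0" using cross2_ray[OF w0] .
  obtain \<delta> where \<delta>0: "\<delta> > 0" "\<forall>s. \<bar>s\<bar> \<le> \<delta> \<longrightarrow> x + s *\<^sub>R r \<in> K" using open_ray[OF K(1) x, of r] by blast
  have \<delta>: "\<delta> > 0" "x + (-\<delta>) *\<^sub>R r \<in> K" using \<delta>0(1) \<delta>0(2)[rule_format, of "-\<delta>"] by auto
  define y where "y = x + (-\<delta>) *\<^sub>R r"
  have "\<delta> * cross2 w r > 0" using \<delta> r by simp
  then have y: "y \<in> K" "cross2 w (e - y) > 0" using \<delta>(2) A by (simp_all add: y_def)
  obtain \<epsilon> where \<epsilon>0: "\<epsilon> > 0" "\<forall>s. 0 < s \<and> s \<le> \<epsilon> \<longrightarrow> e + s *\<^sub>R (e - y) \<in> K"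
    using s y(2) unfolding smooth_at_def by blast
  then have \<epsilon>: "\<epsilon> > 0" "e + \<epsilon> *\<^sub>R (e - y) \<in> K" by auto
  define u where "u = 1 / (1 + \<epsilon>)"
  have u: "0 < u" "u \<le> 1" "u * (1 + \<epsilon>) = 1" using \<epsilon>(1) by (auto simp: u_def)
  have "u *\<^sub>R (e + \<epsilon> *\<^sub>R (e - y)) + (1 - u) *\<^sub>R y \<in> K"
    using \<epsilon> y(1) u by (intro convexD[OF K(2)]) auto
  also have "u *\<^sub>R (e + \<epsilon> *\<^sub>R (e - y)) + (1 - u) *\<^sub>R y = (u * (1 + \<epsilon>)) *\<^sub>R e + (1 - u * (1 + \<epsilon>)) *\<^sub>R y"
    by (simp add: algebra_simps)
  also have "\<dots> = e" by (simp add: u)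
  finally show False using s by (simp add: smooth_at_def)
qed

text \<open>A short step inwards is a convex combination of an interior point \<open>z\<close> and a
  nearby point of the segment. Smoothness therefore spreads from one point of a tangent line to the
  inside of every edge on that line.\<close>

lemma smooth_at_segment:
  assumes K: "open K" "convex K" "K \<noteq> {}" and s: "smooth_at K w e0"
    and P: "P \<in> closure K" "P + r *\<^sub>R w \<in> closure K" "cross2 w (P - e0) = 0" and r: "r \<noteq> 0" and t: "0 < t" "t < 1"
  shows "smooth_at K w (P + (t * r) *\<^sub>R w)"
proof -
  define e where "e = P + (t * r) *\<^sub>R w"
  have cc: "convex (closure K)" using K convex_closure by blast
  have seg: "P + (q * r) *\<^sub>R w \<in> closure K" if "0 \<le> q" "q \<le> 1" for q
  proof -
    have "(1 - q) *\<^sub>R P + q *\<^sub>R (P + r *\<^sub>R w) \<in> closure K" using that P by (intro convexD[OF cc]) auto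
    then show ?thesis by (simp add: algebra_simps)
  qed
  have eK: "e \<notin> K"
  proof
    assume "e \<in> K"
    from smooth_at_halfplane[OF K(1,2) s this] show False using P(3) by (simp add: e_def)
  qed
  have w0: "w \<noteq> 0" using s by (simp add: smooth_at_def)
  obtain z where z: "z \<in> K" using K by auto
  have cz: "cross2 w (z - e) > 0" using smooth_at_halfplane[OF K(1,2) s z] P(3) by (simp add: e_def)
  show ?thesis unfolding smooth_at_def e_def[symmetric]
  proof (intro conjI allI impI w0)
    show "e \<in> closure K - K" using eK seg[of t] t by (simp add: e_def)
    fix u assume u: "cross2 w u > 0"
    define \<beta> where "\<beta> = cross2 w u / cross2 w (z - e)"
    define \<alpha> where "\<alpha> = cross2 u (z - e) / cross2 w (z - e)"
    have ud: "u = \<alpha> *\<^sub>R w + \<beta> *\<^sub>R (z - e)"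
      unfolding \<alpha>_def \<beta>_def by (rule cross2_decompose) (use cz in auto)
    have \<beta>: "\<beta> > 0" using u cz by (simp add: \<beta>_def)
    define g where "g = min t (1 - t) * \<bar>r\<bar>"
    have g: "g > 0" using t r by (simp add: g_def)
    \<comment> \<open>The first bound keeps the weight of \<open>z\<close> at most 1/2; the second
      keeps the shift \<open>c\<close> along the edge within the distance \<open>g\<close> to the
      nearer end.\<close>
    define \<delta> where "\<delta> = min (1 / (2 * \<beta>)) (g / (2 * (\<bar>\<alpha>\<bar> + 1)))"
    show "\<exists>\<delta>>0. \<forall>s. 0 < s \<and> s \<le> \<delta> \<longrightarrow> e + s *\<^sub>R u \<in> K"
    proof (intro exI[of _ \<delta>] conjI allI impI)
      show "0 < \<delta>" using \<beta> g by (simp add: \<delta>_def)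
      fix s assume s: "0 < s \<and> s \<le> \<delta>"
      have sb: "s * \<beta> \<le> 1/2" "s * \<beta> > 0" using s \<beta> by (auto simp: \<delta>_def field_simps)
      have "s * (\<bar>\<alpha>\<bar> + 1) \<le> g / 2"
      proof -
        have "s \<le> g / (2 * (\<bar>\<alpha>\<bar> + 1))" using s by (simp add: \<delta>_def)
        then have "s * (2 * (\<bar>\<alpha>\<bar> + 1)) \<le> g" by (subst (asm) pos_le_divide_eq) auto
        then show ?thesis by (simp add: algebra_simps)
      qed
      moreover have "s * \<bar>\<alpha>\<bar> \<le> s * (\<bar>\<alpha>\<bar> + 1)" using s by simp
      ultimately have sa: "s * \<bar>\<alpha>\<bar> \<le> g / 2" by linarith
      define c where "c = s * \<alpha> / (1 - s * \<beta>)"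
      have "\<bar>c\<bar> = s * \<bar>\<alpha>\<bar> / (1 - s * \<beta>)" using s sb by (simp add: c_def abs_mult)
      also have "\<dots> \<le> (g / 2) / (1/2)" using sa sb s g by (intro frac_le) auto
      finally have c: "\<bar>c\<bar> \<le> g" by simp
      define q where "q = t + c / r"
      have "\<bar>c\<bar> / \<bar>r\<bar> \<le> min t (1 - t)" using c r by (subst pos_divide_le_eq) (simp_all only: g_def zero_less_abs_iff not_False_eq_True)
      then have "\<bar>c / r\<bar> \<le> min t (1 - t)" by (simp only: abs_divide)
      then have "\<bar>c / r\<bar> \<le> t \<and> \<bar>c / r\<bar> \<le> 1 - t" by (simp only: min.bounded_iff)
      then have q: "0 \<le> q" "q \<le> 1" unfolding q_def by linarith+
      have "(s * \<beta>) *\<^sub>R z + (1 - s * \<beta>) *\<^sub>R (P + (q * r) *\<^sub>R w) \<in> K"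
        using z seg[OF q] sb by (intro convex_open_mix[OF K(1,2)]) auto
      also have "P + (q * r) *\<^sub>R w = e + c *\<^sub>R w" using r by (simp add: q_def e_def algebra_simps)
      also have "(s * \<beta>) *\<^sub>R z + (1 - s * \<beta>) *\<^sub>R (e + c *\<^sub>R w) = e + (s * \<beta>) *\<^sub>R (z - e) + ((1 - s * \<beta>) * c) *\<^sub>R w"
        by (simp add: algebra_simps)
      also have "(1 - s * \<beta>) * c = s * \<alpha>" using sb by (simp add: c_def)
      also have "e + (s * \<beta>) *\<^sub>R (z - e) + (s * \<alpha>) *\<^sub>R w = e + s *\<^sub>R u" by (subst ud) (simp add: algebra_simps)
      finally show "e + s *\<^sub>R u \<in> K" .
    qed
  qed
qed

text \<open>Adding a multiple of \<open>w\<close> does not leave the half-plane, and it can make a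
  nonzero determinant with \<open>p\<close> arbitrarily negative.\<close>

lemma cross2_halfplane_parallel:
  assumes w: "w \<noteq> 0" and p: "\<And>u. cross2 w u > 0 \<Longrightarrow> cross2 p u \<ge> 0"
  shows "cross2 p w = 0"
proof (rule ccontr)
  assume A: "cross2 p w \<noteq> 0"
  obtain r where r: "cross2 w r > 0" using cross2_ray[OF w] .
  define \<tau> where "\<tau> = - (cross2 p r + 1) / cross2 p w"
  have "cross2 w (r + \<tau> *\<^sub>R w) > 0" using r by simp
  from p[OF this] show False using A by (simp add: \<tau>_def)
qed

lemma cross2_parallel:
  assumes w: "w \<noteq> 0" and p: "cross2 p w = 0"
  obtains l where "p = l *\<^sub>R w"
proof -
  obtain r where r: "cross2 w r > 0" using cross2_ray[OF w] .
  have "p = (cross2 p r / cross2 w r) *\<^sub>R w"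
    using cross2_decompose[of w r p] r p cross2_commute[of p w] by simp
  then show thesis by (rule that)
qed

lemma cross2_parallel2:
  assumes "w \<noteq> 0" "cross2 p w = 0" "cross2 q w = 0" shows "cross2 p q = 0"
proof -
  obtain l m where "p = l *\<^sub>R w" "q = m *\<^sub>R w" using cross2_parallel assms by metis
  then show ?thesis by simp
qed

text \<open>Left of the half chord at \<open>xl\<close>, tightness confines \<open>K\<close> to a
  triangle with apex \<open>e\<close>. But near a smooth point \<open>K\<close> fills all inward
  directions of a half-plane, so the triangle must degenerate: \<open>xl = -s\<close>, and the half
  chord lies on the tangent at \<open>e\<close>.\<close>

lemma loose_smooth:
  fixes K :: "(real^2) set" and f e a d w
  defines "v \<equiv> f - e"
  defines "B \<equiv> (1/2) *\<^sub>R v" and "E \<equiv> d - a" and "C \<equiv> closure K" and "\<kappa> \<equiv> measure lebesgue K / sqrt 3"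
    and "L \<equiv> 2 / sqrt 3"
  assumes K: "open K" "convex K" "bounded K" "K \<noteq> {}" and lo: "loose K" and h: "half_par K v a d e"
    and sm: "smooth_at K w e"
  obtains s y0 t \<beta> yl xr yr where
    "cross2 E w = 0" "cross2 B E = \<kappa>" "e = pt a B E (-s) y0" "f = pt a B E (2-s) y0"
    "pt a B E t \<beta> \<in> C" "pt a B E t (\<beta> + L) \<in> C"
    "0 \<le> t" "t \<le> 1" "0 \<le> s" "xr = sqrt 3 - s" "1 \<le> xr"
    "pt a B E (-s) yl \<in> C" "pt a B E (-s) (yl + L/2) \<in> C" "pt a B E xr yr \<in> C" "pt a B E xr (yr + L/2) \<in> C"
    "\<And>n m. pt a B E 0 n \<in> C \<Longrightarrow> pt a B E 0 (n + m) \<in> C \<Longrightarrow> (m - 1) * (t + s) \<le> 0"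
    "half_par K (L *\<^sub>R E) (pt a B E xr yr) (pt a B E (-s) yl) (pt a B E t \<beta>)"
proof -
  have C: "compact C" "convex C" unfolding C_def using K by (auto simp: compact_closure intro: convex_closure)
  have KC: "K \<subseteq> C" unfolding C_def by (rule closure_subset)
  have \<kappa>: "\<kappa> > 0" unfolding \<kappa>_def using measure_open_pos[OF K(1,3,4)] by simp
  have L: "L > 0" by (simp add: L_def)
  have ef: "e + v = f" by (simp add: v_def)
  have w0: "w \<noteq> 0" using sm by (simp add: smooth_at_def)
  obtain s y0 t \<beta> xl yl xr yr where H:
    "cross2 B E = \<kappa>" "e = pt a B E (-s) y0" "f = pt a B E (2-s) y0" 
    "pt a B E t \<beta> \<in> C" "pt a B E t (\<beta> + L) \<in> C"
    "0 \<le> t" "t \<le> 1" "xl \<le> 0" "1 \<le> xr" "xr - xl = sqrt 3" "0 \<le> xl + s" "0 \<le> 2 - s - xr"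
    "pt a B E xl yl \<in> C" "pt a B E xl (yl + L/2) \<in> C" "pt a B E xr yr \<in> C" "pt a B E xr (yr + L/2) \<in> C"
    and al: "area_left C E (cross2 a E + xl * \<kappa>) \<le> \<kappa> * ((xl + s) * L / 4)"
    and mm: "\<And>n m. pt a B E 0 n \<in> C \<Longrightarrow> pt a B E 0 (n + m) \<in> C \<Longrightarrow> (m - 1) * (t - xl) \<le> 0"
    and hq: "half_par K (L *\<^sub>R E) (pt a B E xr yr) (pt a B E xl yl) (pt a B E t \<beta>)"
    by (rule loose_half_par[OF K lo h, folded B_def E_def C_def \<kappa>_def L_def, unfolded ef]) blast
  have E0: "E \<noteq> 0" using H(1) \<kappa> by auto
  have eC: "e \<in> C" using h by (simp add: half_par_def C_def)
  define c0 where "c0 = cross2 a E + xl * \<kappa>"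
  define G where "G = K \<inter> {z. cross2 z E < c0}"
  have G: "open G" unfolding G_def using K cross2_halfspaces by (intro open_Int) auto
  have Gb: "bounded G" using K(3) bounded_subset unfolding G_def by blast
  have ce: "cross2 e E = cross2 a E - s * \<kappa>" by (simp add: H(2) pt_def H(1))
  have ray: "\<exists>\<sigma>>0. e + \<sigma> *\<^sub>R u \<in> K \<and> cross2 (e + \<sigma> *\<^sub>R u) E < \<gamma>" if cw: "cross2 w u > 0" and cl: "cross2 e E < \<gamma>" for u \<gamma>
  proof -
    obtain \<delta> where \<delta>: "\<delta> > 0" "\<forall>\<sigma>. 0 < \<sigma> \<and> \<sigma> \<le> \<delta> \<longrightarrow> e + \<sigma> *\<^sub>R u \<in> K" using sm cw unfolding smooth_at_def by blast
    have "open {z. cross2 z E < \<gamma>}" "e \<in> {z. cross2 z E < \<gamma>}" using cl cross2_halfspaces by auto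
    from open_ray[OF this, of u] obtain \<delta>' where \<delta>': "\<delta>' > 0" "\<forall>\<sigma>. \<bar>\<sigma>\<bar> \<le> \<delta>' \<longrightarrow> e + \<sigma> *\<^sub>R u \<in> {z. cross2 z E < \<gamma>}" by blast
    have m: "0 < min \<delta> \<delta>'" "min \<delta> \<delta>' \<le> \<delta>" "\<bar>min \<delta> \<delta>'\<bar> \<le> \<delta>'" using \<delta>(1) \<delta>'(1) by auto
    show ?thesis using m(1) \<delta>(2)[rule_format, OF conjI[OF m(1,2)]] \<delta>'(2)[rule_format, OF m(3)]
      by (intro exI[of _ "min \<delta> \<delta>'"]) (simp only: mem_Collect_eq)
  qed
  have xls: "xl + s = 0"
  proof (rule ccontr)
    assume "xl + s \<noteq> 0"
    then have pos: "xl + s > 0" using H(11) by simp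
    define U where "U = pt a B E xl yl - e"
    define U' where "U' = pt a B E xl (yl + L/2) - e"
    have cU: "cross2 U U' = (xl + s) * (L/2) * \<kappa>"
      by (simp add: U_def U'_def H(2) pt_def H(1) cross2_commute[of E B]) (simp add: algebra_simps)
    have cpos: "(xl + s) * (L/2) * \<kappa> > 0" using pos L \<kappa> by simp
    define T where "T = convex hull {e, pt a B E xl yl, pt a B E xl (yl + L/2)}"
    have Tc: "compact T" unfolding T_def by (simp add: compact_convex_hull)
    have mT: "measure lebesgue T = \<kappa> * ((xl + s) * L / 4)"
      unfolding T_def content_triangle_cross2 U_def[symmetric] U'_def[symmetric] cU using cpos
      by (simp add: mult.commute)
    have TC: "T \<subseteq> C" unfolding T_def using eC H C by (simp add: subset_hull)
    have lev: "cross2 (pt a B E xl y) E = c0" for y by (simp add: pt_def c0_def H(1))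
    have cel: "cross2 e E < c0" using ce mult_pos_pos[OF pos \<kappa>] by (simp add: c0_def algebra_simps)
    have Tle: "T \<subseteq> {z. cross2 z E \<le> c0}"
      unfolding T_def using lev cel by (simp add: subset_hull convex_cross2_le)
    have Tsub: "T \<subseteq> {z. cross2 (z - e) U \<le> 0}" "T \<subseteq> {z. cross2 (z - e) U' \<ge> 0}"
    proof -
      have *: "cross2 U' U \<le> 0" "cross2 U U' \<ge> 0" using cU cpos cross2_commute[of U' U] by simp_all
      have c1: "cross2 (pt a B E xl (yl + L/2) - e) U \<le> 0" using *(1) unfolding U'_def .
      have c2: "cross2 (pt a B E xl yl - e) U' \<ge> 0" using *(2) unfolding U_def .
      have c3: "cross2 (pt a B E xl yl - e) U = 0" "cross2 (pt a B E xl (yl + L/2) - e) U' = 0"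
        unfolding U_def U'_def by (simp_all only: cross2_simps(9))
      show "T \<subseteq> {z. cross2 (z - e) U \<le> 0}" "T \<subseteq> {z. cross2 (z - e) U' \<ge> 0}"
        unfolding T_def using c1 c2 c3 by (simp_all only: subset_hull convex_cross2_le insert_subset mem_Collect_eq) auto
    qed
    \<comment> \<open>A part of \<open>G\<close> outside \<open>T\<close> would have positive
      measure, while \<open>T\<close> alone uses up the area that \<open>al\<close> permits.\<close>
    have GT: "G \<subseteq> T"
    proof (rule ccontr)
      assume "\<not> G \<subseteq> T"
      then have ne: "G - T \<noteq> {}" by auto
      have op: "open (G - T)" using G Tc by (simp add: compact_imp_closed open_Diff)
      have bd: "bounded (G - T)" using Gb bounded_subset by blast
      have pos: "measure lebesgue (G - T) > 0" using measure_open_pos[OF op bd ne] .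
      define T0 where "T0 = T \<inter> {z. cross2 z E < c0}"
      have T0: "T0 \<in> lmeasurable" unfolding T0_def by (rule lmeasurable_strip[OF Tc])
      have "measure lebesgue T \<le> measure lebesgue (T0 \<union> {z. cross2 z E = c0})"
        using Tle T0 lmeasurable_compact[OF Tc] negligible_cross2_line[OF E0]
        by (intro measure_mono_fmeasurable) (auto simp: T0_def negligible_imp_measurable)
      also have "\<dots> = measure lebesgue T0"
        using T0 negligible_cross2_line[OF E0] by (intro measure_Un_null_set) (auto simp: negligible_iff_null_sets)
      finally have 1: "measure lebesgue T \<le> measure lebesgue T0" .
      have "measure lebesgue (G - T) + measure lebesgue T0 = measure lebesgue ((G - T) \<union> T0)"
      proof -
        have "(G - T) \<inter> T0 = {}" by (auto simp: T0_def)
        moreover have "G - T \<in> lmeasurable" using op bd by (simp add: bounded_set_imp_lmeasurable)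
        ultimately show ?thesis using measure_Un3[of "G - T" lebesgue T0] T0 by simp
      qed
      also have "\<dots> \<le> area_left C E c0" unfolding area_left_def
        using KC TC T0 op by (intro measure_mono_fmeasurable lmeasurable_strip C) (auto simp: G_def T0_def)
      also have "\<dots> \<le> measure lebesgue T" using al unfolding mT c0_def .
      finally show False using 1 pos by linarith
    qed
    have inT: "\<exists>\<sigma>>0. e + \<sigma> *\<^sub>R u \<in> T" if "cross2 w u > 0" for u
    proof -
      from ray[OF that cel] show ?thesis using GT by (auto simp: G_def)
    qed
    \<comment> \<open>Every inward direction at \<open>e\<close> runs between the two sides of
      \<open>T\<close>. So both sides are parallel to the tangent, which a triangle of positive area
      does not allow.\<close>
    have "cross2 U w = 0"
    proof (rule cross2_halfplane_parallel[OF w0])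
      fix u assume "cross2 w u > 0"
      then obtain \<sigma> where \<sigma>: "\<sigma> > 0" "e + \<sigma> *\<^sub>R u \<in> T" using inT by blast
      then have "\<sigma> * cross2 u U \<le> 0" using Tsub(1) by auto
      then show "cross2 U u \<ge> 0" using \<sigma>(1) cross2_commute[of U u] by (simp add: mult_le_0_iff)
    qed
    moreover have "cross2 (- U') w = 0"
    proof (rule cross2_halfplane_parallel[OF w0])
      fix u assume "cross2 w u > 0"
      then obtain \<sigma> where \<sigma>: "\<sigma> > 0" "e + \<sigma> *\<^sub>R u \<in> T" using inT by blast
      then have "\<sigma> * cross2 u U' \<ge> 0" using Tsub(2) by auto
      then show "cross2 (- U') u \<ge> 0" using \<sigma>(1) cross2_commute[of U' u] by (simp add: zero_le_mult_iff)
    qed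
    ultimately have "cross2 U (- U') = 0" by (rule cross2_parallel2[OF w0])
    then have "cross2 U U' = 0" by simp
    then show False using cU cpos by linarith
  qed
  \<comment> \<open>With \<open>xl = -s\<close> the permitted area to the left is 0. Hence the line
    through \<open>e\<close> parallel to \<open>E\<close> supports \<open>K\<close>, and smoothness
    makes it the tangent.\<close>
  have Gempty: "G = {}"
  proof (rule ccontr)
    assume ne: "G \<noteq> {}"
    have "0 < measure lebesgue G" using measure_open_pos[OF G Gb ne] .
    also have "\<dots> \<le> area_left C E c0" unfolding area_left_def
      using KC G by (intro measure_mono_fmeasurable lmeasurable_strip C) (auto simp: G_def)
    also have "\<dots> \<le> 0" using al xls unfolding c0_def by simp
    finally show False by simp
  qed
  have ce0: "cross2 e E = c0" using ce xls unfolding c0_def by (simp add: add_eq_0_iff algebra_simps)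
  have "cross2 (- E) w = 0"
  proof (rule cross2_halfplane_parallel[OF w0])
    fix u assume u: "cross2 w u > 0"
    then obtain \<sigma> where "\<sigma> > 0" "\<forall>s. 0 < s \<and> s \<le> \<sigma> \<longrightarrow> e + s *\<^sub>R u \<in> K"
      using sm unfolding smooth_at_def by blast
    then have \<sigma>: "\<sigma> > 0" "e + \<sigma> *\<^sub>R u \<in> K" by auto
    then have "cross2 (e + \<sigma> *\<^sub>R u) E \<ge> c0" using Gempty by (force simp: G_def)
    then have "\<sigma> * cross2 u E \<ge> 0" using ce0 by simp
    then show "cross2 (- E) u \<ge> 0" using \<sigma>(1) cross2_commute[of E u] by (simp add: zero_le_mult_iff)
  qed
  then have par: "cross2 E w = 0" by simp
  have xl: "xl = -s" using xls by simp
  show thesis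
    by (rule that[of s y0 t \<beta> xr yl yr]) (use par H mm hq in \<open>simp_all add: xl\<close>)
qed

section \<open>Chords on a common line, and the contradiction along the edge\<close>

text \<open>A line through the interior leaves \<open>K\<close> at exactly two boundary points,
  which here are \<open>a\<close> and \<open>a + E\<close>; the closure has nothing beyond
  them.\<close>

lemma chord_exact:
  fixes K :: "(real^2) set"
  assumes K: "open K" "convex K" and a: "a \<in> closure K - K" "a + E \<in> closure K - K"
    and z: "a + \<zeta> *\<^sub>R E \<in> K" and q: "a + \<tau> *\<^sub>R E \<in> closure K"
  shows "0 \<le> \<tau>" "\<tau> \<le> 1"
proof -
  have mix: "a + \<rho> *\<^sub>R E \<in> K" if "a + \<mu> *\<^sub>R E \<in> closure K" "(\<zeta> < \<rho> \<and> \<rho> < \<mu>) \<or> (\<mu> < \<rho> \<and> \<rho> < \<zeta>)" for \<mu> \<rho>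
  proof -
    define u where "u = (\<mu> - \<rho>) / (\<mu> - \<zeta>)"
    have u: "0 < u" "u \<le> 1" using that(2) by (auto simp: u_def field_simps)
    have ne: "\<mu> - \<zeta> \<noteq> 0" using that(2) by auto
    have "u *\<^sub>R (a + \<zeta> *\<^sub>R E) + (1 - u) *\<^sub>R (a + \<mu> *\<^sub>R E) \<in> K"
      using convex_open_mix[OF K z that(1) u] .
    also have "u *\<^sub>R (a + \<zeta> *\<^sub>R E) + (1 - u) *\<^sub>R (a + \<mu> *\<^sub>R E) = a + (\<mu> - u * (\<mu> - \<zeta>)) *\<^sub>R E"
      by (simp add: algebra_simps)
    also have "\<mu> - u * (\<mu> - \<zeta>) = \<rho>" using ne by (simp add: u_def)
    finally show ?thesis .
  qed
  have z01: "0 < \<zeta>" "\<zeta> < 1"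
  proof -
    show "0 < \<zeta>"
    proof (rule ccontr)
      assume "\<not> 0 < \<zeta>"
      then have "\<zeta> = 0 \<or> \<zeta> < 0" by auto
      then show False using mix[of 1 0] a z by auto
    qed
    show "\<zeta> < 1"
    proof (rule ccontr)
      assume "\<not> \<zeta> < 1"
      then have "\<zeta> = 1 \<or> \<zeta> > 1" by auto
      then show False using mix[of 0 1] a z by auto
    qed
  qed
  show "0 \<le> \<tau>"
  proof (rule ccontr)
    assume "\<not> 0 \<le> \<tau>"
    then show False using mix[OF q, of 0] z01 a by simp
  qed
  show "\<tau> \<le> 1"
  proof (rule ccontr)
    assume "\<not> \<tau> \<le> 1"
    then show False using mix[OF q, of 1] z01 a by simp
  qed
qed

lemma cross2_level_meets:
  fixes K :: "(real^2) set"
  assumes K: "open K" "convex K" "K \<noteq> {}" and pq: "p \<in> closure K" "q \<in> closure K"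
    and c: "cross2 p E < c" "c < cross2 q E"
  shows "\<exists>z\<in>K. cross2 z E = c"
proof -
  obtain z0 where z0: "z0 \<in> K" using K by auto
  have seg: "\<exists>z\<in>K. cross2 z E = c" if r: "r \<in> closure K" and lt: "(cross2 z0 E < c \<and> c < cross2 r E) \<or> (cross2 r E < c \<and> c < cross2 z0 E)" for r
  proof -
    define u where "u = (c - cross2 r E) / (cross2 z0 E - cross2 r E)"
    have u: "0 < u" "u \<le> 1" using lt by (auto simp: u_def field_simps)
    have ne: "cross2 z0 E - cross2 r E \<noteq> 0" using lt by auto
    have "u *\<^sub>R z0 + (1 - u) *\<^sub>R r \<in> K" by (rule convex_open_mix[OF K(1,2) z0 r u])
    moreover have "cross2 (u *\<^sub>R z0 + (1 - u) *\<^sub>R r) E = c"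
    proof -
      have "cross2 (u *\<^sub>R z0 + (1 - u) *\<^sub>R r) E = cross2 r E + u * (cross2 z0 E - cross2 r E)"
        by (simp add: algebra_simps)
      also have "u * (cross2 z0 E - cross2 r E) = c - cross2 r E" using ne by (simp add: u_def)
      finally show ?thesis by simp
    qed
    ultimately show ?thesis by blast
  qed
  show ?thesis using seg[OF pq(1)] seg[OF pq(2)] c z0 by (cases "cross2 z0 E" c rule: linorder_cases) auto
qed

lemma cross2_level_coord:
  assumes D: "cross2 B E \<noteq> 0" and z: "cross2 z E = cross2 a E"
  obtains \<tau> where "z = a + \<tau> *\<^sub>R E"
proof -
  have "z - a = (cross2 B (z - a) / cross2 B E) *\<^sub>R E"
    using cross2_decompose[OF D, of "z - a"] z by simp
  then have "z = a + (cross2 B (z - a) / cross2 B E) *\<^sub>R E" by (metis add.commute diff_add_cancel)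
  then show thesis by (rule that)
qed

text \<open>Two starting points of \<open>v\<close> on the same edge give the same \<open>E\<close>. If the corresponding \<open>a1\<close>, \<open>a2\<close> had different
  levels, then the chord of length \<open>L > 1\<close> would force a chord longer than \<open>E\<close> on the line through \<open>a2\<close> and
  \<open>a2 + E\<close>, both of which are boundary points.\<close>

lemma loose_level_unique:
  fixes K :: "(real^2) set"
  assumes K: "open K" "convex K" "K \<noteq> {}" and D: "cross2 B2 E > 0"
    and e: "e \<in> closure K" "f \<in> closure K"
    and ec: "cross2 e E = cross2 a2 E - s2 * cross2 B2 E" "cross2 f E = cross2 a2 E + (2 - s2) * cross2 B2 E"
    and s: "0 \<le> s1" "s1 < s2" "s2 \<le> 1"
    and a1: "a1 \<in> closure K" "a1 + E \<in> closure K" "cross2 a1 E = cross2 a2 E + (s1 - s2) * cross2 B2 E"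
    and a2: "a2 \<in> closure K - K" "a2 + E \<in> closure K - K"
    and b2: "a2 + B2 \<in> closure K" "a2 + B2 + E \<in> closure K"
    and p: "p \<in> closure K" "p + L *\<^sub>R E \<in> closure K" "L > 1"
    and pc: "cross2 p E = cross2 a2 E + t * cross2 B2 E" "t \<le> 1"
  shows False
proof -
  define D where "D = cross2 B2 E"
  have D0: "D > 0" using D by (simp add: D_def)
  have cc: "convex (closure K)" using K convex_closure by blast
  have "cross2 e E < cross2 a2 E" "cross2 a2 E < cross2 f E"
    using ec s D0 by (auto simp: D_def[symmetric])
  from cross2_level_meets[OF K e this] obtain z where z: "z \<in> K" "cross2 z E = cross2 a2 E" by blast
  obtain \<zeta> where \<zeta>: "z = a2 + \<zeta> *\<^sub>R E" using cross2_level_coord[of B2 E z a2] D z by auto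
  note ex = chord_exact[OF K(1,2) a2 z(1)[unfolded \<zeta>]]
  have long: False if q: "q \<in> closure K" "q + m *\<^sub>R E \<in> closure K" "cross2 q E = cross2 a2 E" "m > 1" for q m
  proof -
    obtain \<tau> where \<tau>: "q = a2 + \<tau> *\<^sub>R E" using cross2_level_coord[of B2 E q a2] D q(3) by auto
    have "a2 + (\<tau> + m) *\<^sub>R E \<in> closure K" using q(2) by (simp add: \<tau> algebra_simps)
    from ex(2)[OF this] ex(1)[OF q(1)[unfolded \<tau>]] q(4) show False by simp
  qed
  have mix: False if g: "g \<in> closure K" "g + E \<in> closure K" and gc: "cross2 g E = cross2 a2 E + r * D" and rt: "r * t < 0" for g r
  proof -
    define u where "u = r / (r - t)"
    have ne: "r - t \<noteq> 0" using rt by (auto simp: mult_less_0_iff)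
    have u: "0 < u" "u < 1" using rt by (auto simp: u_def mult_less_0_iff divide_simps)
    have u0: "(1 - u) * r + u * t = 0" using ne by (simp add: u_def field_simps)
    define q where "q = (1 - u) *\<^sub>R g + u *\<^sub>R p"
    have "q \<in> closure K" unfolding q_def using g p u by (intro convexD[OF cc]) auto
    moreover have "(1 - u) *\<^sub>R (g + E) + u *\<^sub>R (p + L *\<^sub>R E) \<in> closure K"
      using g p u by (intro convexD[OF cc]) auto
    then have "q + (1 + u * (L - 1)) *\<^sub>R E \<in> closure K" by (simp add: q_def algebra_simps)
    moreover have "cross2 q E = cross2 a2 E + ((1 - u) * r + u * t) * D"
      by (simp add: q_def gc pc D_def algebra_simps)
    moreover have "u * (L - 1) > 0" using u p by simp
    ultimately show False using long[of q "1 + u * (L - 1)"] u0 by simp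
  qed
  show False
  \<comment> \<open>The unit chord on the other side of level 0 from the long chord is the one at
    \<open>a2 + B2\<close> if \<open>t < 0\<close> and the one at \<open>a1\<close> if
    \<open>t > 0\<close>.\<close>
  proof (cases t "0::real" rule: linorder_cases)
    case equal then show False using long[OF p(1,2)] pc p(3) by simp
  next
    case less
    show False by (rule mix[of "a2 + B2" 1]) (use b2 less in \<open>auto simp: D_def\<close>)
  next
    case greater
    show False by (rule mix[of a1 "s1 - s2"]) (use a1 greater s in \<open>auto simp: D_def mult_less_0_iff\<close>)
  qed
qed

lemma pt_inject:
  assumes "cross2 B E \<noteq> 0" "pt a B E x y = pt a B E x' y'"
  shows "x = x'" "y = y'"
proof -
  have "cross2 (pt a B E x y - a) E = cross2 (pt a B E x' y' - a) E" "cross2 B (pt a B E x y - a) = cross2 B (pt a B E x' y' - a)"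
    using assms by simp_all
  then show "x = x'" "y = y'" using assms(1) by (simp_all add: pt_def)
qed

text \<open>The longest chord parallel to \<open>E\<close> lies on the boundary line at level 0: the half chords on it can
  be shifted freely, and the lowest and highest choice contradict each other.\<close>

lemma loose_boundary_chord:
  fixes K :: "(real^2) set" and a B E :: "real^2"
  defines "C \<equiv> closure K" and "L \<equiv> 2 / sqrt 3"
  assumes K: "open K" "convex K" "bounded K" "K \<noteq> {}" and lo: "loose K"
    and D: "cross2 B E > 0"
    and bd: "\<And>y. pt a B E 0 y \<notin> K"
    and bc: "pt a B E 1 0 \<in> C" "pt a B E 1 1 \<in> C"
    and pk: "pt a B E 0 \<beta> \<in> C" "pt a B E 0 (\<beta> + L) \<in> C"
    and hq: "half_par K (L *\<^sub>R E) (pt a B E (sqrt 3) yr) (pt a B E 0 yl) (pt a B E 0 \<beta>)"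
  shows False
proof -
  have cc: "convex C" unfolding C_def using K convex_closure by blast
  have L: "L > 0" by (simp add: L_def)
  define A where "A = pt a B E (sqrt 3) yr"
  define B' where "B' = (1/2) *\<^sub>R (L *\<^sub>R E)"
  define F where "F = (\<lambda>y. pt a B E 0 y - A)"
  have Feq: "pt a B E 0 y - A = F y" for y by (simp add: F_def)
  have cF: "cross2 (L *\<^sub>R E) (F y) = L * (sqrt 3 * cross2 B E)" for y
    by (simp add: F_def A_def pt_def cross2_commute[of E B])
  have Fpos: "cross2 B' (F y) > 0" for y
    using cF[of y] D L by (simp add: B'_def)
  \<comment> \<open>Every point of level 0 gives the same determinant and lies outside
    \<open>K\<close>, so any half chord on that line can take the place of the given one.\<close>
  have half: "half_par K (L *\<^sub>R E) A (pt a B E 0 y) (pt a B E 0 \<beta>)" if "pt a B E 0 y \<in> C" "pt a B E 0 (y + L/2) \<in> C" for y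
  proof -
    have "cross2 (L *\<^sub>R E) (pt a B E 0 y - A) = cross2 (L *\<^sub>R E) (pt a B E 0 yl - A)"
      using cF[of y] cF[of yl] by (simp add: F_def)
    moreover have "pt a B E 0 y + (1/2) *\<^sub>R (L *\<^sub>R E) = pt a B E 0 (y + L/2)" by (simp add: pt_def algebra_simps)
    ultimately show ?thesis
      using hq that bd[of y] bd[of "y + L/2"] unfolding half_par_def A_def[symmetric] C_def by auto
  qed
  have mid: "pt a B E 0 (\<beta> + L/2) \<in> C"
    using pt_convex[OF cc pk, of "1/2"] by (simp add: field_simps)
  \<comment> \<open>Going from \<open>A\<close> at level \<open>sqrt 3\<close> to level 0, level 1
    is reached at the fraction \<open>k\<close>. That \<open>1 - k\<close> is also
    \<open>L / 2\<close> makes the combinations below half chords of exactly the right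
    length.\<close>
  define k where "k = 1 - 1 / sqrt 3"
  have k: "0 < k" "k < 1" "1 - k = L / 2" "sqrt 3 * (1 - k) = 1"
    using real_less_rsqrt[of 1 3] by (auto simp: k_def L_def field_simps)
  have AC: "A \<in> C" "A + B' \<in> C" using hq by (auto simp: half_par_def A_def B'_def C_def)
  have conv: "k *\<^sub>R x + (1 - k) *\<^sub>R y \<in> C" if "x \<in> C" "y \<in> C" for x y
    using that k by (intro convexD[OF cc]) auto
  have coord: "pt a B E 1 y = pt A B' (F r) ((y - yr - k * (r - yr)) / (L / 2)) k" for y r
  proof -
    have "pt A B' (F r) ((y - yr - k * (r - yr)) / (L / 2)) k = A + (y - yr - k * (r - yr)) *\<^sub>R E + k *\<^sub>R (pt a B E 0 r - A)"
      using L by (simp add: pt_def[of A] B'_def F_def)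
    also have "\<dots> = pt a B E (sqrt 3 * (1 - k)) y" unfolding A_def by (simp add: pt_def algebra_simps)
    finally show ?thesis by (simp only: k(4))
  qed
  have low: "yr + k * (\<beta> - yr) \<le> 0"
  proof -
    \<comment> \<open>The lowest choice: the long chord now starts at the corner with coordinates
      (0, 1), so the new \<open>s\<close> is 0 and the left bound \<open>xl\<close> is 0 as
      well.\<close>
    have h: "half_par K (L *\<^sub>R E) A (pt a B E 0 \<beta>) (pt a B E 0 \<beta>)" using half[OF pk(1) mid] .
    obtain s y0 xl where H: "pt a B E 0 \<beta> = pt A B' (F \<beta>) (-s) y0" "xl \<le> 0" "0 \<le> xl + s"
      "\<And>x y. pt A B' (F \<beta>) x y \<in> C \<Longrightarrow> pt A B' (F \<beta>) x (y + L/2) \<in> C \<Longrightarrow> xl \<le> x"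
      by (rule loose_half_par[OF K lo h, folded B'_def C_def L_def, unfolded Feq]) blast
    have "pt a B E 0 \<beta> = pt A B' (F \<beta>) 0 1" by (simp add: pt_def[of A] F_def)
    then have "-s = 0" using H(1) pt_inject(1)[of B' "F \<beta>" A "-s" y0 0 1] Fpos[of \<beta>] by auto
    then have xl: "xl = 0" using H by simp
    define x where "x = (0 - yr - k * (\<beta> - yr)) / (L / 2)"
    have b: "pt A B' (F \<beta>) x k \<in> C" using bc(1) coord[of 0 \<beta>] by (simp add: x_def)
    \<comment> \<open>The lower end of the chord at level 1, combined with \<open>A\<close> and with
      \<open>A + F \<beta>\<close> in the same proportion. The two resulting points span a half
      chord parallel to \<open>F \<beta>\<close>, so \<open>xl\<close> bounds its position.\<close>
    have "k *\<^sub>R pt A B' (F \<beta>) x k + (1 - k) *\<^sub>R A \<in> C" by (rule conv[OF b AC(1)])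
    then have 1: "pt A B' (F \<beta>) (k * x) (k * k) \<in> C" by (simp add: pt_def algebra_simps)
    have "pt a B E 0 \<beta> = A + F \<beta>" by (simp add: F_def)
    from conv[OF b pk(1)[unfolded this]] have 2: "pt A B' (F \<beta>) (k * x) (k * k + L/2) \<in> C" by (simp add: pt_def algebra_simps flip: k(3))
    have "0 \<le> k * x" using H(4)[OF 1 2] xl by simp
    then have "0 \<le> x" using k by (simp add: zero_le_mult_iff)
    then show ?thesis using L by (simp add: x_def zero_le_divide_iff)
  qed
  have high: "1 \<le> yr + L/2 + k * (\<beta> + L/2 - yr)"
  proof -
    define y where "y = \<beta> + L/2"
    have "pt a B E 0 (y + L/2) \<in> C" using pk(2) by (simp add: y_def add.assoc)
    then have h: "half_par K (L *\<^sub>R E) A (pt a B E 0 y) (pt a B E 0 \<beta>)" using half[of y] mid by (simp add: y_def)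
    obtain s y0 xr where H: "pt a B E 0 \<beta> = pt A B' (F y) (-s) y0" "1 \<le> xr" "0 \<le> 2 - s - xr"
      "\<And>x y'. pt A B' (F y) x y' \<in> C \<Longrightarrow> pt A B' (F y) x (y' + L/2) \<in> C \<Longrightarrow> x \<le> xr"
      by (rule loose_half_par[OF K lo h, folded B'_def C_def L_def, unfolded Feq]) blast
    \<comment> \<open>For the highest choice the long chord starts one unit to the left of the
      corner, so \<open>s = 1\<close> and the right bound is \<open>xr = 1\<close>.\<close>
    have "pt a B E 0 \<beta> = pt A B' (F y) (-1) 1" by (simp add: pt_def[of A] F_def y_def) (simp add: pt_def B'_def algebra_simps)
    then have "-s = -1" using H(1) pt_inject(1)[of B' "F y" A "-s" y0 "-1" 1] Fpos[of y] by auto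
    then have xr: "xr = 1" using H by simp
    define x where "x = (1 - yr - k * (y - yr)) / (L / 2)"
    have b: "pt A B' (F y) x k \<in> C" using bc(2) coord[of 1 y] by (simp add: x_def)
    have "k *\<^sub>R pt A B' (F y) x k + (1 - k) *\<^sub>R (A + B') \<in> C" by (rule conv[OF b AC(2)])
    then have 1: "pt A B' (F y) (k * x + (1 - k)) (k * k) \<in> C" by (simp add: pt_def algebra_simps)
    have "pt a B E 0 (\<beta> + L) = A + B' + F y"
      by (simp add: F_def y_def) (simp add: pt_def B'_def algebra_simps flip: scaleR_add_left)
    from conv[OF b pk(2)[unfolded this]] have 2: "pt A B' (F y) (k * x + (1 - k)) (k * k + L/2) \<in> C" by (simp add: pt_def algebra_simps flip: k(3))
    have "k * x + (1 - k) \<le> 1" using H(4)[OF 1 2] xr by simp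
    then have "k * x \<le> k * 1" by linarith
    then have "x \<le> 1" using k(1) mult_le_cancel_left_pos by blast
    then have "1 - yr - k * (y - yr) \<le> L / 2" using L by (simp add: x_def divide_le_eq)
    then show ?thesis by (simp add: y_def)
  qed
  \<comment> \<open>\<open>low\<close> and \<open>high\<close> confine the unit chord at level 1 to
    the trapezoid between the chord of length \<open>L\<close> at level 0 and the half chord at
    level \<open>sqrt 3\<close>. The section of that trapezoid has length only
    \<open>1 - k\<^sup>2\<close>.\<close>
  have "1 \<le> L/2 + k * (L/2)" using low high by (simp add: algebra_simps)
  also have "\<dots> = (1 - k) * (1 + k)" by (simp add: algebra_simps flip: k(3))
  also have "\<dots> = 1 - k\<^sup>2" by (simp add: algebra_simps power2_eq_square)
  finally show False using k by simp
qed


lemma not_loose: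
  fixes K :: "(real^2) set"
  assumes K: "open K" "convex K" "bounded K" "K \<noteq> {}"
  shows "\<not> loose K"
proof
  assume lo: "loose K"
  define C where "C = closure K"
  define L where "L = 2 / sqrt 3"
  define \<kappa> where "\<kappa> = measure lebesgue K / sqrt 3"
  have \<kappa>: "\<kappa> > 0" unfolding \<kappa>_def using measure_open_pos[OF K(1,3,4)] by simp
  have sqrt3: "sqrt 3 < 2" by (rule real_less_lsqrt) auto
  then have L1: "L > 1" by (simp add: L_def field_simps)
  have C: "compact C" "convex C" unfolding C_def using K by (auto simp: compact_closure intro: convex_closure)
  have C0: "C \<noteq> {}" using K by (simp add: C_def)
  have KC: "K \<subseteq> C" unfolding C_def by (rule closure_subset)
  obtain w e0 where sm0: "smooth_at K w e0" using smooth_at_exists[OF K(1,3,4)] .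
  have w0: "w \<noteq> 0" using sm0 by (simp add: smooth_at_def)
  have "continuous_on C (cross2 w)" by (intro continuous_intros)
  from continuous_attains_sup[OF C(1) C0 this]
  \<comment> \<open>A point farthest from the tangent. A chord from the tangent line to
    \<open>f\<close> spans the whole width of \<open>K\<close>, so it is a longest chord of its
    direction; one \<open>f\<close> serves for all starting points with tangent
    \<open>w\<close>.\<close>
  obtain f where f: "f \<in> C" "\<And>z. z \<in> C \<Longrightarrow> cross2 w z \<le> cross2 w f" by blast
  have hp: "\<exists>a d. half_par K (f - e) a d e" if sm: "smooth_at K w e" for e
  proof -
    have "x + (f - e) \<notin> K" if x: "x \<in> K" for x
    proof
      assume "x + (f - e) \<in> K"
      then have "cross2 w (x + (f - e)) \<le> cross2 w f" using f(2) KC by blast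
      then show False using smooth_at_halfplane[OF K(1,2) sm x] by simp
    qed
    moreover have "e \<in> closure K" "e + (f - e) \<in> closure K" using sm f by (auto simp: smooth_at_def C_def)
    ultimately show ?thesis using half_par_exists[OF K, of e "f - e"] by metis
  qed
  \<comment> \<open>The first application of \<open>loose_smooth\<close> only serves to find an edge
    on the tangent line.\<close>
  obtain P r where P: "P \<in> C" "P + r *\<^sub>R w \<in> C" "cross2 w (P - e0) = 0" "r \<noteq> 0"
  proof -
    obtain a d where h: "half_par K (f - e0) a d e0" using hp[OF sm0] by blast
    define B where "B = (1/2) *\<^sub>R (f - e0)"
    define E where "E = d - a"
    obtain s y0 yl where H: "cross2 E w = 0" "cross2 B E = \<kappa>" "e0 = pt a B E (-s) y0"
      "pt a B E (-s) yl \<in> C" "pt a B E (-s) (yl + L/2) \<in> C"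
      by (rule loose_smooth[OF K lo h sm0, folded C_def L_def \<kappa>_def B_def E_def]) blast
    obtain \<mu> where \<mu>: "E = \<mu> *\<^sub>R w" using cross2_parallel[OF w0 H(1)] .
    show thesis
    proof (rule that[of "pt a B E (-s) yl" "(L/2) * \<mu>"])
      have "pt a B E (-s) yl + (L / 2 * \<mu>) *\<^sub>R w = pt a B E (-s) (yl + L/2)"
        by (simp add: pt_def \<mu> algebra_simps)
      then show "pt a B E (-s) yl + (L / 2 * \<mu>) *\<^sub>R w \<in> C" using H(5) by simp
      show "cross2 w (pt a B E (-s) yl - e0) = 0" by (simp add: H(3) pt_def \<mu>)
      show "L / 2 * \<mu> \<noteq> 0" using H(2) \<kappa> L1 by (auto simp: \<mu>)
    qed (rule H)
  qed
  \<comment> \<open>\<open>E\<close> is parallel to \<open>w\<close> and satisfies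
    \<open>cross2 B E = \<kappa>\<close>. Since \<open>U\<close> is the same for all starting points
    on the edge, these two facts give all of them the same \<open>E\<close>.\<close>
  define U where "U = cross2 (f - P) w"
  have cfg: "\<exists>a s t \<beta> yl yr. let E = (2 * \<kappa> / U) *\<^sub>R w; B = (1/2) *\<^sub>R (f - e) in
      cross2 B E = \<kappa> \<and> {a, a + E, a + B, a + B + E} \<subseteq> C - K \<and>
      cross2 e E = cross2 a E - s * \<kappa> \<and> cross2 f E = cross2 a E + (2 - s) * \<kappa> \<and>
      pt a B E t \<beta> \<in> C \<and> pt a B E t (\<beta> + L) \<in> C \<and> 0 \<le> t \<and> t \<le> 1 \<and> 0 \<le> s \<and> s < 1 \<and>
      (\<forall>n m. pt a B E 0 n \<in> C \<longrightarrow> pt a B E 0 (n + m) \<in> C \<longrightarrow> (m - 1) * (t + s) \<le> 0) \<and>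
      half_par K (L *\<^sub>R E) (pt a B E (sqrt 3 - s) yr) (pt a B E (-s) yl) (pt a B E t \<beta>)"
    if sm: "smooth_at K w e" and eP: "e = P + q *\<^sub>R w" for e q
  proof -
    obtain a d where h: "half_par K (f - e) a d e" using hp[OF sm] by blast
    define B where "B = (1/2) *\<^sub>R (f - e)"
    define E where "E = d - a"
    obtain s y0 t \<beta> yl xr yr where H: "cross2 E w = 0" "cross2 B E = \<kappa>"
      "e = pt a B E (-s) y0" "f = pt a B E (2-s) y0"
      "pt a B E t \<beta> \<in> C" "pt a B E t (\<beta> + L) \<in> C" "0 \<le> t" "t \<le> 1" "0 \<le> s" "xr = sqrt 3 - s" "1 \<le> xr"
      and mm: "\<And>n m. pt a B E 0 n \<in> C \<Longrightarrow> pt a B E 0 (n + m) \<in> C \<Longrightarrow> (m - 1) * (t + s) \<le> 0"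
      and hq: "half_par K (L *\<^sub>R E) (pt a B E xr yr) (pt a B E (-s) yl) (pt a B E t \<beta>)"
      by (rule loose_smooth[OF K lo h sm, folded C_def L_def \<kappa>_def B_def E_def]) blast
    obtain \<mu> where \<mu>: "E = \<mu> *\<^sub>R w" using cross2_parallel[OF w0 H(1)] .
    have "cross2 B E = \<mu> / 2 * U" by (simp add: B_def \<mu> eP U_def)
    then have "\<mu> * U = 2 * \<kappa>" using H(2) by simp
    then have EU: "E = (2 * \<kappa> / U) *\<^sub>R w" using \<kappa> by (metis \<mu> divisors_zero less_irrefl nonzero_eq_divide_eq mult_eq_0_iff zero_neq_numeral)
    have "s < 1" using H(10,11) sqrt3 by simp
    moreover have "d = a + E" by (simp add: E_def)
    then have "{a, a + E, a + B, a + B + E} \<subseteq> C - K"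
      using h by (auto simp: half_par_def C_def B_def algebra_simps)
    moreover have "cross2 e E = cross2 a E - s * \<kappa>" "cross2 f E = cross2 a E + (2 - s) * \<kappa>"
      by (simp_all only: H(3,4) pt_def) (simp_all add: H(2))
    ultimately show ?thesis
      unfolding Let_def EU[symmetric] B_def[symmetric] using H mm hq by blast
  qed
  define E where "E = (2 * \<kappa> / U) *\<^sub>R w"
  \<comment> \<open>The points at one and two thirds lie strictly inside the edge, so both are
    smooth.\<close>
  define e1 where "e1 = P + (1/3 * r) *\<^sub>R w"
  define e2 where "e2 = P + (2/3 * r) *\<^sub>R w"
  have sm: "smooth_at K w e1" "smooth_at K w e2"
    unfolding e1_def e2_def using P unfolding C_def
    by (intro smooth_at_segment[OF K(1,2,4) sm0]; simp)+
  define B1 where "B1 = (1/2) *\<^sub>R (f - e1)"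
  define B2 where "B2 = (1/2) *\<^sub>R (f - e2)"
  obtain a1 s1 t1 \<beta>1 yl1 yr1 where H1: "cross2 B1 E = \<kappa>" "{a1, a1 + E, a1 + B1, a1 + B1 + E} \<subseteq> C - K"
      "cross2 e1 E = cross2 a1 E - s1 * \<kappa>" "cross2 f E = cross2 a1 E + (2 - s1) * \<kappa>"
      "pt a1 B1 E t1 \<beta>1 \<in> C" "pt a1 B1 E t1 (\<beta>1 + L) \<in> C" "0 \<le> t1" "t1 \<le> 1" "0 \<le> s1" "s1 < 1"
      "\<forall>n m. pt a1 B1 E 0 n \<in> C \<longrightarrow> pt a1 B1 E 0 (n + m) \<in> C \<longrightarrow> (m - 1) * (t1 + s1) \<le> 0"
      "half_par K (L *\<^sub>R E) (pt a1 B1 E (sqrt 3 - s1) yr1) (pt a1 B1 E (-s1) yl1) (pt a1 B1 E t1 \<beta>1)"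
    using cfg[OF sm(1) e1_def] unfolding Let_def E_def[symmetric] B1_def[symmetric] by blast
  obtain a2 s2 t2 \<beta>2 where H2: "cross2 B2 E = \<kappa>" "{a2, a2 + E, a2 + B2, a2 + B2 + E} \<subseteq> C - K"
      "cross2 e2 E = cross2 a2 E - s2 * \<kappa>" "cross2 f E = cross2 a2 E + (2 - s2) * \<kappa>"
      "pt a2 B2 E t2 \<beta>2 \<in> C" "pt a2 B2 E t2 (\<beta>2 + L) \<in> C" "0 \<le> t2" "t2 \<le> 1" "0 \<le> s2" "s2 < 1"
    using cfg[OF sm(2) e2_def] unfolding Let_def E_def[symmetric] B2_def[symmetric] by blast
  have lev: "cross2 e1 E = cross2 e2 E" by (simp add: e1_def e2_def E_def)
  have eC: "e1 \<in> closure K" "e2 \<in> closure K" "f \<in> closure K" using sm f by (auto simp: smooth_at_def C_def)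
  have "\<not> s1 < s2"
  proof
    assume "s1 < s2"
    show False
    proof (rule loose_level_unique[OF K(1,2,4), of B2 E e2 f a2 s2 s1 a1 "pt a2 B2 E t2 \<beta>2" L t2])
      show "pt a2 B2 E t2 \<beta>2 + L *\<^sub>R E \<in> closure K" using H2(6) by (simp add: pt_def C_def algebra_simps)
      show "cross2 a1 E = cross2 a2 E + (s1 - s2) * cross2 B2 E"
        using H1(3) H2(3) lev by (simp add: H2(1) algebra_simps)
    qed (use \<kappa> H1 H2 eC \<open>s1 < s2\<close> L1 in \<open>auto simp: C_def pt_def\<close>)
  qed
  moreover have "\<not> s2 < s1"
  proof
    assume "s2 < s1"
    show False
    proof (rule loose_level_unique[OF K(1,2,4), of B1 E e1 f a1 s1 s2 a2 "pt a1 B1 E t1 \<beta>1" L t1])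
      show "pt a1 B1 E t1 \<beta>1 + L *\<^sub>R E \<in> closure K" using H1(6) by (simp add: pt_def C_def algebra_simps)
      show "cross2 a2 E = cross2 a1 E + (s2 - s1) * cross2 B1 E"
        using H1(3) H2(3) lev by (simp add: H1(1) algebra_simps)
    qed (use \<kappa> H1 H2 eC \<open>s2 < s1\<close> L1 in \<open>auto simp: C_def pt_def\<close>)
  qed
  ultimately have ss: "s2 = s1" by simp
  have la: "cross2 a2 E = cross2 a1 E" using H1(3) H2(3) lev ss by simp
  have D1: "cross2 B1 E \<noteq> 0" using H1(1) \<kappa> by simp
  \<comment> \<open>On a line that meets the interior, the boundary chord is unique, so its starting
    point is determined.\<close>
  have same: "y = x" if x: "{x, x + E} \<subseteq> C - K" and y: "{y, y + E} \<subseteq> C - K" and l: "cross2 y E = cross2 x E"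
    and lx: "cross2 e1 E < cross2 x E" "cross2 x E < cross2 f E" for x y
  proof -
    obtain z where z: "z \<in> K" "cross2 z E = cross2 x E"
      using cross2_level_meets[OF K(1,2,4) eC(1,3) lx] by blast
    obtain \<zeta> where \<zeta>: "z = x + \<zeta> *\<^sub>R E" using cross2_level_coord[OF D1 z(2)] .
    obtain \<tau> where \<tau>: "y = x + \<tau> *\<^sub>R E" using cross2_level_coord[OF D1 l] .
    have xb: "x \<in> closure K - K" "x + E \<in> closure K - K" using x by (auto simp: C_def)
    have y1: "x + (\<tau> + 1) *\<^sub>R E \<in> closure K" and y0: "x + \<tau> *\<^sub>R E \<in> closure K"
      using y by (simp_all add: \<tau> C_def algebra_simps)
    note ex = chord_exact[OF K(1,2) xb z(1)[unfolded \<zeta>]]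
    have "\<tau> = 0" using ex(1)[OF y0] ex(2)[OF y1] by simp
    then show ?thesis by (simp add: \<tau>)
  qed
  \<comment> \<open>Because \<open>s1 < 1\<close>, level 1 lies strictly between the edge and
    \<open>f\<close>; the far sides of the two parallelograms coincide. The near corners then differ
    by half the shift of the starting point.\<close>
  have ab: "a2 + B2 = a1 + B1"
  proof (rule same)
    show "cross2 (a2 + B2) E = cross2 (a1 + B1) E" using la H1(1) H2(1) by simp
    have "s1 * \<kappa> \<ge> 0" "(2 - s1) * \<kappa> > 1 * \<kappa>" using H1(9,10) \<kappa> by (auto intro!: mult_strict_right_mono)
    then show "cross2 e1 E < cross2 (a1 + B1) E" "cross2 (a1 + B1) E < cross2 f E"
      using H1(1,3,4) \<kappa> by auto
  qed (use H1(2) H2(2) in auto)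
  have ee: "e2 - e1 = (1/3 * r) *\<^sub>R w" by (simp add: e1_def e2_def algebra_simps flip: scaleR_add_left)
  have aa: "a2 - a1 = (1/6 * r) *\<^sub>R w"
  proof -
    have "a2 - a1 = B1 - B2" using ab by (simp add: algebra_simps)
    also have "\<dots> = (1/2) *\<^sub>R (e2 - e1)" by (simp add: B1_def B2_def algebra_simps)
    finally show ?thesis by (simp add: ee)
  qed
  then have a12: "a2 \<noteq> a1" using P(4) w0 by auto
  \<comment> \<open>For positive \<open>s1\<close> the line through \<open>a1\<close> would also
    meet the interior, which would force \<open>a2 = a1\<close>.\<close>
  have s0: "s1 = 0"
  proof (rule ccontr)
    assume "s1 \<noteq> 0"
    then have "s1 * \<kappa> > 0" "(2 - s1) * \<kappa> > 0" using H1(9,10) \<kappa> by auto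
    then have "a2 = a1" using H1 H2 la by (intro same) auto
    then show False using a12 by simp
  qed
  obtain \<tau> where \<tau>: "a2 = a1 + \<tau> *\<^sub>R E" using cross2_level_coord[OF D1 la] .
  have \<tau>0: "\<tau> \<noteq> 0" using a12 \<tau> by auto
  \<comment> \<open>The line at level 0 carries both sides of length 1, shifted by
    \<open>\<tau>\<close>, hence a chord longer than 1. By the surplus condition the longest chord
    must lie there too.\<close>
  have "\<bar>\<tau>\<bar> * t1 \<le> 0"
  proof (cases "\<tau> > 0")
    case True
    have "pt a1 B1 E 0 0 \<in> C" using H1(2) by (simp add: pt_def)
    moreover have "pt a1 B1 E 0 (0 + (1 + \<tau>)) \<in> C" using H2(2) by (simp add: pt_def \<tau> algebra_simps)
    ultimately have "((1 + \<tau>) - 1) * (t1 + s1) \<le> 0" using H1(11) by blast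
    then show ?thesis using True s0 by simp
  next
    case False
    have "pt a1 B1 E 0 \<tau> \<in> C" using H2(2) by (simp add: pt_def \<tau>)
    moreover have "pt a1 B1 E 0 (\<tau> + (1 - \<tau>)) \<in> C" using H1(2) by (simp add: pt_def)
    ultimately have "((1 - \<tau>) - 1) * (t1 + s1) \<le> 0" using H1(11) by blast
    then show ?thesis using False s0 by simp
  qed
  then have t0: "t1 = 0" using \<tau>0 H1(7) by (simp add: mult_le_0_iff)
  show False
  proof (rule loose_boundary_chord[OF K lo, folded L_def C_def])
    show "cross2 B1 E > 0" using H1(1) \<kappa> by simp
    show "pt a1 B1 E 0 y \<notin> K" for y
    proof
      assume A: "pt a1 B1 E 0 y \<in> K"
      have "cross2 E (a1 - e1) = 0" using H1(3) s0 cross2_commute[of E a1] cross2_commute[of E e1] by simp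
      then have "U \<noteq> 0 \<Longrightarrow> cross2 w (a1 - e1) = 0" using \<kappa> by (simp add: E_def)
      moreover have "U \<noteq> 0" using H1(1) \<kappa> by (auto simp: E_def)
      ultimately have "cross2 w (pt a1 B1 E 0 y - e1) = 0" by (simp add: pt_def E_def)
      then show False using smooth_at_halfplane[OF K(1,2) sm(1) A] by simp
    qed
    show "pt a1 B1 E 1 0 \<in> C" "pt a1 B1 E 1 1 \<in> C" using H1(2) by (auto simp: pt_def)
    show "pt a1 B1 E 0 \<beta>1 \<in> C" "pt a1 B1 E 0 (\<beta>1 + L) \<in> C" using H1(5,6) t0 by auto
    show "half_par K (L *\<^sub>R E) (pt a1 B1 E (sqrt 3) yr1) (pt a1 B1 E 0 yl1) (pt a1 B1 E 0 \<beta>1)"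
      using H1(12) by (simp add: t0 s0)
  qed
qed

text \<open>Reflection in \<open>a\<close> sends \<open>x\<close> to \<open>2 a - x\<close>, whence
  \<open>z = 2 a\<close>. A common point of \<open>K\<close> and a reflected copy is a relation
  \<open>x + y = z + ...\<close>, which is why sums appear in the last claim.\<close>

theorem double_lattice_packing:
  fixes K :: "(real^2) set"
  assumes K: "open K" "convex K" "bounded K" "K \<noteq> {}"
  obtains v w z where "0 < cross2 v w" "cross2 v w < 4 * measure lebesgue K / sqrt 3"
    "\<And>x i j. \<lbrakk>x \<in> K; (i, j) \<noteq> (0, 0)\<rbrakk> \<Longrightarrow> x + of_int i *\<^sub>R v + of_int j *\<^sub>R w \<notin> K"
    "\<And>x y i j. \<lbrakk>x \<in> K; y \<in> K\<rbrakk> \<Longrightarrow> x + y \<noteq> z + of_int i *\<^sub>R v + of_int j *\<^sub>R w"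
proof -
  obtain v a d e where h: "half_par K v a d e" "cross2 v (d - a) < 2 * (measure lebesgue K / sqrt 3)"
    using not_loose[OF K] unfolding loose_def by force
  show thesis
  proof (rule that[of v "2 *\<^sub>R (d - a)" "2 *\<^sub>R a"])
    show "0 < cross2 v (2 *\<^sub>R (d - a))" using h(1) by (simp add: half_par_def)
    show "cross2 v (2 *\<^sub>R (d - a)) < 4 * measure lebesgue K / sqrt 3" using h(2) by simp
  qed (use half_par_packing[OF K(1,2) h(1)] in blast)+
qed

section \<open>Square-integrable functions and the modes of a square\<close>

definition sq_integrable :: "'a measure \<Rightarrow> ('a \<Rightarrow> real) \<Rightarrow> bool" where
  "sq_integrable M f \<longleftrightarrow> f \<in> borel_measurable M \<and> integrable M (\<lambda>x. (f x)\<^sup>2)"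

lemma sq_integrable_mult:
  assumes "sq_integrable M f" "sq_integrable M g"
  shows "integrable M (\<lambda>x. f x * g x)"
proof (rule Bochner_Integration.integrable_bound)
  show "integrable M (\<lambda>x. (f x)\<^sup>2 + (g x)\<^sup>2)" using assms by (auto simp: sq_integrable_def)
  show "(\<lambda>x. f x * g x) \<in> borel_measurable M" using assms by (auto simp: sq_integrable_def)
  have "\<bar>a * b\<bar> \<le> a\<^sup>2 + b\<^sup>2" for a b :: real
  proof -
    have "2 * (\<bar>a\<bar> * \<bar>b\<bar>) \<le> a\<^sup>2 + b\<^sup>2" using sum_squares_bound[of "\<bar>a\<bar>" "\<bar>b\<bar>"] by simp
    moreover have "0 \<le> \<bar>a\<bar> * \<bar>b\<bar>" by simp
    ultimately show ?thesis unfolding abs_mult by linarith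
  qed
  then show "AE x in M. norm (f x * g x) \<le> norm ((f x)\<^sup>2 + (g x)\<^sup>2)" by auto
qed

lemma sq_integrable_cmult: "sq_integrable M f \<Longrightarrow> sq_integrable M (\<lambda>x. c * f x)"
  by (auto simp: sq_integrable_def power_mult_distrib)

lemma sq_integrable_add:
  assumes "sq_integrable M f" "sq_integrable M g" shows "sq_integrable M (\<lambda>x. f x + g x)"
proof -
  have "(\<lambda>x. (f x + g x)\<^sup>2) = (\<lambda>x. (f x)\<^sup>2 + (g x)\<^sup>2 + 2 * (f x * g x))"
    by (auto simp: power2_eq_square algebra_simps)
  then show ?thesis using assms sq_integrable_mult[OF assms] by (auto simp: sq_integrable_def)
qed

lemma sq_integrable_diff:
  assumes "sq_integrable M f" "sq_integrable M g" shows "sq_integrable M (\<lambda>x. f x - g x)"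
  using sq_integrable_add[OF assms(1) sq_integrable_cmult[OF assms(2), of "-1"]] by simp

lemma sq_integrable_sum:
  assumes "\<And>i. i \<in> I \<Longrightarrow> sq_integrable M (f i)" shows "sq_integrable M (\<lambda>x. \<Sum>i\<in>I. f i x)"
  using assms
proof (induction I rule: infinite_finite_induct)
  case (insert i I) then show ?case by (simp add: sq_integrable_add)
qed (auto simp: sq_integrable_def)

lemma sq_integrable_Cauchy_Schwarz:
  assumes f: "sq_integrable M f" and g: "sq_integrable M g"
  shows "(\<integral>x. f x * g x \<partial>M)\<^sup>2 \<le> (\<integral>x. (f x)\<^sup>2 \<partial>M) * (\<integral>x. (g x)\<^sup>2 \<partial>M)"
proof -
  define A B C where "A = (\<integral>x. (f x)\<^sup>2 \<partial>M)" and "B = (\<integral>x. f x * g x \<partial>M)" and "C = (\<integral>x. (g x)\<^sup>2 \<partial>M)"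
  have i: "integrable M (\<lambda>x. (f x)\<^sup>2)" "integrable M (\<lambda>x. (g x)\<^sup>2)" "integrable M (\<lambda>x. f x * g x)"
    using f g sq_integrable_mult by (auto simp: sq_integrable_def)
  have C0: "C \<ge> 0" by (simp add: C_def)
  have q: "0 \<le> A + 2 * t * B + t\<^sup>2 * C" for t
  proof -
    have "0 \<le> (\<integral>x. (f x + t * g x)\<^sup>2 \<partial>M)" by simp
    also have "\<dots> = (\<integral>x. (f x)\<^sup>2 + (2 * t) * (f x * g x) + t\<^sup>2 * (g x)\<^sup>2 \<partial>M)"
      by (intro Bochner_Integration.integral_cong) (auto simp: power2_eq_square algebra_simps)
    also have "\<dots> = A + 2 * t * B + t\<^sup>2 * C"
      using i by (simp add: A_def B_def C_def)
    finally show ?thesis .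
  qed
  have "B\<^sup>2 \<le> A * C"
  proof (cases "C = 0")
    case True
    have "B = 0"
    proof (rule ccontr)
      assume "B \<noteq> 0"
      then show False using q[of "- (A + 1) / (2 * B)"] True by (simp add: field_simps)
    qed
    then show ?thesis using True by simp
  next
    case False
    then show ?thesis using q[of "- B / C"] C0 by (simp add: field_simps power2_eq_square)
  qed
  then show ?thesis by (simp add: A_def B_def C_def)
qed

lemma sq_integrable_tendsto_mult:
  assumes a: "\<And>n. sq_integrable M (a n)" and b: "\<And>n. sq_integrable M (b n)"
    and f: "sq_integrable M f" and g: "sq_integrable M g"
    and af: "(\<lambda>n. \<integral>x. (a n x - f x)\<^sup>2 \<partial>M) \<longlonglongrightarrow> 0" and bg: "(\<lambda>n. \<integral>x. (b n x - g x)\<^sup>2 \<partial>M) \<longlonglongrightarrow> 0"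
  shows "(\<lambda>n. \<integral>x. a n x * b n x \<partial>M) \<longlonglongrightarrow> (\<integral>x. f x * g x \<partial>M)"
proof -
  note af' = sq_integrable_diff[OF a f] and bg' = sq_integrable_diff[OF b g]
  have z: "c \<longlonglongrightarrow> 0" if "\<And>n. (c n)\<^sup>2 \<le> d n" "d \<longlonglongrightarrow> 0" for c d :: "nat \<Rightarrow> real"
  proof -
    have "(\<lambda>n. (c n)\<^sup>2) \<longlonglongrightarrow> 0"
      by (rule tendsto_sandwich[OF _ _ tendsto_const that(2)]) (use that(1) in auto)
    then have "(\<lambda>n. sqrt ((c n)\<^sup>2)) \<longlonglongrightarrow> sqrt 0" by (rule tendsto_real_sqrt)
    then show ?thesis by (simp add: tendsto_rabs_zero_iff)
  qed
  have 1: "(\<lambda>n. \<integral>x. (a n x - f x) * (b n x - g x) \<partial>M) \<longlonglongrightarrow> 0"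
    by (rule z[OF sq_integrable_Cauchy_Schwarz[OF af' bg']]) (use tendsto_mult[OF af bg] in simp)
  have 2: "(\<lambda>n. \<integral>x. (a n x - f x) * g x \<partial>M) \<longlonglongrightarrow> 0"
    by (rule z[OF sq_integrable_Cauchy_Schwarz[OF af' g]]) (use tendsto_mult_right[OF af] in simp)
  have 3: "(\<lambda>n. \<integral>x. (b n x - g x) * f x \<partial>M) \<longlonglongrightarrow> 0"
    by (rule z[OF sq_integrable_Cauchy_Schwarz[OF bg' f]]) (use tendsto_mult_right[OF bg] in simp)
  have "(\<integral>x. a n x * b n x \<partial>M) = (\<integral>x. (a n x - f x) * (b n x - g x) \<partial>M) + (\<integral>x. (a n x - f x) * g x \<partial>M)
     + (\<integral>x. (b n x - g x) * f x \<partial>M) + (\<integral>x. f x * g x \<partial>M)" for n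
  proof -
    have "(\<integral>x. a n x * b n x \<partial>M) = (\<integral>x. (a n x - f x) * (b n x - g x) + (a n x - f x) * g x + (b n x - g x) * f x + f x * g x \<partial>M)"
      by (intro Bochner_Integration.integral_cong) (auto simp: algebra_simps)
    then show ?thesis
      using sq_integrable_mult[OF af' bg', of n n] sq_integrable_mult[OF af' g, of n] sq_integrable_mult[OF bg' f, of n] sq_integrable_mult[OF f g]
      by simp
  qed
  then show ?thesis using tendsto_add[OF tendsto_add[OF tendsto_add[OF 1 2] 3] tendsto_const] by simp
qed

text \<open>Fourier coefficients give the best approximation, so any choice of \<open>a\<close>
  bounds the loss in Bessel's inequality. A uniform approximation thereby becomes an approximate
  Parseval identity, without a detour through completeness.\<close>

lemma Bessel_defect:
  fixes e :: "'i \<Rightarrow> 'a \<Rightarrow> real" and a :: "'i \<Rightarrow> real"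
  assumes F: "finite F" and f: "sq_integrable M f" and e: "\<And>i. i \<in> F \<Longrightarrow> sq_integrable M (e i)"
    and on: "\<And>i j. i \<in> F \<Longrightarrow> j \<in> F \<Longrightarrow> (\<integral>x. e i x * e j x \<partial>M) = (if i = j then 1 else 0)"
  shows "(\<integral>x. (f x)\<^sup>2 \<partial>M) - (\<Sum>i\<in>F. (\<integral>x. f x * e i x \<partial>M)\<^sup>2) \<le> (\<integral>x. (f x - (\<Sum>i\<in>F. a i * e i x))\<^sup>2 \<partial>M)"
proof -
  define c where "c = (\<lambda>i. \<integral>x. f x * e i x \<partial>M)"
  define S where "S = (\<lambda>x. \<Sum>i\<in>F. a i * e i x)"
  have S: "sq_integrable M S" unfolding S_def by (intro sq_integrable_sum sq_integrable_cmult e)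
  have fS: "(\<integral>x. f x * S x \<partial>M) = (\<Sum>i\<in>F. a i * c i)"
  proof -
    have "(\<integral>x. f x * S x \<partial>M) = (\<integral>x. (\<Sum>i\<in>F. a i * (f x * e i x)) \<partial>M)"
      by (simp add: S_def sum_distrib_left algebra_simps)
    also have "\<dots> = (\<Sum>i\<in>F. a i * c i)"
      using sq_integrable_mult[OF f e] by (subst Bochner_Integration.integral_sum) (auto simp: c_def)
    finally show ?thesis .
  qed
  have Se: "(\<integral>x. S x * e i x \<partial>M) = a i" if i: "i \<in> F" for i
  proof -
    have "(\<integral>x. S x * e i x \<partial>M) = (\<integral>x. (\<Sum>j\<in>F. a j * (e j x * e i x)) \<partial>M)"
      by (simp add: S_def sum_distrib_left sum_distrib_right algebra_simps)
    also have "\<dots> = (\<Sum>j\<in>F. a j * (if j = i then 1 else 0))"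
      using sq_integrable_mult[OF e e] i by (subst Bochner_Integration.integral_sum) (auto simp: on)
    finally show ?thesis using F i by (simp add: sum.delta if_distrib[of "\<lambda>t. _ * t"] cong: if_cong)
  qed
  have SS: "(\<integral>x. S x * S x \<partial>M) = (\<Sum>i\<in>F. (a i)\<^sup>2)"
  proof -
    have "(\<integral>x. S x * S x \<partial>M) = (\<integral>x. (\<Sum>i\<in>F. a i * (S x * e i x)) \<partial>M)"
      by (intro Bochner_Integration.integral_cong) (auto simp: S_def sum_distrib_left algebra_simps)
    also have "\<dots> = (\<Sum>i\<in>F. a i * a i)"
      using sq_integrable_mult[OF S e] Se by (subst Bochner_Integration.integral_sum) auto
    finally show ?thesis by (simp add: power2_eq_square)
  qed
  have "(\<integral>x. (f x - S x)\<^sup>2 \<partial>M) = (\<integral>x. (f x)\<^sup>2 - 2 * (f x * S x) + S x * S x \<partial>M)"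
    by (intro Bochner_Integration.integral_cong) (auto simp: power2_eq_square algebra_simps)
  also have "\<dots> = (\<integral>x. (f x)\<^sup>2 \<partial>M) - 2 * (\<Sum>i\<in>F. a i * c i) + (\<Sum>i\<in>F. (a i)\<^sup>2)"
    using f sq_integrable_mult[OF f S] sq_integrable_mult[OF S S] by (simp add: fS SS sq_integrable_def)
  finally have eq: "(\<integral>x. (f x - S x)\<^sup>2 \<partial>M) = \<dots>" .
  have "0 \<le> (\<Sum>i\<in>F. (a i - c i)\<^sup>2)" by (intro sum_nonneg) auto
  also have "\<dots> = (\<Sum>i\<in>F. (a i)\<^sup>2) - 2 * (\<Sum>i\<in>F. a i * c i) + (\<Sum>i\<in>F. (c i)\<^sup>2)"
    by (simp add: power2_diff sum.distrib sum_subtractf sum_distrib_left algebra_simps)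
  finally show ?thesis using eq by (simp add: S_def c_def)
qed

text \<open>Cauchy-Schwarz between \<open>f\<close> and its projection \<open>S\<close>; the norm of
  \<open>S\<close> is bounded by applying \<open>Bessel_defect\<close> to \<open>S\<close>
  itself.\<close>

lemma Bessel_inequality:
  fixes e :: "'i \<Rightarrow> 'a \<Rightarrow> real"
  assumes F: "finite F" and f: "sq_integrable M f" and e: "\<And>i. i \<in> F \<Longrightarrow> sq_integrable M (e i)"
    and on: "\<And>i j. i \<in> F \<Longrightarrow> j \<in> F \<Longrightarrow> (\<integral>x. e i x * e j x \<partial>M) = (if i = j then 1 else 0)"
  shows "(\<Sum>i\<in>F. (\<integral>x. f x * e i x \<partial>M)\<^sup>2) \<le> (\<integral>x. (f x)\<^sup>2 \<partial>M)"
proof -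
  define c where "c = (\<lambda>i. \<integral>x. f x * e i x \<partial>M)"
  define S where "S = (\<lambda>x. \<Sum>i\<in>F. c i * e i x)"
  have S: "sq_integrable M S" unfolding S_def by (intro sq_integrable_sum sq_integrable_cmult e)
  have "(\<integral>x. f x * S x \<partial>M) = (\<integral>x. (\<Sum>i\<in>F. c i * (f x * e i x)) \<partial>M)"
    by (simp add: S_def sum_distrib_left algebra_simps)
  also have "\<dots> = (\<Sum>i\<in>F. (c i)\<^sup>2)"
    using sq_integrable_mult[OF f e] by (subst Bochner_Integration.integral_sum) (auto simp: c_def power2_eq_square)
  finally have fS: "(\<integral>x. f x * S x \<partial>M) = (\<Sum>i\<in>F. (c i)\<^sup>2)" .
  have "(\<integral>x. (S x)\<^sup>2 \<partial>M) - (\<Sum>i\<in>F. (\<integral>x. S x * e i x \<partial>M)\<^sup>2) \<le> (\<integral>x. (S x - S x)\<^sup>2 \<partial>M)"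
    unfolding S_def by (rule Bessel_defect[OF F S[unfolded S_def] e on])
  moreover have "(\<integral>x. S x * e i x \<partial>M) = c i" if i: "i \<in> F" for i
  proof -
    have "(\<integral>x. S x * e i x \<partial>M) = (\<integral>x. (\<Sum>j\<in>F. c j * (e j x * e i x)) \<partial>M)"
      by (simp add: S_def sum_distrib_left sum_distrib_right algebra_simps)
    also have "\<dots> = (\<Sum>j\<in>F. c j * (if j = i then 1 else 0))"
      using sq_integrable_mult[OF e e] i by (subst Bochner_Integration.integral_sum) (auto simp: on)
    finally show ?thesis using F i by (simp add: sum.delta if_distrib[of "\<lambda>t. _ * t"] cong: if_cong)
  qed
  ultimately have SS: "(\<integral>x. (S x)\<^sup>2 \<partial>M) \<le> (\<Sum>i\<in>F. (c i)\<^sup>2)" by simp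
  have "(\<Sum>i\<in>F. (c i)\<^sup>2)\<^sup>2 \<le> (\<integral>x. (f x)\<^sup>2 \<partial>M) * (\<integral>x. (S x)\<^sup>2 \<partial>M)"
    using sq_integrable_Cauchy_Schwarz[OF f S] fS by simp
  also have "\<dots> \<le> (\<integral>x. (f x)\<^sup>2 \<partial>M) * (\<Sum>i\<in>F. (c i)\<^sup>2)" using SS by (intro mult_left_mono) auto
  finally have "(\<Sum>i\<in>F. (c i)\<^sup>2) * (\<Sum>i\<in>F. (c i)\<^sup>2) \<le> (\<integral>x. (f x)\<^sup>2 \<partial>M) * (\<Sum>i\<in>F. (c i)\<^sup>2)"
    by (simp add: power2_eq_square)
  moreover have "(\<Sum>i\<in>F. (c i)\<^sup>2) \<ge> 0" "(\<integral>x. (f x)\<^sup>2 \<partial>M) \<ge> 0" by (auto intro: sum_nonneg)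
  ultimately have "(\<Sum>i\<in>F. (c i)\<^sup>2) \<le> (\<integral>x. (f x)\<^sup>2 \<partial>M)"
    by (metis mult_right_le_imp_le order_le_less)
  then show ?thesis by (simp add: c_def)
qed

section \<open>Product integrals over the square and orthogonality of sines and cosines\<close>

lemma Basis_real2: "(Basis :: (real^2) set) = {axis 1 1, axis 2 1}"
  by (auto simp: Basis_vec_def UNIV_2)

lemma axis_12_neq: "axis 1 (1::real) \<noteq> (axis 2 1 :: real^2)"
  by (simp add: axis_eq_axis)

text \<open>\<open>lborel\<close> is the image of a product measure indexed by the basis vectors,
  which reduces the claim to the product formula for integrals.\<close>

lemma integral_real2_product:
  fixes f g :: "real \<Rightarrow> real"
  assumes f: "integrable lborel f" and g: "integrable lborel g"
  shows "(\<integral>z. f (z$1) * g (z$2) \<partial>(lborel :: (real^2) measure)) = (\<integral>x. f x \<partial>lborel) * (\<integral>x. g x \<partial>lborel)"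
proof -
  interpret P: product_sigma_finite "\<lambda>_ :: real^2. lborel :: real measure" ..
  define h where "h = (\<lambda>b :: real^2. if b = axis 1 1 then f else g)"
  have [measurable]: "f \<in> borel_measurable borel" "g \<in> borel_measurable borel"
    using f g by (auto dest: borel_measurable_integrable)
  have [measurable]: "(\<lambda>z :: real^2. z $ i) \<in> borel_measurable borel" for i
    by (intro borel_measurable_continuous_onI continuous_intros)
  have "(\<integral>z. f (z$1) * g (z$2) \<partial>(lborel :: (real^2) measure))
    = (\<integral>z. f (z$1) * g (z$2) \<partial>(distr (\<Pi>\<^sub>M b\<in>(Basis :: (real^2) set). lborel) borel (\<lambda>x. \<Sum>b\<in>Basis. x b *\<^sub>R b)))"
    by (simp only: lborel_eq[symmetric])
  also have "\<dots> = (\<integral>x. f ((\<Sum>b\<in>Basis. x b *\<^sub>R b) $ 1) * g ((\<Sum>b\<in>Basis. x b *\<^sub>R b) $ 2) \<partial>(\<Pi>\<^sub>M b\<in>(Basis :: (real^2) set). lborel))"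
    by (rule integral_distr) measurable
  also have "\<dots> = (\<integral>x. (\<Prod>b\<in>Basis. h b (x b)) \<partial>(\<Pi>\<^sub>M b\<in>(Basis :: (real^2) set). lborel))"
  proof (rule arg_cong[where f = "integral\<^sup>L _"], rule ext)
    fix x :: "real^2 \<Rightarrow> real"
    have "(\<Sum>b\<in>Basis. x b *\<^sub>R b) = x (axis 1 1) *\<^sub>R axis 1 1 + x (axis 2 1) *\<^sub>R (axis 2 1 :: real^2)"
      using axis_12_neq by (simp add: Basis_real2)
    moreover have "(\<Prod>b\<in>Basis. h b (x b)) = h (axis 1 1) (x (axis 1 1)) * h (axis 2 1) (x (axis 2 1))"
      using axis_12_neq by (simp add: Basis_real2)
    moreover have "h (axis 1 1) = f" "h (axis 2 1) = g"
      using axis_12_neq unfolding h_def by presburger+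
    ultimately show "f ((\<Sum>b\<in>Basis. x b *\<^sub>R b) $ 1) * g ((\<Sum>b\<in>Basis. x b *\<^sub>R b) $ 2) = (\<Prod>b\<in>Basis. h b (x b))"
      by (simp add: axis_def)
  qed
  also have "\<dots> = (\<Prod>b\<in>(Basis :: (real^2) set). \<integral>x. h b x \<partial>lborel)"
    by (rule P.product_integral_prod) (auto simp: h_def f g)
  also have "\<dots> = (\<integral>x. f x \<partial>lborel) * (\<integral>x. g x \<partial>lborel)"
    by (simp add: Basis_real2 axis_12_neq axis_12_neq[symmetric] h_def)
  finally show ?thesis .
qed

definition square :: "real \<Rightarrow> (real^2) set" where "square M = cbox 0 (\<chi> i. M)"

lemma mem_square: "z \<in> square M \<longleftrightarrow> 0 \<le> z$1 \<and> z$1 \<le> M \<and> 0 \<le> z$2 \<and> z$2 \<le> M"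
  by (auto simp: square_def mem_box_cart forall_2)

lemma integral_square_product:
  fixes f g :: "real \<Rightarrow> real"
  assumes f: "continuous_on UNIV f" and g: "continuous_on UNIV g"
  shows "(\<integral>z. f (z$1) * g (z$2) \<partial>lebesgue_on (square M)) = integral {0..M} f * integral {0..M} g"
proof -
  have I: "integrable lborel (\<lambda>x. if x \<in> {0..M} then h x else 0)"
    "integral\<^sup>L lborel (\<lambda>x. if x \<in> {0..M} then h x else 0) = integral {0..M} h"
    if h: "continuous_on UNIV h" for h :: "real \<Rightarrow> real"
  proof -
    have i: "integrable (lebesgue_on {0..M}) h"
      by (rule continuous_imp_integrable_real) (rule continuous_on_subset[OF h], simp)
    have [measurable]: "h \<in> borel_measurable borel" by (rule borel_measurable_continuous_onI[OF h])
    have b: "(\<lambda>x. if x \<in> {0..M} then h x else 0) \<in> borel_measurable lborel" by measurable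
    show "integrable lborel (\<lambda>x. if x \<in> {0..M} then h x else 0)"
      using i Lebesgue_Measure.integrable_restrict_UNIV[of "{0..M}" h] integrable_completion[OF b] by simp
    show "integral\<^sup>L lborel (\<lambda>x. if x \<in> {0..M} then h x else 0) = integral {0..M} h"
      using integral_completion[OF b] Lebesgue_Measure.integral_restrict_UNIV[of "{0..M}" h] lebesgue_integral_eq_integral[OF i] by simp
  qed
  have [measurable]: "f \<in> borel_measurable borel" "g \<in> borel_measurable borel"
    by (rule borel_measurable_continuous_onI[OF f], rule borel_measurable_continuous_onI[OF g])
  have [measurable]: "(\<lambda>z :: real^2. z $ i) \<in> borel_measurable borel" for i
    by (intro borel_measurable_continuous_onI continuous_intros)
  have "(\<integral>z. f (z$1) * g (z$2) \<partial>lebesgue_on (square M))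
    = (\<integral>z. (if z \<in> square M then f (z$1) * g (z$2) else 0) \<partial>lebesgue)"
    by (rule Lebesgue_Measure.integral_restrict_UNIV[symmetric]) (simp add: square_def)
  also have "\<dots> = (\<integral>z. (if z$1 \<in> {0..M} then f (z$1) else 0) * (if z$2 \<in> {0..M} then g (z$2) else 0) \<partial>(lebesgue :: (real^2) measure))"
    by (intro Bochner_Integration.integral_cong) (auto simp: mem_square)
  also have "\<dots> = (\<integral>z. (if z$1 \<in> {0..M} then f (z$1) else 0) * (if z$2 \<in> {0..M} then g (z$2) else 0) \<partial>(lborel :: (real^2) measure))"
    by (rule integral_completion) measurable
  also have "\<dots> = integral {0..M} f * integral {0..M} g"
    using integral_real2_product[OF I(1)[OF f] I(1)[OF g]] I(2)[OF f] I(2)[OF g] by simp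
  finally show ?thesis .
qed

lemma integral_cos_int:
  fixes M :: real and k :: int
  assumes M: "M > 0"
  shows "((\<lambda>x. cos (of_int k * pi * x / M)) has_integral (if k = 0 then M else 0)) {0..M}"
proof (cases "k = 0")
  case True then show ?thesis using has_integral_const_real[of "1::real" 0 M] M by (simp add: real_scaleR_def)
next
  case False
  have "((\<lambda>x. cos (of_int k * pi * x / M)) has_integral
     (sin (of_int k * pi * M / M) * (M / (of_int k * pi)) - sin (of_int k * pi * 0 / M) * (M / (of_int k * pi)))) {0..M}"
  proof (rule fundamental_theorem_of_calculus)
    fix x show "((\<lambda>x. sin (of_int k * pi * x / M) * (M / (of_int k * pi))) has_vector_derivative cos (of_int k * pi * x / M)) (at x within {0..M})"
      unfolding has_real_derivative_iff_has_vector_derivative[symmetric]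
      using M False by (auto intro!: derivative_eq_intros simp: field_simps)
  qed (use M in simp)
  moreover have "sin (of_int k * pi * M / M) = 0"
  proof -
    have "of_int k * pi * M / M = of_int k * pi" using M by simp
    then show ?thesis using sin_zero_iff_int2[of "of_int k * pi"] by metis
  qed
  moreover have "sin (of_int k * pi * 0 / M) = 0" by simp
  ultimately show ?thesis using False by (simp only: if_False mult_zero_left diff_zero)
qed

lemma sin_cos_orthogonal:
  fixes M :: real and m n :: nat
  assumes M: "M > 0" and mn: "m \<ge> 1" "n \<ge> 1"
  shows "integral {0..M} (\<lambda>x. sin (m * pi * x / M) * sin (n * pi * x / M)) = (if m = n then M / 2 else 0)"
    "integral {0..M} (\<lambda>x. cos (m * pi * x / M) * cos (n * pi * x / M)) = (if m = n then M / 2 else 0)"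
proof -
  \<comment> \<open>The frequencies of the product-to-sum formulas. The sum \<open>l\<close> is
    never 0 for positive indices, and a cosine of nonzero integer frequency integrates to 0.\<close>
  define k l where "k = int m - int n" and "l = int m + int n"
  have l0: "l \<noteq> 0" using mn by (simp add: l_def)
  have kk: "k = 0 \<longleftrightarrow> m = n" by (simp add: k_def)
  have ka: "real_of_int k * pi * x / M = m * pi * x / M - n * pi * x / M"
    "real_of_int l * pi * x / M = m * pi * x / M + n * pi * x / M" for x
    by (simp_all add: k_def l_def ring_distribs add_divide_distrib diff_divide_distrib)
  have "((\<lambda>x. (cos (of_int k * pi * x / M) - cos (of_int l * pi * x / M)) * (1/2)) has_integral
     ((if k = 0 then M else 0) - (if l = 0 then M else 0)) * (1/2)) {0..M}"
    by (intro has_integral_mult_left has_integral_diff integral_cos_int M)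
  moreover have "(cos (of_int k * pi * x / M) - cos (of_int l * pi * x / M)) * (1/2) = sin (m * pi * x / M) * sin (n * pi * x / M)" for x
    unfolding ka cos_add cos_diff by simp
  moreover have "((if k = 0 then M else 0) - (if l = 0 then M else 0)) * (1/2) = (if m = n then M / 2 else 0)"
    using l0 kk by simp
  ultimately have "((\<lambda>x. sin (m * pi * x / M) * sin (n * pi * x / M)) has_integral (if m = n then M / 2 else 0)) {0..M}"
    by (simp only:)
  then show "integral {0..M} (\<lambda>x. sin (m * pi * x / M) * sin (n * pi * x / M)) = (if m = n then M / 2 else 0)"
    by (rule integral_unique)
  have "((\<lambda>x. (cos (of_int k * pi * x / M) + cos (of_int l * pi * x / M)) * (1/2)) has_integral
     ((if k = 0 then M else 0) + (if l = 0 then M else 0)) * (1/2)) {0..M}"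
    by (intro has_integral_mult_left has_integral_add integral_cos_int M)
  moreover have "(cos (of_int k * pi * x / M) + cos (of_int l * pi * x / M)) * (1/2) = cos (m * pi * x / M) * cos (n * pi * x / M)" for x
    unfolding ka cos_add cos_diff by simp
  moreover have "((if k = 0 then M else 0) + (if l = 0 then M else 0)) * (1/2) = (if m = n then M / 2 else 0)"
    using l0 kk by simp
  ultimately have "((\<lambda>x. cos (m * pi * x / M) * cos (n * pi * x / M)) has_integral (if m = n then M / 2 else 0)) {0..M}"
    by (simp only:)
  then show "integral {0..M} (\<lambda>x. cos (m * pi * x / M) * cos (n * pi * x / M)) = (if m = n then M / 2 else 0)"
    by (rule integral_unique)
qed

section \<open>Compactly supported functions and integration by parts\<close>

definition Cc :: "(real^2 \<Rightarrow> real) \<Rightarrow> bool" where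
  "Cc f \<longleftrightarrow> continuous_on UNIV f \<and> compact (closure {x. f x \<noteq> 0})"

lemma Cc_outside: "x \<notin> closure {x. f x \<noteq> 0} \<Longrightarrow> f x = 0"
  using closure_subset[of "{x. f x \<noteq> 0}"] by auto

lemma compact_closed_subset: "compact T \<Longrightarrow> closed S \<Longrightarrow> S \<subseteq> T \<Longrightarrow> compact (S :: 'a::t2_space set)"
  using compact_Int_closed[of T S] by (simp add: Int_absorb1)

lemma Cc_mult: assumes "Cc f" "continuous_on UNIV g" shows "Cc (\<lambda>x. f x * g x)"
proof -
  have "closure {x. f x * g x \<noteq> 0} \<subseteq> closure {x. f x \<noteq> 0}" by (intro closure_mono) auto
  then have "compact (closure {x. f x * g x \<noteq> 0})"
    using assms unfolding Cc_def by (intro compact_closed_subset[OF _ closed_closure]) auto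
  then show ?thesis using assms unfolding Cc_def by (auto intro: continuous_on_mult)
qed

lemma Cc_add: assumes "Cc f" "Cc g" shows "Cc (\<lambda>x. f x + g x)"
proof -
  have "closure {x. f x + g x \<noteq> 0} \<subseteq> closure ({x. f x \<noteq> 0} \<union> {x. g x \<noteq> 0})" by (intro closure_mono) auto
  moreover have "compact (closure ({x. f x \<noteq> 0} \<union> {x. g x \<noteq> 0}))"
    using assms by (simp add: closure_Un Cc_def compact_Un)
  ultimately have "compact (closure {x. f x + g x \<noteq> 0})"
    by (intro compact_closed_subset[OF _ closed_closure]) auto
  then show ?thesis using assms unfolding Cc_def by (auto intro: continuous_on_add)
qed

lemma Cc_integrable: assumes "Cc f" shows "integrable lborel f"
proof -
  let ?S = "closure {x. f x \<noteq> 0}"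
  have "integrable lborel (\<lambda>x. indicator ?S x *\<^sub>R f x)"
    using assms unfolding Cc_def by (intro borel_integrable_compact) (auto intro: continuous_on_subset)
  also have "(\<lambda>x. indicator ?S x *\<^sub>R f x) = f"
  proof
    fix x show "indicator ?S x *\<^sub>R f x = f x" using Cc_outside[of x f] by (cases "x \<in> ?S") simp_all
  qed
  finally show ?thesis .
qed

lemma Cc_measurable: assumes "Cc f" shows "f \<in> borel_measurable borel"
  using assms by (intro borel_measurable_continuous_onI) (simp add: Cc_def)

lemma Cc_lebesgue_on:
  assumes f: "Cc f" and S: "S \<in> sets lebesgue"
  shows "integrable (lebesgue_on S) f" "f \<in> borel_measurable (lebesgue_on S)"
    "(\<And>x. x \<notin> S \<Longrightarrow> f x = 0) \<Longrightarrow> integral\<^sup>L (lebesgue_on S) f = integral\<^sup>L lborel f"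
proof -
  have m: "f \<in> borel_measurable lborel" using Cc_measurable[OF f] by simp
  have i: "integrable lebesgue f" using Cc_integrable[OF f] integrable_completion[OF m] by simp
  have "integrable lebesgue (\<lambda>x. indicator S x *\<^sub>R f x)"
    using i S by (intro integrable_mult_indicator) auto
  then show "integrable (lebesgue_on S) f" using S by (subst integrable_restrict_space) auto
  then show "f \<in> borel_measurable (lebesgue_on S)" by auto
  assume "\<And>x. x \<notin> S \<Longrightarrow> f x = 0"
  then have "(\<lambda>x. if x \<in> S then f x else 0) = f" by auto
  then show "integral\<^sup>L (lebesgue_on S) f = integral\<^sup>L lborel f"
    using Lebesgue_Measure.integral_restrict_UNIV[OF S, of f] integral_completion[OF m] by simp
qed

lemma Cc_sq_integrable:
  assumes f: "Cc f" and S: "S \<in> sets lebesgue"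
  shows "sq_integrable (lebesgue_on S) f"
proof -
  have "Cc (\<lambda>x. f x * f x)" using f by (intro Cc_mult) (auto simp: Cc_def)
  then show ?thesis using Cc_lebesgue_on[OF _ S] f unfolding sq_integrable_def power2_eq_square by blast
qed

lemma integral_lborel_isometry:
  fixes f :: "real^2 \<Rightarrow> real"
  assumes f: "f \<in> borel_measurable borel" and \<sigma>: "\<bar>\<sigma>\<bar> = 1"
  shows "(\<integral>x. f (\<sigma> *\<^sub>R x + \<tau>) \<partial>lborel) = integral\<^sup>L lborel f"
proof -
  have "\<sigma> \<noteq> 0" using \<sigma> by auto
  have "(lborel :: (real^2) measure) = density (distr lborel borel (\<lambda>x. \<tau> + \<sigma> *\<^sub>R x)) (\<lambda>_. \<bar>\<sigma>\<bar> ^ DIM(real^2))"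
    by (rule lborel_affine[OF \<open>\<sigma> \<noteq> 0\<close>])
  also have "\<dots> = distr lborel borel (\<lambda>x. \<tau> + \<sigma> *\<^sub>R x)" by (simp add: \<sigma> density_1)
  finally have eq: "(lborel :: (real^2) measure) = distr lborel borel (\<lambda>x. \<tau> + \<sigma> *\<^sub>R x)" .
  have "integral\<^sup>L lborel f = integral\<^sup>L (distr lborel borel (\<lambda>x. \<tau> + \<sigma> *\<^sub>R x)) f"
    by (simp only: eq[symmetric])
  also have "\<dots> = (\<integral>x. f (\<tau> + \<sigma> *\<^sub>R x) \<partial>lborel)" using f by (intro integral_distr) auto
  finally show ?thesis by (simp add: add.commute)
qed

text \<open>One direction is all that integration by parts sees, and a derivative in this sense is
  easily carried to translated and reflected copies.\<close>

definition deriv_along :: "real^2 \<Rightarrow> (real^2 \<Rightarrow> real) \<Rightarrow> (real^2 \<Rightarrow> real) \<Rightarrow> bool" where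
  "deriv_along e F F' \<longleftrightarrow> (\<forall>x. ((\<lambda>t. F (x + t *\<^sub>R e)) has_real_derivative F' x) (at 0))"

lemma deriv_along_shift:
  assumes "deriv_along e F F'"
  shows "((\<lambda>t. F (x + t *\<^sub>R e)) has_real_derivative F' (x + t *\<^sub>R e)) (at t)"
proof -
  have "((\<lambda>s. F ((x + t *\<^sub>R e) + s *\<^sub>R e)) has_real_derivative F' (x + t *\<^sub>R e)) (at 0)"
    using assms unfolding deriv_along_def by blast
  then have "((\<lambda>s. F (x + (s + t) *\<^sub>R e)) has_real_derivative F' (x + t *\<^sub>R e)) (at 0)"
    by (simp add: algebra_simps)
  then show ?thesis using DERIV_shift[of "\<lambda>t. F (x + t *\<^sub>R e)" "F' (x + t *\<^sub>R e)" 0 t] by simp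
qed

text \<open>The difference quotients have integral 0 by translation invariance. They converge to
  \<open>F'\<close>, dominated by a constant on a ball through the mean value theorem.\<close>

lemma integral_deriv_along:
  assumes d: "deriv_along e F F'" and F: "Cc F" and F': "Cc F'" and e: "norm e \<le> 1"
  shows "integral\<^sup>L lborel F' = 0"
proof -
  define h where "h = (\<lambda>n. 1 / real (Suc n))"
  have h: "0 < h n" "h n \<le> 1" for n by (auto simp: h_def)
  define D where "D = (\<lambda>n x. (F (x + h n *\<^sub>R e) - F x) / h n)"
  have Fm: "F \<in> borel_measurable borel" and F'm: "F' \<in> borel_measurable borel" using F F' by (auto intro: Cc_measurable)
  have Fs: "integrable lborel (\<lambda>x. F (x + c))" "(\<integral>x. F (x + c) \<partial>lborel) = integral\<^sup>L lborel F" for c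
  proof -
    show "(\<integral>x. F (x + c) \<partial>lborel) = integral\<^sup>L lborel F"
      using integral_lborel_isometry[OF Fm abs_one, of c] by (simp only: scaleR_one)
    have "Cc (\<lambda>x. F (x + c))"
    proof -
      have eq: "{x. F (x + c) \<noteq> 0} = (\<lambda>x. - c + x) ` {x. F x \<noteq> 0}"
      proof (intro set_eqI iffI)
        fix x assume "x \<in> {x. F (x + c) \<noteq> 0}"
        then show "x \<in> (\<lambda>x. - c + x) ` {x. F x \<noteq> 0}" by (intro image_eqI[of _ _ "x + c"]) auto
      qed auto
      have "closure {x. F (x + c) \<noteq> 0} = (\<lambda>x. - c + x) ` closure {x. F x \<noteq> 0}"
        unfolding eq by (rule closure_translation)
      then have "compact (closure {x. F (x + c) \<noteq> 0})" using F by (simp only: Cc_def compact_translation)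
      moreover have "continuous_on UNIV (\<lambda>x. F (x + c))"
        using F unfolding Cc_def by (auto intro!: continuous_on_compose2[of UNIV F] continuous_intros)
      ultimately show ?thesis by (simp add: Cc_def)
    qed
    then show "integrable lborel (\<lambda>x. F (x + c))" by (rule Cc_integrable)
  qed
  have D0: "integral\<^sup>L lborel (D n) = 0" for n
    unfolding D_def using Fs[of "h n *\<^sub>R e"] Cc_integrable[OF F] by simp
  obtain B where B: "\<And>x. \<bar>F' x\<bar> \<le> B"
  proof -
    let ?S = "closure {x. F' x \<noteq> 0}"
    have "compact (F' ` ?S)"
      using F' unfolding Cc_def by (intro compact_continuous_image) (auto intro: continuous_on_subset)
    then have "bounded (F' ` ?S)" by (rule compact_imp_bounded)
    then obtain b where b: "\<And>x. x \<in> ?S \<Longrightarrow> \<bar>F' x\<bar> \<le> b" unfolding bounded_iff by auto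
    have "\<bar>F' x\<bar> \<le> max b 0" for x
      using b[of x] Cc_outside[of x F'] by (cases "x \<in> ?S") auto
    then show thesis by (rule that)
  qed
  have B0: "B \<ge> 0" using B[of 0] by simp
  have "bounded (closure {x. F x \<noteq> 0})" using F by (simp add: Cc_def compact_imp_bounded)
  then obtain R where R: "\<And>x. F x \<noteq> 0 \<Longrightarrow> norm x \<le> R" unfolding bounded_iff using closure_subset[of "{x. F x \<noteq> 0}"] by auto
  \<comment> \<open>The steps have length at most 1, so a single ball of radius \<open>R + 1\<close>
    contains the supports of all quotients.\<close>
  have Db: "\<bar>D n x\<bar> \<le> B * indicator (cball 0 (R + 1)) x" for n x
  proof (cases "F (x + h n *\<^sub>R e) = 0 \<and> F x = 0")
    case True then show ?thesis using B0 by (simp add: D_def)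
  next
    case False
    have "norm (h n *\<^sub>R e) \<le> 1" using h[of n] e by (simp add: mult_le_one)
    have "norm x \<le> R + 1"
    proof (cases "F x = 0")
      case True
      then have "norm (x + h n *\<^sub>R e) \<le> R" using R False by auto
      moreover have "norm x \<le> norm (x + h n *\<^sub>R e) + norm (h n *\<^sub>R e)"
        using norm_triangle_ineq4[of "x + h n *\<^sub>R e" "h n *\<^sub>R e"] by simp
      ultimately show ?thesis using \<open>norm (h n *\<^sub>R e) \<le> 1\<close> by linarith
    next
      case False then show ?thesis using R[of x] by simp
    qed
    moreover obtain z where "F (x + h n *\<^sub>R e) - F (x + 0 *\<^sub>R e) = (h n - 0) * F' (x + z *\<^sub>R e)"
      using MVT2[OF h(1)[of n], of "\<lambda>t. F (x + t *\<^sub>R e)" "\<lambda>t. F' (x + t *\<^sub>R e)"] deriv_along_shift[OF d] by blast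
    then have "D n x = F' (x + z *\<^sub>R e)" using h[of n] by (simp add: D_def)
    ultimately show ?thesis using B by simp
  qed
  have "(\<lambda>n. integral\<^sup>L lborel (D n)) \<longlonglongrightarrow> integral\<^sup>L lborel F'"
  proof (rule integral_dominated_convergence[where w = "\<lambda>x. B * indicator (cball 0 (R + 1)) x"])
    show "F' \<in> borel_measurable lborel" using F'm by simp
    show "D n \<in> borel_measurable lborel" for n unfolding D_def
      using Fs(1)[of "h n *\<^sub>R e"] Fm by (auto dest: borel_measurable_integrable)
    show "integrable lborel (\<lambda>x :: real^2. B * indicator (cball 0 (R + 1)) x)"
      using emeasure_bounded_finite[OF bounded_cball, of "0 :: real^2" "R + 1"]
      by (intro integrable_mult_right integrable_real_indicator) (simp_all add: less_top)
    show "AE x in lborel. (\<lambda>n. D n x) \<longlonglongrightarrow> F' x"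
    proof (intro AE_I2)
      fix x
      have "((\<lambda>t. F (x + t *\<^sub>R e)) has_real_derivative F' x) (at 0)" using d by (auto simp: deriv_along_def)
      then have "((\<lambda>t. (F (x + (0 + t) *\<^sub>R e) - F (x + 0 *\<^sub>R e)) / t) \<longlongrightarrow> F' x) (at 0)" by (rule DERIV_D)
      moreover have "filterlim h (at 0) sequentially"
        unfolding filterlim_at using h LIMSEQ_Suc[OF lim_1_over_n] by (auto simp: h_def[abs_def] intro!: always_eventually)
      ultimately show "(\<lambda>n. D n x) \<longlonglongrightarrow> F' x"
        unfolding D_def by (auto dest: filterlim_compose)
    qed
    show "AE x in lborel. norm (D n x) \<le> B * indicator (cball 0 (R + 1)) x" for n using Db by auto
  qed
  then have "(\<lambda>n. 0) \<longlonglongrightarrow> integral\<^sup>L lborel F'" by (simp add: D0)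
  then show ?thesis using LIMSEQ_unique tendsto_const by blast
qed

lemma integral_by_parts_along:
  assumes f: "deriv_along e f f'" "Cc f" "Cc f'" and g: "deriv_along e g g'" "continuous_on UNIV g" "continuous_on UNIV g'"
    and e: "norm e \<le> 1"
  shows "(\<integral>x. f' x * g x \<partial>lborel) = - (\<integral>x. f x * g' x \<partial>lborel)"
proof -
  have 1: "Cc (\<lambda>x. f' x * g x)" "Cc (\<lambda>x. f x * g' x)" using assms by (auto intro: Cc_mult)
  have "deriv_along e (\<lambda>x. f x * g x) (\<lambda>x. f' x * g x + f x * g' x)"
    using f(1) g(1) unfolding deriv_along_def by (auto intro!: derivative_eq_intros)
  then have "integral\<^sup>L lborel (\<lambda>x. f' x * g x + f x * g' x) = 0"
    by (rule integral_deriv_along[OF _ Cc_mult[OF f(2) g(2)] Cc_add[OF 1] e])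
  then show ?thesis using 1 by (simp add: Cc_integrable)
qed

section \<open>Partial derivatives of test functions\<close>

lemma Ck_continuous: "Ck n f \<Longrightarrow> continuous_on UNIV f"
  by (cases n) (auto intro!: continuous_at_imp_continuous_on differentiable_imp_continuous_within)

lemma differentiable_deriv_along:
  assumes "\<And>x. f differentiable (at x)"
  shows "deriv_along (axis i 1) f (partial i f)"
  unfolding deriv_along_def
proof
  fix x
  have fd: "(f has_derivative frechet_derivative f (at x)) (at x)" using assms frechet_derivative_works by blast
  have lin: "linear (frechet_derivative f (at x))" using fd has_derivative_linear by blast
  have "((\<lambda>t::real. x + t *\<^sub>R axis i 1) has_derivative (\<lambda>t. t *\<^sub>R axis i 1)) (at 0)"
    by (auto intro!: derivative_eq_intros)
  then have "((\<lambda>t::real. f (x + t *\<^sub>R axis i 1)) has_derivative (\<lambda>t. frechet_derivative f (at x) (t *\<^sub>R axis i 1))) (at 0)"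
    by (rule has_derivative_compose) (use fd in simp)
  moreover have "(\<lambda>t. frechet_derivative f (at x) (t *\<^sub>R axis i 1)) = (\<lambda>t. partial i f x * t)"
    using linear_scale[OF lin] by (auto simp: partial_def)
  ultimately show "((\<lambda>t. f (x + t *\<^sub>R axis i 1)) has_real_derivative partial i f x) (at 0)"
    by (simp add: has_field_derivative_def)
qed

lemma partial_support:
  assumes f: "\<And>x. f differentiable (at x)" and x: "x \<notin> closure {x. f x \<noteq> 0}"
  shows "partial i f x = 0"
proof -
  have "open (- closure {x. f x \<noteq> 0})" by (rule open_Compl) (rule closed_closure)
  from open_contains_ball[THEN iffD1, OF this] x obtain \<epsilon> where \<epsilon>: "\<epsilon> > 0" "ball x \<epsilon> \<subseteq> - closure {x. f x \<noteq> 0}" by blast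
  have "(f has_derivative (\<lambda>_. 0)) (at x)"
  proof (rule has_derivative_transform_within_open[where f = "\<lambda>_. 0" and s = "ball x \<epsilon>"])
    fix y assume "y \<in> ball x \<epsilon>" then show "0 = f y" using \<epsilon>(2) Cc_outside[of y f] by auto
  qed (use \<epsilon> in auto)
  then have "frechet_derivative f (at x) = (\<lambda>_. 0)" by (metis frechet_derivative_at)
  then show ?thesis by (simp add: partial_def)
qed

lemma partial_cc:
  assumes "Ck (Suc n) f" "compact (closure {x. f x \<noteq> 0})"
  shows "Cc (partial i f)" "closure {x. partial i f x \<noteq> 0} \<subseteq> closure {x. f x \<noteq> 0}"
proof -
  have "{x. partial i f x \<noteq> 0} \<subseteq> closure {x. f x \<noteq> 0}" using assms partial_support by fastforce
  then show s: "closure {x. partial i f x \<noteq> 0} \<subseteq> closure {x. f x \<noteq> 0}" by (simp add: closure_minimal)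
  then have "compact (closure {x. partial i f x \<noteq> 0})" using assms(2)
    by (intro compact_closed_subset[OF _ closed_closure]) auto
  moreover have "Ck n (partial i f)" using assms(1) by simp
  ultimately show "Cc (partial i f)" using Ck_continuous unfolding Cc_def by blast
qed

lemma test_functionD:
  assumes "test_function \<Omega> \<phi>"
  shows "Cc \<phi>" "Cc (partial i \<phi>)" "Cc (partial j (partial i \<phi>))"
    "deriv_along (axis i 1) \<phi> (partial i \<phi>)" "deriv_along (axis j 1) (partial i \<phi>) (partial j (partial i \<phi>))"
    "\<And>x. x \<notin> closure {x. \<phi> x \<noteq> 0} \<Longrightarrow> partial i \<phi> x = 0" "closure {x. \<phi> x \<noteq> 0} \<subseteq> \<Omega>"
    "\<And>x. x \<notin> \<Omega> \<Longrightarrow> \<phi> x = 0" "\<And>x. x \<notin> \<Omega> \<Longrightarrow> partial i \<phi> x = 0"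
proof -
  have C: "Ck n \<phi>" for n using assms by (simp add: test_function_def)
  have k: "compact (closure {x. \<phi> x \<noteq> 0})" and s: "closure {x. \<phi> x \<noteq> 0} \<subseteq> \<Omega>" using assms by (auto simp: test_function_def)
  show "Cc \<phi>" using C[of 0] k by (simp add: Cc_def)
  have d: "\<phi> differentiable (at x)" for x using C[of "Suc 0"] by simp
  have d2: "partial i \<phi> differentiable (at x)" for x using C[of "Suc (Suc 0)"] by simp
  show 1: "Cc (partial i \<phi>)" using partial_cc[OF C k] by simp
  have "Ck (Suc 0) (partial i \<phi>)" using C[of "Suc (Suc 0)"] by simp
  then show "Cc (partial j (partial i \<phi>))" using 1 partial_cc(1) unfolding Cc_def by blast
  show "deriv_along (axis i 1) \<phi> (partial i \<phi>)" "deriv_along (axis j 1) (partial i \<phi>) (partial j (partial i \<phi>))"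
    using d d2 by (auto intro: differentiable_deriv_along)
  show 2: "\<And>x. x \<notin> closure {x. \<phi> x \<noteq> 0} \<Longrightarrow> partial i \<phi> x = 0" by (rule partial_support[OF d])
  show "closure {x. \<phi> x \<noteq> 0} \<subseteq> \<Omega>" by fact
  show "\<And>x. x \<notin> \<Omega> \<Longrightarrow> \<phi> x = 0" "\<And>x. x \<notin> \<Omega> \<Longrightarrow> partial i \<phi> x = 0"
    using s 2 by (blast intro: Cc_outside)+
qed

section \<open>Approximation by sines and Parseval's identity on the square\<close>

definition sin_sin :: "real \<Rightarrow> nat \<times> nat \<Rightarrow> real^2 \<Rightarrow> real" where
  "sin_sin M p z = sin (real (fst p) * pi * z$1 / M) * sin (real (snd p) * pi * z$2 / M)"

definition cos_sin :: "real \<Rightarrow> nat \<times> nat \<Rightarrow> real^2 \<Rightarrow> real" where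
  "cos_sin M p z = cos (real (fst p) * pi * z$1 / M) * sin (real (snd p) * pi * z$2 / M)"

definition sin_cos :: "real \<Rightarrow> nat \<times> nat \<Rightarrow> real^2 \<Rightarrow> real" where
  "sin_cos M p z = sin (real (fst p) * pi * z$1 / M) * cos (real (snd p) * pi * z$2 / M)"

abbreviation modes :: "(nat \<times> nat) set" where "modes \<equiv> {1..} \<times> {1..}"

inductive sine_poly :: "real \<Rightarrow> (real^2 \<Rightarrow> real) \<Rightarrow> bool" for M where
  sine_poly_basic: "p \<in> modes \<Longrightarrow> sine_poly M (sin_sin M p)"
| sine_poly_add: "sine_poly M f \<Longrightarrow> sine_poly M g \<Longrightarrow> sine_poly M (\<lambda>z. f z + g z)"
| sine_poly_scale: "sine_poly M f \<Longrightarrow> sine_poly M (\<lambda>z. c * f z)"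

inductive cos_poly :: "real \<Rightarrow> (real^2 \<Rightarrow> real) \<Rightarrow> bool" for M where
  cos_poly_const: "cos_poly M (\<lambda>_. c)"
| cos_poly_cos: "cos_poly M (\<lambda>z. cos (pi * z$i / M))"
| cos_poly_add: "cos_poly M f \<Longrightarrow> cos_poly M g \<Longrightarrow> cos_poly M (\<lambda>z. f z + g z)"
| cos_poly_mult: "cos_poly M f \<Longrightarrow> cos_poly M g \<Longrightarrow> cos_poly M (\<lambda>z. f z * g z)"

lemma sine_poly_cong: "sine_poly M f \<Longrightarrow> (\<And>z. f z = g z) \<Longrightarrow> sine_poly M g"
  by (metis ext)

lemma sin_mult_cos:
  fixes n :: nat assumes "n \<ge> 1"
  shows "cos (pi * x / M) * sin (real n * pi * x / M)
    = (sin (real (n + 1) * pi * x / M) + sin (real (n - 1) * pi * x / M)) / 2"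
proof -
  have "real (n + 1) * pi * x / M = real n * pi * x / M + pi * x / M"
    "real (n - 1) * pi * x / M = real n * pi * x / M - pi * x / M"
    using assms by (simp_all add: of_nat_diff ring_distribs add_divide_distrib diff_divide_distrib)
  then show ?thesis by (simp add: sin_add sin_diff)
qed

lemma sine_poly_cos: "sine_poly M f \<Longrightarrow> sine_poly M (\<lambda>z. cos (pi * z$i / M) * f z)"
proof (induction rule: sine_poly.induct)
  case (sine_poly_basic p)
  obtain m n where p: "p = (m, n)" "m \<ge> 1" "n \<ge> 1" using sine_poly_basic by auto
  have z0: "sine_poly M (\<lambda>z. 0)"
    using sine_poly_scale[OF sine_poly.sine_poly_basic[OF sine_poly_basic], of M 0] by simp
  \<comment> \<open>Lowering an index may produce 0; that sine vanishes identically, so the shifted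
    term still belongs to the span.\<close>
  have sh: "sine_poly M (sin_sin M (m', n'))" if "m' \<ge> 1 \<or> m' = 0" "n' \<ge> 1 \<or> n' = 0" for m' n'
    using that z0 sine_poly.sine_poly_basic[of "(m', n')" M] by (cases "m' = 0 \<or> n' = 0") (auto simp: sin_sin_def[abs_def])
  have i: "i = 1 \<or> i = 2" using exhaust_2 by blast
  then show ?case
  proof
    assume i: "i = 1"
    have "sine_poly M (\<lambda>z. (1/2) * (sin_sin M (m + 1, n) z + sin_sin M (m - 1, n) z))"
      using p by (intro sine_poly_scale sine_poly_add sh) auto
    then show ?thesis
    proof (rule sine_poly_cong)
      fix z show "(1/2) * (sin_sin M (m + 1, n) z + sin_sin M (m - 1, n) z) = cos (pi * z$i / M) * sin_sin M p z"
        unfolding sin_sin_def p i fst_conv snd_conv mult.assoc[symmetric] sin_mult_cos[OF p(2)]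
        by (simp add: algebra_simps)
    qed
  next
    assume i: "i = 2"
    have "sine_poly M (\<lambda>z. (1/2) * (sin_sin M (m, n + 1) z + sin_sin M (m, n - 1) z))"
      using p by (intro sine_poly_scale sine_poly_add sh) auto
    then show ?thesis
    proof (rule sine_poly_cong)
      fix z
      have "cos (pi * z$2 / M) * sin_sin M (m, n) z = sin (real m * pi * z$1 / M) * (cos (pi * z$2 / M) * sin (real n * pi * z$2 / M))"
        by (simp add: sin_sin_def)
      then show "(1/2) * (sin_sin M (m, n + 1) z + sin_sin M (m, n - 1) z) = cos (pi * z$i / M) * sin_sin M p z"
        unfolding p i sin_mult_cos[OF p(3)] by (simp add: sin_sin_def algebra_simps)
    qed
  qed
next
  case (sine_poly_add f g)
  then show ?case using sine_poly.sine_poly_add[OF sine_poly_add.IH] by (simp add: algebra_simps)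
next
  case (sine_poly_scale f c)
  then show ?case using sine_poly.sine_poly_scale[OF sine_poly_scale.IH, of c] by (simp add: algebra_simps)
qed

text \<open>By the product-to-sum formula the sine span is a module over the algebra of cosines.
  Multiplying a cosine approximation by the first mode therefore gives a sine approximation.\<close>

lemma cos_poly_mult_sine_poly: "cos_poly M g \<Longrightarrow> sine_poly M f \<Longrightarrow> sine_poly M (\<lambda>z. g z * f z)"
proof (induction arbitrary: f rule: cos_poly.induct)
  case (cos_poly_const c) then show ?case by (rule sine_poly_scale)
next
  case (cos_poly_cos i) then show ?case by (rule sine_poly_cos)
next
  case (cos_poly_add g h)
  show ?case using sine_poly_add[OF cos_poly_add.IH[OF cos_poly_add.prems]] by (simp add: distrib_right)
next
  case (cos_poly_mult g h)
  show ?case using cos_poly_mult.IH(1)[OF cos_poly_mult.IH(2)[OF cos_poly_mult.prems]] by (simp add: mult.assoc)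
qed

lemma sine_poly_sum:
  "sine_poly M f \<Longrightarrow> \<exists>F a. finite F \<and> F \<subseteq> modes \<and> (\<forall>z. f z = (\<Sum>p\<in>F. a p * sin_sin M p z))"
proof (induction rule: sine_poly.induct)
  case (sine_poly_basic p)
  then show ?case by (intro exI[of _ "{p}"] exI[of _ "\<lambda>_. 1"]) auto
next
  case (sine_poly_add f g)
  from sine_poly_add.IH(1) obtain F a where F: "finite F" "F \<subseteq> modes" "\<forall>z. f z = (\<Sum>p\<in>F. a p * sin_sin M p z)" by blast
  from sine_poly_add.IH(2) obtain G b where G: "finite G" "G \<subseteq> modes" "\<forall>z. g z = (\<Sum>p\<in>G. b p * sin_sin M p z)" by blast
  have "f z + g z = (\<Sum>p\<in>F \<union> G. ((if p \<in> F then a p else 0) + (if p \<in> G then b p else 0)) * sin_sin M p z)" for z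
  proof -
    have "f z = (\<Sum>p\<in>F \<union> G. (if p \<in> F then a p else 0) * sin_sin M p z)"
      unfolding F(3)[rule_format] using F(1) G(1) by (intro sum.mono_neutral_cong_left) auto
    moreover have "g z = (\<Sum>p\<in>F \<union> G. (if p \<in> G then b p else 0) * sin_sin M p z)"
      unfolding G(3)[rule_format] using F(1) G(1) by (intro sum.mono_neutral_cong_left) auto
    ultimately show ?thesis by (simp only: distrib_right sum.distrib)
  qed
  then show ?case using F G by (intro exI[of _ "F \<union> G"] exI[of _ "\<lambda>p. (if p \<in> F then a p else 0) + (if p \<in> G then b p else 0)"]) auto
next
  case (sine_poly_scale f c)
  then obtain F a where F: "finite F" "F \<subseteq> modes" "\<forall>z. f z = (\<Sum>p\<in>F. a p * sin_sin M p z)" by blast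
  then have "c * f z = (\<Sum>p\<in>F. (c * a p) * sin_sin M p z)" for z by (simp add: sum_distrib_left mult.assoc)
  then show ?case using F by (intro exI[of _ F] exI[of _ "\<lambda>p. c * a p"]) auto
qed

lemma cos_poly_continuous: "M > 0 \<Longrightarrow> cos_poly M f \<Longrightarrow> continuous_on S f"
  by (erule cos_poly.induct) (auto intro!: continuous_intros)

lemma interior_square: "z \<in> interior (square M) \<longleftrightarrow> 0 < z$1 \<and> z$1 < M \<and> 0 < z$2 \<and> z$2 < M"
  by (auto simp: square_def interior_cbox mem_box_cart forall_2)

text \<open>Dividing by the first mode reduces the claim to Stone-Weierstrass for polynomials in the cosines.\<close>

lemma sine_approximation:
  assumes M: "M > 0" and f: "continuous_on UNIV f" and s: "closure {x. f x \<noteq> 0} \<subseteq> interior (square M)" and \<epsilon>: "\<epsilon> > 0"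
  obtains F a where "finite F" "F \<subseteq> modes" "\<And>z. z \<in> square M \<Longrightarrow> \<bar>f z - (\<Sum>p\<in>F. a p * sin_sin M p z)\<bar> \<le> \<epsilon>"
proof -
  define w where "w = sin_sin M (1, 1)"
  define h where "h = (\<lambda>z. f z / w z)"
  have wpos: "w z > 0" if "z \<in> interior (square M)" for z
  proof -
    have *: "sin (pi * x / M) > 0" if "0 < x" "x < M" for x
    proof (rule sin_gt_zero)
      show "0 < pi * x / M" using that M by simp
      show "pi * x / M < pi" using that M by (simp add: divide_less_eq)
    qed
    show ?thesis using *[of "z$1"] *[of "z$2"] that by (auto simp: w_def sin_sin_def interior_square)
  qed
  have wle: "\<bar>w z\<bar> \<le> 1" for z
    unfolding w_def sin_sin_def abs_mult by (intro mult_le_one) auto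
  have cw: "continuous_on S w" for S unfolding w_def sin_sin_def using M by (auto intro!: continuous_intros)
  \<comment> \<open>The divisor \<open>w\<close> vanishes on the boundary of the square, but
    \<open>f\<close> vanishes near it, so two open sets on which \<open>h\<close> is continuous
    cover the plane.\<close>
  have "continuous_on (interior (square M) \<union> - closure {x. f x \<noteq> 0}) h"
  proof (rule continuous_on_open_Un)
    have ne: "\<forall>z\<in>interior (square M). w z \<noteq> 0" using wpos by force
    show "continuous_on (interior (square M)) h"
      unfolding h_def by (rule continuous_on_divide[OF continuous_on_subset[OF f] cw ne]) auto
    have "h z = 0" if "z \<in> - closure {x. f x \<noteq> 0}" for z using Cc_outside[of z f] that by (simp add: h_def)
    then show "continuous_on (- closure {x. f x \<noteq> 0}) h"
      by (subst continuous_on_cong[OF refl, of _ _ "\<lambda>_. 0"]) auto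
  qed auto
  moreover have "interior (square M) \<union> - closure {x. f x \<noteq> 0} = UNIV" using s by auto
  ultimately have ch: "continuous_on (square M) h" by (metis continuous_on_subset subset_UNIV)
  interpret function_ring_on "Collect (cos_poly M)" "square M"
  proof
    show "compact (square M)" by (simp add: square_def)
    show "f \<in> Collect (cos_poly M) \<Longrightarrow> continuous_on (square M) f" for f using cos_poly_continuous[OF M] by auto
    fix x y assume xy: "x \<in> square M" "y \<in> square M" "x \<noteq> y"
    then obtain i where i: "x$i \<noteq> y$i" by (auto simp: vec_eq_iff)
    have r: "0 \<le> x$i \<and> x$i \<le> M \<and> 0 \<le> y$i \<and> y$i \<le> M" using xy exhaust_2[of i] by (auto simp: mem_square)
    have b: "0 \<le> pi * t / M" "pi * t / M \<le> pi" if "0 \<le> t \<and> t \<le> M" for t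
      using that M by (simp_all add: divide_le_eq)
    have rx: "0 \<le> x$i \<and> x$i \<le> M" and ry: "0 \<le> y$i \<and> y$i \<le> M" using r by auto
    have "pi * x$i / M \<noteq> pi * y$i / M" using i M by simp
    then have "cos (pi * x$i / M) \<noteq> cos (pi * y$i / M)"
      using cos_inj_pi[OF b[OF rx] b[OF ry]] by blast
    then show "\<exists>f\<in>Collect (cos_poly M). f x \<noteq> f y"
      using cos_poly_cos[of M i] by (intro bexI[of _ "\<lambda>z. cos (pi * z$i / M)"]) simp_all
  qed (simp_all add: cos_poly_add cos_poly_mult cos_poly_const)
  obtain g where g: "cos_poly M g" "\<And>z. z \<in> square M \<Longrightarrow> \<bar>h z - g z\<bar> < \<epsilon>"
    using Stone_Weierstrass_basic[OF ch \<epsilon>] by auto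
  have "sine_poly M (\<lambda>z. g z * w z)"
    unfolding w_def by (rule cos_poly_mult_sine_poly[OF g(1)]) (auto intro: sine_poly_basic)
  from sine_poly_sum[OF this] obtain F a where F: "finite F" "F \<subseteq> modes" "\<forall>z. g z * w z = (\<Sum>p\<in>F. a p * sin_sin M p z)" by blast
  have "\<bar>f z - g z * w z\<bar> \<le> \<epsilon>" if z: "z \<in> square M" for z
  proof -
    have "f z = h z * w z"
    proof (cases "f z = 0")
      case False
      then have "z \<in> interior (square M)" using s closure_subset[of "{x. f x \<noteq> 0}"] by auto
      from wpos[OF this] show ?thesis by (simp add: h_def)
    qed (simp add: h_def)
    then have "\<bar>f z - g z * w z\<bar> = \<bar>h z - g z\<bar> * \<bar>w z\<bar>" by (simp add: abs_mult flip: left_diff_distrib)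
    also have "\<dots> \<le> \<epsilon> * 1" using g(2)[OF z] wle[of z] \<epsilon> by (intro mult_mono) auto
    finally show ?thesis by simp
  qed
  then show thesis using that[OF F(1,2)] F(3) by auto
qed

lemma sin_sin_continuous: "continuous_on S (sin_sin M p)" "continuous_on S (cos_sin M p)" "continuous_on S (sin_cos M p)"
  unfolding sin_sin_def[abs_def] cos_sin_def[abs_def] sin_cos_def[abs_def] divide_inverse by (auto intro!: continuous_intros)

lemma continuous_sq_integrable_square:
  assumes "continuous_on UNIV f" shows "sq_integrable (lebesgue_on (square M)) f"
proof -
  have c: "continuous_on (square M) f" using assms continuous_on_subset by blast
  then have "integrable (lebesgue_on (square M)) f" "integrable (lebesgue_on (square M)) (\<lambda>x. (f x)\<^sup>2)"
    unfolding square_def by (auto intro!: continuous_imp_integrable continuous_intros)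
  then show ?thesis by (auto simp: sq_integrable_def)
qed

text \<open>The mixed families receive the gradient coefficients. Restricted to positive indices
  they are not complete, but Bessel's inequality applies to them.\<close>

lemma modes_orthonormal:
  assumes M: "M > 0" and p: "p \<in> modes" "q \<in> modes"
  shows "(\<integral>z. (2 / M * sin_sin M p z) * (2 / M * sin_sin M q z) \<partial>lebesgue_on (square M)) = (if p = q then 1 else 0)"
    "(\<integral>z. (2 / M * cos_sin M p z) * (2 / M * cos_sin M q z) \<partial>lebesgue_on (square M)) = (if p = q then 1 else 0)"
    "(\<integral>z. (2 / M * sin_cos M p z) * (2 / M * sin_cos M q z) \<partial>lebesgue_on (square M)) = (if p = q then 1 else 0)"
proof -
  obtain m n m' n' where pq: "p = (m, n)" "q = (m', n')" by (cases p, cases q)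
  have ge: "m \<ge> 1" "n \<ge> 1" "m' \<ge> 1" "n' \<ge> 1" using p by (auto simp: pq)
  define s where "s = (\<lambda>k x. sin (real k * pi * x / M))"
  define c where "c = (\<lambda>k x. cos (real k * pi * x / M))"
  have cont: "continuous_on UNIV (\<lambda>x. s k x * s l x)" "continuous_on UNIV (\<lambda>x. c k x * c l x)" for k l
    unfolding s_def c_def divide_inverse by (auto intro!: continuous_intros)
  have so: "integral {0..M} (\<lambda>x. s k x * s l x) = (if k = l then M / 2 else 0)"
    "integral {0..M} (\<lambda>x. c k x * c l x) = (if k = l then M / 2 else 0)" if "k \<ge> 1" "l \<ge> 1" for k l
    using sin_cos_orthogonal[OF M that] by (simp_all add: s_def c_def)
  have gen: "(\<integral>z. (2 / M * (f (z$1) * g (z$2))) * (2 / M * (f' (z$1) * g' (z$2))) \<partial>lebesgue_on (square M)) = (if p = q then 1 else 0)"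
    if "continuous_on UNIV (\<lambda>x. f x * f' x)" "continuous_on UNIV (\<lambda>x. g x * g' x)"
     "integral {0..M} (\<lambda>x. f x * f' x) = (if m = m' then M / 2 else 0)" "integral {0..M} (\<lambda>x. g x * g' x) = (if n = n' then M / 2 else 0)"
    for f g f' g'
  proof -
    have "(\<integral>z. (2 / M * (f (z$1) * g (z$2))) * (2 / M * (f' (z$1) * g' (z$2))) \<partial>lebesgue_on (square M))
      = (\<integral>z. (2 / M)\<^sup>2 * ((f (z$1) * f' (z$1)) * (g (z$2) * g' (z$2))) \<partial>lebesgue_on (square M))"
      by (intro Bochner_Integration.integral_cong) (auto simp: power2_eq_square algebra_simps)
    also have "\<dots> = (2 / M)\<^sup>2 * ((if m = m' then M / 2 else 0) * (if n = n' then M / 2 else 0))"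
      using integral_square_product[OF that(1,2), of M] that(3,4) by simp
    also have "\<dots> = (if p = q then 1 else 0)" using M by (auto simp: pq power2_eq_square)
    finally show ?thesis .
  qed
  show "(\<integral>z. (2 / M * sin_sin M p z) * (2 / M * sin_sin M q z) \<partial>lebesgue_on (square M)) = (if p = q then 1 else 0)"
    using gen[OF cont(1) cont(1) so(1)[OF ge(1,3)] so(1)[OF ge(2,4)]] by (simp add: sin_sin_def pq s_def)
  show "(\<integral>z. (2 / M * cos_sin M p z) * (2 / M * cos_sin M q z) \<partial>lebesgue_on (square M)) = (if p = q then 1 else 0)"
    using gen[OF cont(2) cont(1) so(2)[OF ge(1,3)] so(1)[OF ge(2,4)]] by (simp add: cos_sin_def pq s_def c_def)
  show "(\<integral>z. (2 / M * sin_cos M p z) * (2 / M * sin_cos M q z) \<partial>lebesgue_on (square M)) = (if p = q then 1 else 0)"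
    using gen[OF cont(1) cont(2) so(1)[OF ge(1,3)] so(2)[OF ge(2,4)]] by (simp add: sin_cos_def pq s_def c_def)
qed

lemma sine_Parseval_approx:
  assumes M: "M > 0" and f: "continuous_on UNIV f" and s: "closure {x. f x \<noteq> 0} \<subseteq> interior (square M)" and \<epsilon>: "\<epsilon> > 0"
  obtains F where "finite F" "F \<subseteq> modes"
    "(\<integral>z. (f z)\<^sup>2 \<partial>lebesgue_on (square M)) \<le> (\<Sum>p\<in>F. (\<integral>z. f z * (2 / M * sin_sin M p z) \<partial>lebesgue_on (square M))\<^sup>2) + \<epsilon>"
proof -
  \<comment> \<open>A uniform error \<open>\<delta>\<close> on the square costs
    \<open>\<delta>\<^sup>2 * M\<^sup>2 = \<epsilon>\<close> in the integral of the square.\<close>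
  define \<delta> where "\<delta> = sqrt \<epsilon> / M"
  have \<delta>: "\<delta> > 0" using \<epsilon> M by (simp add: \<delta>_def)
  obtain F a where F: "finite F" "F \<subseteq> modes" "\<And>z. z \<in> square M \<Longrightarrow> \<bar>f z - (\<Sum>p\<in>F. a p * sin_sin M p z)\<bar> \<le> \<delta>"
    using sine_approximation[OF M f s \<delta>] by blast
  define g where "g = (\<lambda>z. f z - (\<Sum>p\<in>F. (a p * M / 2) * (2 / M * sin_sin M p z)))"
  have g: "\<bar>g z\<bar> \<le> \<delta>" if "z \<in> square M" for z
    using F(3)[OF that] M by (simp add: g_def)
  have cg: "continuous_on UNIV g" unfolding g_def by (intro continuous_intros f sin_sin_continuous)
  have "(\<integral>z. (f z)\<^sup>2 \<partial>lebesgue_on (square M)) - (\<Sum>p\<in>F. (\<integral>z. f z * (2 / M * sin_sin M p z) \<partial>lebesgue_on (square M))\<^sup>2)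
    \<le> (\<integral>z. (g z)\<^sup>2 \<partial>lebesgue_on (square M))"
    unfolding g_def
  proof (rule Bessel_defect[OF F(1)])
    show "sq_integrable (lebesgue_on (square M)) f" by (rule continuous_sq_integrable_square[OF f])
    show "sq_integrable (lebesgue_on (square M)) (\<lambda>z. 2 / M * sin_sin M p z)" for p
      by (intro continuous_sq_integrable_square continuous_intros sin_sin_continuous)
    show "(\<integral>z. (2 / M * sin_sin M p z) * (2 / M * sin_sin M q z) \<partial>lebesgue_on (square M)) = (if p = q then 1 else 0)"
      if "p \<in> F" "q \<in> F" for p q using modes_orthonormal(1)[OF M] that F(2) by blast
  qed
  also have "\<dots> \<le> (\<integral>z. (\<delta>\<^sup>2 * 1) * 1 \<partial>lebesgue_on (square M))"
  proof (rule integral_mono_AE)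
    show "integrable (lebesgue_on (square M)) (\<lambda>z. (g z)\<^sup>2)"
      using continuous_sq_integrable_square[OF cg] by (simp add: sq_integrable_def)
    show "integrable (lebesgue_on (square M)) (\<lambda>z. \<delta>\<^sup>2 * 1 * 1)"
      unfolding square_def by (rule continuous_imp_integrable) (auto intro: continuous_intros)
    have "z \<in> square M \<Longrightarrow> (g z)\<^sup>2 \<le> \<delta>\<^sup>2" for z using g[of z] \<delta> by (metis abs_le_square_iff abs_of_pos)
    then show "AE z in lebesgue_on (square M). (g z)\<^sup>2 \<le> \<delta>\<^sup>2 * 1 * 1"
      by (intro AE_I2) (auto simp: square_def)
  qed
  also have "(\<integral>z. (\<delta>\<^sup>2 * 1) * 1 \<partial>lebesgue_on (square M)) = (\<delta>\<^sup>2 * M) * M"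
    using integral_square_product[of "\<lambda>_. \<delta>\<^sup>2 * 1" "\<lambda>_. 1" M] M by simp
  also have "\<dots> = \<epsilon>" using M \<epsilon> by (simp add: \<delta>_def power_divide power2_eq_square[of M])
  finally show thesis using that[OF F(1,2)] by simp
qed

section \<open>Disjoint copies in a square\<close>

text \<open>Support compactly inside \<open>\<Omega>\<close> lets such functions be extended by zero
  and moved to the copies. Passing to finite sums keeps the class, with \<open>f'\<close> following
  linearly.\<close>

definition compact_C1 :: "(real^2) set \<Rightarrow> (real^2 \<Rightarrow> real) \<Rightarrow> (2 \<Rightarrow> real^2 \<Rightarrow> real) \<Rightarrow> bool" where
  "compact_C1 \<Omega> f f' \<longleftrightarrow> Cc f \<and> closure {x. f x \<noteq> 0} \<subseteq> \<Omega> \<and>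
     (\<forall>i. Cc (f' i) \<and> closure {x. f' i x \<noteq> 0} \<subseteq> \<Omega> \<and> deriv_along (axis i 1) f (f' i))"

locale disjoint_copies =
  fixes \<Omega> :: "(real^2) set" and J :: "'j set" and \<sigma> :: "'j \<Rightarrow> real" and \<tau> :: "'j \<Rightarrow> real^2" and M :: real
  assumes \<Omega>: "open \<Omega>" and J: "finite J" and M: "M > 0"
    and \<sigma>: "\<And>m. m \<in> J \<Longrightarrow> \<bar>\<sigma> m\<bar> = 1"
    and inside: "\<And>m x. m \<in> J \<Longrightarrow> x \<in> \<Omega> \<Longrightarrow> \<sigma> m *\<^sub>R x + \<tau> m \<in> interior (square M)"
    and disjoint: "\<And>m l x y. \<lbrakk>m \<in> J; l \<in> J; x \<in> \<Omega>; y \<in> \<Omega>; \<sigma> m *\<^sub>R x + \<tau> m = \<sigma> l *\<^sub>R y + \<tau> l\<rbrakk> \<Longrightarrow> m = l"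
begin

definition place :: "'j \<Rightarrow> real^2 \<Rightarrow> real^2" where "place m x = \<sigma> m *\<^sub>R x + \<tau> m"
text \<open>The sign \<open>\<sigma> m\<close> is its own inverse.\<close>

definition unplace :: "'j \<Rightarrow> real^2 \<Rightarrow> real^2" where "unplace m z = \<sigma> m *\<^sub>R (z - \<tau> m)"

lemma \<sigma>_sq: "m \<in> J \<Longrightarrow> \<sigma> m * \<sigma> m = 1"
  using \<sigma>[of m] by (metis abs_mult_self_eq mult_1)

lemma unplace_place: "m \<in> J \<Longrightarrow> unplace m (place m x) = x" "m \<in> J \<Longrightarrow> place m (unplace m z) = z"
  by (simp_all add: place_def unplace_def \<sigma>_sq)

lemma continuous_place: "continuous_on S (place m)" "continuous_on S (unplace m)"
  unfolding place_def[abs_def] unplace_def[abs_def] by (auto intro!: continuous_intros)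

definition glue :: "('j \<Rightarrow> real^2 \<Rightarrow> real) \<Rightarrow> real^2 \<Rightarrow> real" where
  "glue f z = (\<Sum>m\<in>J. f m (unplace m z))"

context
  fixes f :: "'j \<Rightarrow> real^2 \<Rightarrow> real"
  assumes f: "\<And>m. m \<in> J \<Longrightarrow> Cc (f m)" "\<And>m. m \<in> J \<Longrightarrow> closure {x. f m x \<noteq> 0} \<subseteq> \<Omega>"
begin

lemma piece_support:
  assumes m: "m \<in> J"
  shows "closure {z. f m (unplace m z) \<noteq> 0} \<subseteq> place m ` closure {x. f m x \<noteq> 0}"
proof (rule closure_minimal)
  show "{z. f m (unplace m z) \<noteq> 0} \<subseteq> place m ` closure {x. f m x \<noteq> 0}"
  proof
    fix z assume "z \<in> {z. f m (unplace m z) \<noteq> 0}"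
    then have "unplace m z \<in> closure {x. f m x \<noteq> 0}" using closure_subset[of "{x. f m x \<noteq> 0}"] by auto
    then show "z \<in> place m ` closure {x. f m x \<noteq> 0}" using unplace_place(2)[OF m, of z] by (metis image_eqI)
  qed
  have "compact (place m ` closure {x. f m x \<noteq> 0})"
    using f(1)[OF m] by (intro compact_continuous_image continuous_place) (simp add: Cc_def)
  then show "closed (place m ` closure {x. f m x \<noteq> 0})" by (rule compact_imp_closed)
qed

lemma piece_cc: assumes m: "m \<in> J" shows "Cc (\<lambda>z. f m (unplace m z))"
proof -
  have "compact (place m ` closure {x. f m x \<noteq> 0})"
    using f(1)[OF m] by (intro compact_continuous_image continuous_place) (simp add: Cc_def)
  then have "compact (closure {z. f m (unplace m z) \<noteq> 0})"
    using piece_support[OF m] by (rule compact_closed_subset[OF _ closed_closure])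
  moreover have "continuous_on UNIV (\<lambda>z. f m (unplace m z))"
    using f(1)[OF m] unfolding Cc_def by (auto intro!: continuous_on_compose2[of UNIV "f m"] continuous_place)
  ultimately show ?thesis by (simp add: Cc_def)
qed

lemma piece_in_square:
  assumes m: "m \<in> J" shows "closure {z. f m (unplace m z) \<noteq> 0} \<subseteq> interior (square M)"
proof -
  have "place m ` closure {x. f m x \<noteq> 0} \<subseteq> interior (square M)"
    using f(2)[OF m] inside[OF m] by (auto simp: place_def)
  then show ?thesis using piece_support[OF m] by blast
qed

lemma glue_support: "closure {z. glue f z \<noteq> 0} \<subseteq> interior (square M)"
proof -
  have "{z. glue f z \<noteq> 0} \<subseteq> (\<Union>m\<in>J. {z. f m (unplace m z) \<noteq> 0})"
  proof
    fix z assume "z \<in> {z. glue f z \<noteq> 0}"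
    then have "(\<Sum>m\<in>J. f m (unplace m z)) \<noteq> 0" by (simp add: glue_def)
    then show "z \<in> (\<Union>m\<in>J. {z. f m (unplace m z) \<noteq> 0})" using sum.not_neutral_contains_not_neutral by fastforce
  qed
  also have "\<dots> \<subseteq> (\<Union>m\<in>J. closure {z. f m (unplace m z) \<noteq> 0})"
    by (rule UN_mono[OF order_refl closure_subset])
  finally have "closure {z. glue f z \<noteq> 0} \<subseteq> (\<Union>m\<in>J. closure {z. f m (unplace m z) \<noteq> 0})"
    using J by (intro closure_minimal) auto
  then show ?thesis using piece_in_square by blast
qed

lemma glue_continuous: "continuous_on UNIV (glue f)"
  unfolding glue_def[abs_def] using piece_cc by (intro continuous_on_sum) (simp add: Cc_def)

lemma integral_piece:
  assumes m: "m \<in> J" and h: "continuous_on UNIV h"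
  shows "(\<integral>z. f m (unplace m z) * h z \<partial>lebesgue_on (square M)) = (\<integral>x. f m x * h (place m x) \<partial>lebesgue_on \<Omega>)"
    "integrable (lebesgue_on (square M)) (\<lambda>z. f m (unplace m z) * h z)"
proof -
  have c: "Cc (\<lambda>z. f m (unplace m z) * h z)" by (rule Cc_mult[OF piece_cc[OF m] h])
  have s: "square M \<in> sets lebesgue" by (simp add: square_def)
  have "f m (unplace m z) * h z = 0" if "z \<notin> square M" for z
  proof -
    have "z \<notin> closure {z. f m (unplace m z) \<noteq> 0}" using that piece_in_square[OF m] interior_subset by blast
    then show ?thesis using closure_subset[of "{z. f m (unplace m z) \<noteq> 0}"] by auto
  qed
  then have "(\<integral>z. f m (unplace m z) * h z \<partial>lebesgue_on (square M)) = (\<integral>z. f m (unplace m z) * h z \<partial>lborel)"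
    by (rule Cc_lebesgue_on(3)[OF c s])
  also have "\<dots> = (\<integral>x. f m (unplace m (\<sigma> m *\<^sub>R x + \<tau> m)) * h (\<sigma> m *\<^sub>R x + \<tau> m) \<partial>lborel)"
    by (rule integral_lborel_isometry[OF Cc_measurable[OF c] \<sigma>[OF m], symmetric])
  also have "\<dots> = (\<integral>x. f m x * h (place m x) \<partial>lborel)"
    by (simp only: place_def[symmetric] unplace_place(1)[OF m])
  also have "\<dots> = (\<integral>x. f m x * h (place m x) \<partial>lebesgue_on \<Omega>)"
  proof (rule Cc_lebesgue_on(3)[symmetric])
    show "Cc (\<lambda>x. f m x * h (place m x))"
      by (intro Cc_mult f(1)[OF m] continuous_on_compose2[OF h continuous_place(1)]) auto
    show "\<Omega> \<in> sets lebesgue" using \<Omega> by simp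
    fix x assume "x \<notin> \<Omega>" then show "f m x * h (place m x) = 0"
      using f(2)[OF m] closure_subset[of "{x. f m x \<noteq> 0}"] by auto
  qed
  finally show "(\<integral>z. f m (unplace m z) * h z \<partial>lebesgue_on (square M)) = (\<integral>x. f m x * h (place m x) \<partial>lebesgue_on \<Omega>)" .
  show "integrable (lebesgue_on (square M)) (\<lambda>z. f m (unplace m z) * h z)" by (rule Cc_lebesgue_on(1)[OF c s])
qed

lemma integral_glue:
  assumes h: "continuous_on UNIV h"
  shows "(\<integral>z. glue f z * h z \<partial>lebesgue_on (square M)) = (\<Sum>m\<in>J. \<integral>x. f m x * h (place m x) \<partial>lebesgue_on \<Omega>)"
proof -
  have "(\<integral>z. glue f z * h z \<partial>lebesgue_on (square M)) = (\<integral>z. (\<Sum>m\<in>J. f m (unplace m z) * h z) \<partial>lebesgue_on (square M))"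
    by (simp add: glue_def sum_distrib_right)
  also have "\<dots> = (\<Sum>m\<in>J. \<integral>x. f m x * h (place m x) \<partial>lebesgue_on \<Omega>)"
    using integral_piece[OF _ h] by (subst Bochner_Integration.integral_sum) auto
  finally show ?thesis .
qed

end

lemma integral_glue_square:
  assumes f: "\<And>m. m \<in> J \<Longrightarrow> Cc (f m)" "\<And>m. m \<in> J \<Longrightarrow> closure {x. f m x \<noteq> 0} \<subseteq> \<Omega>"
  shows "(\<integral>z. (glue f z)\<^sup>2 \<partial>lebesgue_on (square M)) = (\<Sum>m\<in>J. \<integral>x. (f m x)\<^sup>2 \<partial>lebesgue_on \<Omega>)"
proof -
  have "(glue f z)\<^sup>2 = glue (\<lambda>m x. f m x * f m x) z * 1" for z
  proof -
    have off: "f m (unplace m z) * f l (unplace l z) = 0" if "m \<in> J" "l \<in> J" "m \<noteq> l" for m l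
    proof (rule ccontr)
      assume "f m (unplace m z) * f l (unplace l z) \<noteq> 0"
      then have "unplace m z \<in> \<Omega>" "unplace l z \<in> \<Omega>"
        using f(2)[OF that(1)] f(2)[OF that(2)] closure_subset[of "{x. f m x \<noteq> 0}"] closure_subset[of "{x. f l x \<noteq> 0}"] by auto
      moreover have "\<sigma> m *\<^sub>R unplace m z + \<tau> m = \<sigma> l *\<^sub>R unplace l z + \<tau> l"
        using unplace_place(2)[OF that(1), of z] unplace_place(2)[OF that(2), of z] by (simp add: place_def)
      ultimately show False using disjoint[OF that(1,2)] that(3) by blast
    qed
    have "(glue f z)\<^sup>2 = (\<Sum>m\<in>J. \<Sum>l\<in>J. f m (unplace m z) * f l (unplace l z))"
      by (simp add: glue_def power2_eq_square sum_product)
    also have "\<dots> = (\<Sum>m\<in>J. \<Sum>l\<in>J. if l = m then f m (unplace m z) * f m (unplace m z) else 0)"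
      using off by (intro sum.cong) auto
    also have "\<dots> = glue (\<lambda>m x. f m x * f m x) z * 1" using J by (simp add: glue_def)
    finally show ?thesis .
  qed
  then have "(\<integral>z. (glue f z)\<^sup>2 \<partial>lebesgue_on (square M)) = (\<integral>z. glue (\<lambda>m x. f m x * f m x) z * 1 \<partial>lebesgue_on (square M))"
    by simp
  also have "\<dots> = (\<Sum>m\<in>J. \<integral>x. f m x * f m x * 1 \<partial>lebesgue_on \<Omega>)"
  proof (rule integral_glue)
    fix m assume m: "m \<in> J"
    show "Cc (\<lambda>x. f m x * f m x)" using f(1)[OF m] by (intro Cc_mult) (auto simp: Cc_def)
    show "closure {x. f m x * f m x \<noteq> 0} \<subseteq> \<Omega>" using f(2)[OF m] by simp
  qed simp
  finally show ?thesis by (simp add: power2_eq_square)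
qed

lemma deriv_along_place:
  assumes h: "\<And>z. ((\<lambda>t. h (z + t *\<^sub>R axis i 1)) has_real_derivative h' z) (at 0)"
  shows "deriv_along (axis i 1) (\<lambda>x. h (place m x)) (\<lambda>x. \<sigma> m * h' (place m x))"
  unfolding deriv_along_def
proof
  fix x
  have "((\<lambda>t. h (place m x + (\<sigma> m * t) *\<^sub>R axis i 1)) has_real_derivative h' (place m x) * \<sigma> m) (at 0)"
    by (rule DERIV_chain'[where g = "\<lambda>t. h (place m x + t *\<^sub>R axis i 1)" and f = "\<lambda>t. \<sigma> m * t"])
      (use h in \<open>auto intro!: derivative_eq_intros\<close>)
  then show "((\<lambda>t. h (place m (x + t *\<^sub>R axis i 1))) has_real_derivative \<sigma> m * h' (place m x)) (at 0)"
    by (simp add: place_def algebra_simps)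
qed

text \<open>The Fourier coefficient of the glued function for the normalised sine mode
  \<open>p\<close>, with the integrals pulled back to \<open>\<Omega>\<close>.\<close>

definition coeff :: "('j \<Rightarrow> real^2 \<Rightarrow> real) \<Rightarrow> nat \<times> nat \<Rightarrow> real" where
  "coeff f p = (\<Sum>m\<in>J. \<integral>x. f m x * (2 / M * sin_sin M p (place m x)) \<partial>lebesgue_on \<Omega>)"

text \<open>The Dirichlet eigenvalue of the square of side \<open>M\<close> that belongs to the mode
  \<open>p\<close>.\<close>

definition freq :: "nat \<times> nat \<Rightarrow> real" where
  "freq p = (pi / M)\<^sup>2 * ((real (fst p))\<^sup>2 + (real (snd p))\<^sup>2)"

context
  fixes f :: "'j \<Rightarrow> real^2 \<Rightarrow> real" and f' :: "'j \<Rightarrow> 2 \<Rightarrow> real^2 \<Rightarrow> real"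
  assumes f: "\<And>m. m \<in> J \<Longrightarrow> compact_C1 \<Omega> (f m) (f' m)"
begin

lemma grad_part:
  shows "m \<in> J \<Longrightarrow> Cc (\<lambda>x. \<sigma> m * f' m i x)" "m \<in> J \<Longrightarrow> closure {x. \<sigma> m * f' m i x \<noteq> 0} \<subseteq> \<Omega>"
    "(\<integral>z. (glue (\<lambda>m x. \<sigma> m * f' m i x) z)\<^sup>2 \<partial>lebesgue_on (square M)) = (\<Sum>m\<in>J. \<integral>x. (f' m i x)\<^sup>2 \<partial>lebesgue_on \<Omega>)"
proof -
  show c: "m \<in> J \<Longrightarrow> Cc (\<lambda>x. \<sigma> m * f' m i x)" for m
    using f[of m] Cc_mult[of "f' m i" "\<lambda>_. \<sigma> m"] by (simp add: compact_C1_def mult.commute)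
  show s: "m \<in> J \<Longrightarrow> closure {x. \<sigma> m * f' m i x \<noteq> 0} \<subseteq> \<Omega>" for m
  proof -
    assume m: "m \<in> J"
    have "{x. \<sigma> m * f' m i x \<noteq> 0} = {x. f' m i x \<noteq> 0}" using \<sigma>[OF m] by auto
    then show ?thesis using f[OF m] by (simp add: compact_C1_def)
  qed
  show "(\<integral>z. (glue (\<lambda>m x. \<sigma> m * f' m i x) z)\<^sup>2 \<partial>lebesgue_on (square M)) = (\<Sum>m\<in>J. \<integral>x. (f' m i x)\<^sup>2 \<partial>lebesgue_on \<Omega>)"
  proof -
    have "(\<integral>z. (glue (\<lambda>m x. \<sigma> m * f' m i x) z)\<^sup>2 \<partial>lebesgue_on (square M)) = (\<Sum>m\<in>J. \<integral>x. (\<sigma> m * f' m i x)\<^sup>2 \<partial>lebesgue_on \<Omega>)"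
      using c s by (intro integral_glue_square) auto
    also have "\<dots> = (\<Sum>m\<in>J. \<integral>x. (f' m i x)\<^sup>2 \<partial>lebesgue_on \<Omega>)"
      by (intro sum.cong) (auto simp: power_mult_distrib power2_eq_square[of "\<sigma> _"] \<sigma>_sq)
    finally show ?thesis .
  qed
qed

text \<open>Integration by parts on each copy. The sign \<open>\<sigma> m\<close> enters once
  through the transported gradient and once through the chain rule, so reflected copies contribute
  like translated ones. The function \<open>h\<close> will be \<open>cos_sin\<close> or
  \<open>sin_cos\<close>.\<close>

lemma coeff_deriv:
  fixes h :: "real^2 \<Rightarrow> real" and w :: real
  assumes h: "\<And>z. ((\<lambda>t. h (z + t *\<^sub>R axis i 1)) has_real_derivative - w * sin_sin M p z) (at 0)" "continuous_on UNIV h"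
  shows "(\<integral>z. glue (\<lambda>m x. \<sigma> m * f' m i x) z * (2 / M * h z) \<partial>lebesgue_on (square M)) = w * coeff f p"
proof -
  have O: "\<Omega> \<in> sets lebesgue" using \<Omega> by simp
  have ch: "continuous_on UNIV (\<lambda>z. 2 / M * h z)" by (intro continuous_intros h)
  have "(\<integral>z. glue (\<lambda>m x. \<sigma> m * f' m i x) z * (2 / M * h z) \<partial>lebesgue_on (square M))
    = (\<Sum>m\<in>J. \<integral>x. \<sigma> m * f' m i x * (2 / M * h (place m x)) \<partial>lebesgue_on \<Omega>)"
    using grad_part ch by (intro integral_glue) auto
  also have "\<dots> = (\<Sum>m\<in>J. w * (\<integral>x. f m x * (2 / M * sin_sin M p (place m x)) \<partial>lebesgue_on \<Omega>))"
  proof (rule sum.cong[OF refl])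
    fix m assume m: "m \<in> J"
    have d: "deriv_along (axis i 1) (\<lambda>x. h (place m x)) (\<lambda>x. \<sigma> m * (- w * sin_sin M p (place m x)))"
      by (rule deriv_along_place[OF h(1)])
    have hc: "continuous_on UNIV (\<lambda>x. h (place m x))" by (intro continuous_on_compose2[OF h(2) continuous_place(1)]) auto
    have sc: "continuous_on UNIV (\<lambda>x. sin_sin M p (place m x))"
      by (intro continuous_on_compose2[OF sin_sin_continuous(1)[of UNIV] continuous_place(1)]) auto
    have zero: "f m x = 0" "f' m i x = 0" if "x \<notin> \<Omega>" for x
    proof -
      have "closure {x. f m x \<noteq> 0} \<subseteq> \<Omega>" "closure {x. f' m i x \<noteq> 0} \<subseteq> \<Omega>"
        using f[OF m] by (simp_all add: compact_C1_def)
      then show "f m x = 0" "f' m i x = 0"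
        using that closure_subset[of "{x. f m x \<noteq> 0}"] closure_subset[of "{x. f' m i x \<noteq> 0}"] by auto
    qed
    have fc: "Cc (f m)" "Cc (f' m i)" "deriv_along (axis i 1) (f m) (f' m i)" using f[OF m] by (auto simp: compact_C1_def)
    have 1: "(\<integral>x. \<sigma> m * f' m i x * (2 / M * h (place m x)) \<partial>lebesgue_on \<Omega>) = \<sigma> m * (2 / M) * (\<integral>x. f' m i x * h (place m x) \<partial>lborel)"
    proof -
      have "(\<integral>x. \<sigma> m * f' m i x * (2 / M * h (place m x)) \<partial>lebesgue_on \<Omega>) = (\<integral>x. \<sigma> m * (2 / M) * (f' m i x * h (place m x)) \<partial>lebesgue_on \<Omega>)"
        by (intro Bochner_Integration.integral_cong) (auto simp: algebra_simps)
      also have "\<dots> = \<sigma> m * (2 / M) * (\<integral>x. f' m i x * h (place m x) \<partial>lebesgue_on \<Omega>)" by simp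
      also have "(\<integral>x. f' m i x * h (place m x) \<partial>lebesgue_on \<Omega>) = (\<integral>x. f' m i x * h (place m x) \<partial>lborel)"
        by (rule Cc_lebesgue_on(3)[OF Cc_mult[OF fc(2) hc] O]) (simp add: zero)
      finally show ?thesis .
    qed
    have 2: "(\<integral>x. f m x * (2 / M * sin_sin M p (place m x)) \<partial>lebesgue_on \<Omega>) = 2 / M * (\<integral>x. f m x * sin_sin M p (place m x) \<partial>lborel)"
    proof -
      have "(\<integral>x. f m x * (2 / M * sin_sin M p (place m x)) \<partial>lebesgue_on \<Omega>) = (\<integral>x. 2 / M * (f m x * sin_sin M p (place m x)) \<partial>lebesgue_on \<Omega>)"
        by (intro Bochner_Integration.integral_cong) (auto simp: algebra_simps)
      also have "\<dots> = 2 / M * (\<integral>x. f m x * sin_sin M p (place m x) \<partial>lebesgue_on \<Omega>)" by simp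
      also have "(\<integral>x. f m x * sin_sin M p (place m x) \<partial>lebesgue_on \<Omega>) = (\<integral>x. f m x * sin_sin M p (place m x) \<partial>lborel)"
        by (rule Cc_lebesgue_on(3)[OF Cc_mult[OF fc(1) sc] O]) (simp add: zero)
      finally show ?thesis .
    qed
    have "(\<integral>x. f' m i x * h (place m x) \<partial>lborel) = - (\<integral>x. f m x * (\<sigma> m * (- w * sin_sin M p (place m x))) \<partial>lborel)"
      by (rule integral_by_parts_along[OF fc(3,1,2) d hc]) (auto intro!: continuous_intros sc)
    also have "(\<integral>x. f m x * (\<sigma> m * (- w * sin_sin M p (place m x))) \<partial>lborel) = (\<integral>x. (- \<sigma> m * w) * (f m x * sin_sin M p (place m x)) \<partial>lborel)"
      by (intro Bochner_Integration.integral_cong) (auto simp: algebra_simps)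
    also have "- \<dots> = \<sigma> m * w * (\<integral>x. f m x * sin_sin M p (place m x) \<partial>lborel)" by simp
    finally have "(\<integral>x. f' m i x * h (place m x) \<partial>lborel) = \<sigma> m * w * (\<integral>x. f m x * sin_sin M p (place m x) \<partial>lborel)" .
    then have "\<sigma> m * (2 / M) * (\<integral>x. f' m i x * h (place m x) \<partial>lborel) = (\<sigma> m * \<sigma> m) * w * (2 / M) * (\<integral>x. f m x * sin_sin M p (place m x) \<partial>lborel)"
      by simp
    then show "(\<integral>x. \<sigma> m * f' m i x * (2 / M * h (place m x)) \<partial>lebesgue_on \<Omega>) = w * (\<integral>x. f m x * (2 / M * sin_sin M p (place m x)) \<partial>lebesgue_on \<Omega>)"
      unfolding 1 2 \<sigma>_sq[OF m] by simp
  qed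
  also have "\<dots> = w * coeff f p" by (simp add: coeff_def sum_distrib_left)
  finally show ?thesis .
qed

text \<open>Differentiation turns a sine coefficient into a mixed coefficient multiplied by a wave
  number, and the squares of the two wave numbers add up to \<open>freq p\<close>.\<close>

lemma Bessel_gradient:
  assumes F: "finite F" "F \<subseteq> modes"
  shows "(\<Sum>p\<in>F. freq p * (coeff f p)\<^sup>2) \<le> (\<Sum>m\<in>J. (\<integral>x. (f' m 1 x)\<^sup>2 \<partial>lebesgue_on \<Omega>) + (\<integral>x. (f' m 2 x)\<^sup>2 \<partial>lebesgue_on \<Omega>))"
proof -
  have d1: "((\<lambda>t. cos_sin M p (z + t *\<^sub>R axis 1 1)) has_real_derivative - (real (fst p) * pi / M) * sin_sin M p z) (at 0)" for p z
    unfolding cos_sin_def sin_sin_def using M by (auto intro!: derivative_eq_intros simp: axis_def)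
  have d2: "((\<lambda>t. sin_cos M p (z + t *\<^sub>R axis 2 1)) has_real_derivative - (real (snd p) * pi / M) * sin_sin M p z) (at 0)" for p z
    unfolding sin_cos_def sin_sin_def using M by (auto intro!: derivative_eq_intros simp: axis_def)
  have sq: "sq_integrable (lebesgue_on (square M)) (glue (\<lambda>m x. \<sigma> m * f' m i x))" for i
    by (intro continuous_sq_integrable_square glue_continuous grad_part)
  have e: "sq_integrable (lebesgue_on (square M)) (\<lambda>z. 2 / M * cos_sin M p z)" 
    "sq_integrable (lebesgue_on (square M)) (\<lambda>z. 2 / M * sin_cos M p z)" for p
    by (intro continuous_sq_integrable_square continuous_intros sin_sin_continuous)+
  have 1: "(\<Sum>p\<in>F. (\<integral>z. glue (\<lambda>m x. \<sigma> m * f' m 1 x) z * (2 / M * cos_sin M p z) \<partial>lebesgue_on (square M))\<^sup>2)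
    \<le> (\<integral>z. (glue (\<lambda>m x. \<sigma> m * f' m 1 x) z)\<^sup>2 \<partial>lebesgue_on (square M))"
    using F(2) modes_orthonormal(2)[OF M] by (intro Bessel_inequality F(1) sq e) blast
  have 2: "(\<Sum>p\<in>F. (\<integral>z. glue (\<lambda>m x. \<sigma> m * f' m 2 x) z * (2 / M * sin_cos M p z) \<partial>lebesgue_on (square M))\<^sup>2)
    \<le> (\<integral>z. (glue (\<lambda>m x. \<sigma> m * f' m 2 x) z)\<^sup>2 \<partial>lebesgue_on (square M))"
    using F(2) modes_orthonormal(3)[OF M] by (intro Bessel_inequality F(1) sq e) blast
  have "(\<Sum>p\<in>F. freq p * (coeff f p)\<^sup>2) = (\<Sum>p\<in>F. (real (fst p) * pi / M * coeff f p)\<^sup>2) + (\<Sum>p\<in>F. (real (snd p) * pi / M * coeff f p)\<^sup>2)"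
    unfolding sum.distrib[symmetric]
    by (intro sum.cong) (simp_all add: freq_def power_mult_distrib power_divide distrib_right distrib_left add_divide_distrib mult.commute mult.left_commute)
  then show ?thesis
    using 1 2 unfolding coeff_deriv[OF d1 sin_sin_continuous(2)] coeff_deriv[OF d2 sin_sin_continuous(3)] grad_part(3)
    by (simp add: sum.distrib)
qed

text \<open>Outside \<open>F0\<close>, approximate Parseval for the function meets Bessel for the
  gradient, and the factor \<open>freq p\<close> is at least \<open>\<rho>\<close>. A finite
  \<open>F\<close> suffices for each \<open>\<epsilon>\<close>.\<close>

lemma spectral_gap_inequality:
  assumes F0: "finite F0" "F0 \<subseteq> modes" and l: "\<rho> \<ge> 0" "\<And>p. p \<in> modes - F0 \<Longrightarrow> \<rho> \<le> freq p"
  shows "\<rho> * ((\<Sum>m\<in>J. \<integral>x. (f m x)\<^sup>2 \<partial>lebesgue_on \<Omega>) - (\<Sum>p\<in>F0. (coeff f p)\<^sup>2))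
    \<le> (\<Sum>m\<in>J. (\<integral>x. (f' m 1 x)\<^sup>2 \<partial>lebesgue_on \<Omega>) + (\<integral>x. (f' m 2 x)\<^sup>2 \<partial>lebesgue_on \<Omega>))" (is "_ \<le> ?E")
proof (rule field_le_epsilon)
  fix \<epsilon> :: real assume \<epsilon>: "\<epsilon> > 0"
  define \<delta> where "\<delta> = \<epsilon> / (\<rho> + 1)"
  have \<delta>: "\<delta> > 0" "\<rho> * \<delta> \<le> \<epsilon>" using \<epsilon> l(1) by (auto simp: \<delta>_def field_simps)
  have c: "\<And>m. m \<in> J \<Longrightarrow> Cc (f m)" "\<And>m. m \<in> J \<Longrightarrow> closure {x. f m x \<noteq> 0} \<subseteq> \<Omega>"
    using f by (auto simp: compact_C1_def)
  have co: "(\<integral>z. glue f z * (2 / M * sin_sin M p z) \<partial>lebesgue_on (square M)) = coeff f p" for p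
    unfolding coeff_def using c M by (intro integral_glue) (auto intro!: continuous_intros sin_sin_continuous)
  have gs: "(\<integral>z. (glue f z)\<^sup>2 \<partial>lebesgue_on (square M)) = (\<Sum>m\<in>J. \<integral>x. (f m x)\<^sup>2 \<partial>lebesgue_on \<Omega>)"
    using c by (intro integral_glue_square) auto
  have gc: "continuous_on UNIV (glue f)" "closure {z. glue f z \<noteq> 0} \<subseteq> interior (square M)"
    using glue_continuous[of f] glue_support[of f] c by auto
  obtain F where F: "finite F" "F \<subseteq> modes"
    "(\<Sum>m\<in>J. \<integral>x. (f m x)\<^sup>2 \<partial>lebesgue_on \<Omega>) \<le> (\<Sum>p\<in>F. (coeff f p)\<^sup>2) + \<delta>"
    by (rule sine_Parseval_approx[OF M gc \<delta>(1), unfolded co gs])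
  have "(\<Sum>p\<in>F. (coeff f p)\<^sup>2) - (\<Sum>p\<in>F0. (coeff f p)\<^sup>2) \<le> (\<Sum>p\<in>F - F0. (coeff f p)\<^sup>2)"
  proof -
    have "(\<Sum>p\<in>F. (coeff f p)\<^sup>2) \<le> (\<Sum>p\<in>(F - F0) \<union> F0. (coeff f p)\<^sup>2)"
      using F F0 by (intro sum_mono2) auto
    also have "\<dots> = (\<Sum>p\<in>F - F0. (coeff f p)\<^sup>2) + (\<Sum>p\<in>F0. (coeff f p)\<^sup>2)"
      using F F0 by (intro sum.union_disjoint) auto
    finally show ?thesis by simp
  qed
  then have "\<rho> * ((\<Sum>m\<in>J. \<integral>x. (f m x)\<^sup>2 \<partial>lebesgue_on \<Omega>) - (\<Sum>p\<in>F0. (coeff f p)\<^sup>2)) \<le> \<rho> * ((\<Sum>p\<in>F - F0. (coeff f p)\<^sup>2) + \<delta>)"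
    using F(3) l(1) by (intro mult_left_mono) auto
  also have "\<dots> = (\<Sum>p\<in>F - F0. \<rho> * (coeff f p)\<^sup>2) + \<rho> * \<delta>" by (simp add: distrib_left sum_distrib_left)
  also have "\<dots> \<le> (\<Sum>p\<in>F - F0. freq p * (coeff f p)\<^sup>2) + \<epsilon>"
    using \<delta>(2) l(2) F(2) by (intro add_mono sum_mono mult_right_mono) auto
  also have "\<dots> \<le> ?E + \<epsilon>" using Bessel_gradient[of "F - F0"] F by auto
  finally show "\<rho> * ((\<Sum>m\<in>J. \<integral>x. (f m x)\<^sup>2 \<partial>lebesgue_on \<Omega>) - (\<Sum>p\<in>F0. (coeff f p)\<^sup>2)) \<le> ?E + \<epsilon>" .
qed

end

end

section \<open>Linear systems, Gram forms and weak gradients\<close>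

lemma homogeneous_system:
  fixes a :: "'p \<Rightarrow> 'i \<Rightarrow> real"
  assumes "finite F" "finite I" "card F < card I"
  shows "\<exists>c. (\<exists>i\<in>I. c i \<noteq> 0) \<and> (\<forall>p\<in>F. (\<Sum>i\<in>I. a p i * c i) = 0)"
  using assms
proof (induction F arbitrary: I a rule: finite_induct)
  case empty
  then obtain i where "i \<in> I" by fastforce
  then show ?case by (intro exI[of _ "\<lambda>_. 1"]) auto
next
  case (insert p F)
  show ?case
  proof (cases "\<forall>i\<in>I. a p i = 0")
    case True
    have "card F < card I" using insert by auto
    from insert.IH[OF insert.prems(1) this, of a] True show ?thesis by auto
  next
    case False
    then obtain i0 where i0: "i0 \<in> I" "a p i0 \<noteq> 0" by blast
    define I' where "I' = I - {i0}"
    have I': "finite I'" "I = insert i0 I'" "i0 \<notin> I'" using insert.prems i0 by (auto simp: I'_def)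
    have "card F < card I'" using insert I' by auto
    from insert.IH[OF I'(1) this, of "\<lambda>q i. a q i - a q i0 * a p i / a p i0"]
    obtain c where c: "\<exists>i\<in>I'. c i \<noteq> 0" "\<And>q. q \<in> F \<Longrightarrow> (\<Sum>i\<in>I'. (a q i - a q i0 * a p i / a p i0) * c i) = 0" by blast
    define s where "s = - (\<Sum>i\<in>I'. a p i * c i) / a p i0"
    define d where "d = c(i0 := s)"
    have dI: "(\<Sum>i\<in>I. a q i * d i) = a q i0 * s + (\<Sum>i\<in>I'. a q i * c i)" for q
    proof -
      have "(\<Sum>i\<in>I'. a q i * d i) = (\<Sum>i\<in>I'. a q i * c i)" using I'(3) by (intro sum.cong) (auto simp: d_def)
      then show ?thesis using I' by (simp add: d_def)
    qed
    have "(\<Sum>i\<in>I. a p i * d i) = 0" unfolding dI using i0 by (simp add: s_def)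
    moreover have "(\<Sum>i\<in>I. a q i * d i) = 0" if q: "q \<in> F" for q
    proof -
      have "(\<Sum>i\<in>I'. (a q i - a q i0 * a p i / a p i0) * c i) = (\<Sum>i\<in>I'. a q i * c i) - a q i0 / a p i0 * (\<Sum>i\<in>I'. a p i * c i)"
        by (simp add: left_diff_distrib sum_subtractf sum_distrib_left mult.assoc)
      then show ?thesis using c(2)[OF q] unfolding dI by (simp add: s_def)
    qed
    moreover have "\<exists>i\<in>I. d i \<noteq> 0" using c(1) I' by (auto simp: d_def)
    ultimately show ?thesis by blast
  qed
qed

lemma integral_square_sum:
  fixes c :: "'i \<Rightarrow> real"
  assumes "\<And>j. j \<in> I \<Longrightarrow> sq_integrable N (f j)"
  shows "(\<integral>x. (\<Sum>j\<in>I. c j * f j x)\<^sup>2 \<partial>N) = (\<Sum>j\<in>I. \<Sum>l\<in>I. c j * c l * (\<integral>x. f j x * f l x \<partial>N))"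
proof -
  have i: "integrable N (\<lambda>x. f j x * f l x)" if "j \<in> I" "l \<in> I" for j l
    by (rule sq_integrable_mult[OF assms[OF that(1)] assms[OF that(2)]])
  have "(\<integral>x. (\<Sum>j\<in>I. c j * f j x)\<^sup>2 \<partial>N) = (\<integral>x. (\<Sum>j\<in>I. \<Sum>l\<in>I. c j * c l * (f j x * f l x)) \<partial>N)"
    by (intro Bochner_Integration.integral_cong) (auto simp: power2_eq_square sum_product algebra_simps)
  also have "\<dots> = (\<Sum>j\<in>I. \<integral>x. (\<Sum>l\<in>I. c j * c l * (f j x * f l x)) \<partial>N)"
    using i by (intro Bochner_Integration.integral_sum Bochner_Integration.integrable_sum integrable_mult_right)
  also have "\<dots> = (\<Sum>j\<in>I. \<Sum>l\<in>I. c j * c l * (\<integral>x. f j x * f l x \<partial>N))"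
    using i by (intro sum.cong refl) (subst Bochner_Integration.integral_sum; simp)
  finally show ?thesis .
qed

lemma continuous_sq_integrable_bounded:
  fixes f :: "real^2 \<Rightarrow> real"
  assumes f: "continuous_on UNIV f" and S: "S \<in> sets lebesgue" "bounded S"
  shows "sq_integrable (lebesgue_on S) f"
proof -
  obtain l u where lu: "S \<subseteq> cbox l u" using bounded_subset_cbox_symmetric[OF S(2)] by blast
  have i: "integrable (lebesgue_on S) h" if h: "continuous_on UNIV h" for h :: "real^2 \<Rightarrow> real"
  proof -
    have "integrable (lebesgue_on (cbox l u)) h"
      by (intro continuous_imp_integrable continuous_on_subset[OF h]) simp
    then have "integrable lebesgue (\<lambda>x. if x \<in> cbox l u then h x else 0)"
      by (subst Lebesgue_Measure.integrable_restrict_UNIV) auto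
    from integrable_mult_indicator[OF _ this, of S]
    have "integrable lebesgue (\<lambda>x. indicator S x *\<^sub>R (if x \<in> cbox l u then h x else 0))" using S by simp
    also have "(\<lambda>x. indicator S x *\<^sub>R (if x \<in> cbox l u then h x else 0)) = (\<lambda>x. if x \<in> S then h x else 0)"
      by (rule ext) (use lu in \<open>auto simp: indicator_def\<close>)
    finally show ?thesis using S by (subst (asm) Lebesgue_Measure.integrable_restrict_UNIV) auto
  qed
  have "continuous_on UNIV (\<lambda>x. (f x)\<^sup>2)" by (intro continuous_intros f)
  then show ?thesis using i[OF f] i by (auto simp: sq_integrable_def)
qed

lemma deriv_along_sum:
  assumes "\<And>j. j \<in> I \<Longrightarrow> deriv_along e (f j) (f' j)"
  shows "deriv_along e (\<lambda>x. \<Sum>j\<in>I. c j * f j x) (\<lambda>x. \<Sum>j\<in>I. c j * f' j x)"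
  unfolding deriv_along_def
proof
  fix x
  show "((\<lambda>t. \<Sum>j\<in>I. c j * f j (x + t *\<^sub>R e)) has_real_derivative (\<Sum>j\<in>I. c j * f' j x)) (at 0)"
    using assms unfolding deriv_along_def by (intro DERIV_sum DERIV_cmult) auto
qed

lemma Cc_sum:
  assumes "finite I" "\<And>j. j \<in> I \<Longrightarrow> Cc (f j)" "\<And>j. j \<in> I \<Longrightarrow> closure {x. f j x \<noteq> 0} \<subseteq> \<Omega>"
  shows "Cc (\<lambda>x. \<Sum>j\<in>I. c j * f j x)" "closure {x. (\<Sum>j\<in>I. c j * f j x) \<noteq> 0} \<subseteq> \<Omega>"
proof -
  have "{x. (\<Sum>j\<in>I. c j * f j x) \<noteq> 0} \<subseteq> (\<Union>j\<in>I. closure {x. f j x \<noteq> 0})"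
  proof
    fix x assume "x \<in> {x. (\<Sum>j\<in>I. c j * f j x) \<noteq> 0}"
    then obtain j where j: "j \<in> I" "c j * f j x \<noteq> 0" using sum.not_neutral_contains_not_neutral by blast
    then show "x \<in> (\<Union>j\<in>I. closure {x. f j x \<noteq> 0})" using closure_subset[of "{x. f j x \<noteq> 0}"] by auto
  qed
  then have sub: "closure {x. (\<Sum>j\<in>I. c j * f j x) \<noteq> 0} \<subseteq> (\<Union>j\<in>I. closure {x. f j x \<noteq> 0})"
    using assms(1) by (intro closure_minimal) auto
  then show "closure {x. (\<Sum>j\<in>I. c j * f j x) \<noteq> 0} \<subseteq> \<Omega>" using assms(3) by blast
  have "compact (\<Union>j\<in>I. closure {x. f j x \<noteq> 0})" using assms by (intro compact_UN) (auto simp: Cc_def)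
  then have "compact (closure {x. (\<Sum>j\<in>I. c j * f j x) \<noteq> 0})" by (rule compact_closed_subset[OF _ closed_closure sub])
  moreover have "continuous_on UNIV (\<lambda>x. \<Sum>j\<in>I. c j * f j x)"
    using assms(2) by (intro continuous_intros) (auto simp: Cc_def)
  ultimately show "Cc (\<lambda>x. \<Sum>j\<in>I. c j * f j x)" by (simp add: Cc_def)
qed

lemma compact_C1_sum:
  assumes "finite I" "\<And>j. j \<in> I \<Longrightarrow> compact_C1 \<Omega> (f j) (f' j)"
  shows "compact_C1 \<Omega> (\<lambda>x. \<Sum>j\<in>I. c j * f j x) (\<lambda>i x. \<Sum>j\<in>I. c j * f' j i x)"
  using assms unfolding compact_C1_def
  by (intro conjI allI Cc_sum deriv_along_sum) auto

lemma test_function_compact_C1: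
  assumes "test_function \<Omega> \<phi>" shows "compact_C1 \<Omega> \<phi> (\<lambda>i. partial i \<phi>)"
proof -
  note t = test_functionD[OF assms]
  have "closure {x. partial i \<phi> x \<noteq> 0} \<subseteq> closure {x. \<phi> x \<noteq> 0}" for i
    using t(6)[of _ i] by (intro closure_minimal) auto
  then show ?thesis using t unfolding compact_C1_def by blast
qed

text \<open>The weak gradient and the approximating sequence are existential in \<open>H10\<close>;
  the limits below need them by name.\<close>

definition H10_approx :: "(real^2) set \<Rightarrow> (real^2 \<Rightarrow> real) \<Rightarrow> (2 \<Rightarrow> real^2 \<Rightarrow> real) \<Rightarrow> (nat \<Rightarrow> real^2 \<Rightarrow> real) \<Rightarrow> bool" where
  "H10_approx \<Omega> u g \<phi> \<longleftrightarrow> u \<in> L2 \<Omega> \<and> (\<forall>i. g i \<in> L2 \<Omega>) \<and> (\<forall>n. test_function \<Omega> (\<phi> n)) \<and>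
     (\<lambda>n. \<integral>x. (\<phi> n x - u x)\<^sup>2 \<partial>lebesgue_on \<Omega>) \<longlonglongrightarrow> 0 \<and>
     (\<forall>i. (\<lambda>n. \<integral>x. (partial i (\<phi> n) x - g i x)\<^sup>2 \<partial>lebesgue_on \<Omega>) \<longlonglongrightarrow> 0)"

lemma H10_approx_exists: "u \<in> H10 \<Omega> \<Longrightarrow> \<exists>g \<phi>. H10_approx \<Omega> u g \<phi>"
  unfolding H10_def H10_approx_def by blast

lemma H10_approxD:
  assumes "open \<Omega>" "H10_approx \<Omega> u g \<phi>"
  shows "sq_integrable (lebesgue_on \<Omega>) u" "sq_integrable (lebesgue_on \<Omega>) (g i)" "test_function \<Omega> (\<phi> n)"
    "sq_integrable (lebesgue_on \<Omega>) (\<phi> n)" "sq_integrable (lebesgue_on \<Omega>) (partial i (\<phi> n))"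
    "(\<lambda>n. \<integral>x. (\<phi> n x - u x)\<^sup>2 \<partial>lebesgue_on \<Omega>) \<longlonglongrightarrow> 0"
    "(\<lambda>n. \<integral>x. (partial i (\<phi> n) x - g i x)\<^sup>2 \<partial>lebesgue_on \<Omega>) \<longlonglongrightarrow> 0"
proof -
  show t: "test_function \<Omega> (\<phi> n)" for n using assms(2) by (simp add: H10_approx_def)
  show "sq_integrable (lebesgue_on \<Omega>) u" "sq_integrable (lebesgue_on \<Omega>) (g i)"
    using assms(2) by (auto simp: H10_approx_def L2_def sq_integrable_def)
  show "sq_integrable (lebesgue_on \<Omega>) (\<phi> n)" "sq_integrable (lebesgue_on \<Omega>) (partial i (\<phi> n))"
    using test_functionD[OF t] assms(1) by (auto intro: Cc_sq_integrable)
  show "(\<lambda>n. \<integral>x. (\<phi> n x - u x)\<^sup>2 \<partial>lebesgue_on \<Omega>) \<longlonglongrightarrow> 0"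
    "(\<lambda>n. \<integral>x. (partial i (\<phi> n) x - g i x)\<^sup>2 \<partial>lebesgue_on \<Omega>) \<longlonglongrightarrow> 0"
    using assms(2) by (auto simp: H10_approx_def)
qed

lemma L2_const_tendsto: "(\<lambda>n :: nat. \<integral>x. (f x - f x :: real)\<^sup>2 \<partial>N) \<longlonglongrightarrow> 0"
  by simp

text \<open>Integration by parts is available for the approximating test functions, and both sides
  pass to the limit by Cauchy-Schwarz.\<close>

lemma H10_green:
  assumes \<Omega>: "open \<Omega>" and u: "H10_approx \<Omega> u g \<phi>" and \<psi>: "test_function \<Omega> \<psi>"
  shows "(\<integral>x. g 1 x * partial 1 \<psi> x \<partial>lebesgue_on \<Omega>) + (\<integral>x. g 2 x * partial 2 \<psi> x \<partial>lebesgue_on \<Omega>)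
    = (\<integral>x. u x * laplace \<psi> x \<partial>lebesgue_on \<Omega>)"
proof -
  have O: "\<Omega> \<in> sets lebesgue" using \<Omega> by simp
  note U = H10_approxD[OF \<Omega> u] and P = test_functionD[OF \<psi>]
  have sq: "sq_integrable (lebesgue_on \<Omega>) (partial i \<psi>)" "sq_integrable (lebesgue_on \<Omega>) (partial i (partial i \<psi>))" for i
    using P O by (auto intro: Cc_sq_integrable)
  have sl: "sq_integrable (lebesgue_on \<Omega>) (laplace \<psi>)"
    using sq_integrable_diff[OF sq_integrable_cmult[OF sq(2)[of 1], of "-1"] sq(2)[of 2]] by (simp add: laplace_def[abs_def])
  have ibp: "(\<integral>x. partial i (\<phi> n) x * partial i \<psi> x \<partial>lebesgue_on \<Omega>) = - (\<integral>x. \<phi> n x * partial i (partial i \<psi>) x \<partial>lebesgue_on \<Omega>)" for i n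
  proof -
    note Q = test_functionD[OF U(3)[of n]]
    have c: "continuous_on UNIV (partial i \<psi>)" "continuous_on UNIV (partial i (partial i \<psi>))" using P(2,3) by (auto simp: Cc_def)
    have "(\<integral>x. partial i (\<phi> n) x * partial i \<psi> x \<partial>lebesgue_on \<Omega>) = (\<integral>x. partial i (\<phi> n) x * partial i \<psi> x \<partial>lborel)"
      by (rule Cc_lebesgue_on(3)[OF Cc_mult[OF Q(2) c(1)] O]) (simp add: Q)
    also have "\<dots> = - (\<integral>x. \<phi> n x * partial i (partial i \<psi>) x \<partial>lborel)"
      by (rule integral_by_parts_along[OF Q(4,1,2) P(5) c]) (simp add: norm_axis_1)
    also have "(\<integral>x. \<phi> n x * partial i (partial i \<psi>) x \<partial>lborel) = (\<integral>x. \<phi> n x * partial i (partial i \<psi>) x \<partial>lebesgue_on \<Omega>)"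
      by (rule Cc_lebesgue_on(3)[OF Cc_mult[OF Q(1) c(2)] O, symmetric]) (simp add: Q)
    finally show ?thesis .
  qed
  have eq: "(\<integral>x. \<phi> n x * laplace \<psi> x \<partial>lebesgue_on \<Omega>) = (\<integral>x. partial 1 (\<phi> n) x * partial 1 \<psi> x \<partial>lebesgue_on \<Omega>)
     + (\<integral>x. partial 2 (\<phi> n) x * partial 2 \<psi> x \<partial>lebesgue_on \<Omega>)" for n
  proof -
    have "(\<integral>x. \<phi> n x * laplace \<psi> x \<partial>lebesgue_on \<Omega>) = (\<integral>x. - (\<phi> n x * partial 1 (partial 1 \<psi>) x) - \<phi> n x * partial 2 (partial 2 \<psi>) x \<partial>lebesgue_on \<Omega>)"
      by (intro Bochner_Integration.integral_cong) (auto simp: laplace_def algebra_simps)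
    also have "\<dots> = - (\<integral>x. \<phi> n x * partial 1 (partial 1 \<psi>) x \<partial>lebesgue_on \<Omega>) - (\<integral>x. \<phi> n x * partial 2 (partial 2 \<psi>) x \<partial>lebesgue_on \<Omega>)"
      using sq_integrable_mult[OF U(4) sq(2)] by simp
    finally show ?thesis by (simp add: ibp)
  qed
  have 1: "(\<lambda>n. \<integral>x. \<phi> n x * laplace \<psi> x \<partial>lebesgue_on \<Omega>) \<longlonglongrightarrow> (\<integral>x. u x * laplace \<psi> x \<partial>lebesgue_on \<Omega>)"
    by (rule sq_integrable_tendsto_mult[OF U(4) sl U(1) sl U(6) L2_const_tendsto])
  have 2: "(\<lambda>n. \<integral>x. partial i (\<phi> n) x * partial i \<psi> x \<partial>lebesgue_on \<Omega>) \<longlonglongrightarrow> (\<integral>x. g i x * partial i \<psi> x \<partial>lebesgue_on \<Omega>)" for i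
    by (rule sq_integrable_tendsto_mult[OF U(5) sq(1) U(2) sq(1) U(7) L2_const_tendsto])
  show ?thesis by (rule LIMSEQ_unique[OF tendsto_add[OF 2 2] 1[unfolded eq]])
qed

text \<open>The eigenvalue equation speaks of test functions only; the approximants of
  \<open>v\<close> carry it to \<open>v\<close>. The result is the weak form in which the energy of
  two functions appears symmetrically.\<close>

lemma eigenspace_green:
  assumes \<Omega>: "open \<Omega>" and e: "u \<in> dirichlet_eigenspace \<Omega> \<mu>"
    and u: "H10_approx \<Omega> u g \<phi>" and v: "H10_approx \<Omega> v h \<psi>"
  shows "(\<integral>x. g 1 x * h 1 x \<partial>lebesgue_on \<Omega>) + (\<integral>x. g 2 x * h 2 x \<partial>lebesgue_on \<Omega>)
    = \<mu> * (\<integral>x. u x * v x \<partial>lebesgue_on \<Omega>)"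
proof -
  note U = H10_approxD[OF \<Omega> u] and V = H10_approxD[OF \<Omega> v]
  have eq: "(\<integral>x. g 1 x * partial 1 (\<psi> n) x \<partial>lebesgue_on \<Omega>) + (\<integral>x. g 2 x * partial 2 (\<psi> n) x \<partial>lebesgue_on \<Omega>)
    = \<mu> * (\<integral>x. u x * \<psi> n x \<partial>lebesgue_on \<Omega>)" for n
    using e V(3)[of n] H10_green[OF \<Omega> u V(3)] by (simp add: dirichlet_eigenspace_def)
  have 1: "(\<lambda>n. \<integral>x. g i x * partial i (\<psi> n) x \<partial>lebesgue_on \<Omega>) \<longlonglongrightarrow> (\<integral>x. g i x * h i x \<partial>lebesgue_on \<Omega>)" for i
    by (rule sq_integrable_tendsto_mult[OF U(2) V(5) U(2) V(2) L2_const_tendsto V(7)])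
  have 2: "(\<lambda>n. \<integral>x. u x * \<psi> n x \<partial>lebesgue_on \<Omega>) \<longlonglongrightarrow> (\<integral>x. u x * v x \<partial>lebesgue_on \<Omega>)"
    by (rule sq_integrable_tendsto_mult[OF U(1) V(4) U(1) V(1) L2_const_tendsto V(6)])
  from tendsto_add[OF 1[of 1] 1[of 2]] tendsto_mult_left[OF 2, of \<mu>] show ?thesis
    unfolding eq by (rule LIMSEQ_unique)
qed

context disjoint_copies begin

lemma finite_modes_below: "finite {p \<in> modes. freq p \<le> \<mu>}"
proof (rule finite_subset)
  show "{p \<in> modes. freq p \<le> \<mu>} \<subseteq> {..nat \<lceil>\<mu> * (M / pi)\<^sup>2\<rceil>} \<times> {..nat \<lceil>\<mu> * (M / pi)\<^sup>2\<rceil>}"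
  proof
    fix p assume p: "p \<in> {p \<in> modes. freq p \<le> \<mu>}"
    have "(real (fst p))\<^sup>2 + (real (snd p))\<^sup>2 = freq p * (M / pi)\<^sup>2"
      using M by (simp add: freq_def power_divide)
    also have "\<dots> \<le> \<mu> * (M / pi)\<^sup>2" using p by (intro mult_right_mono) auto
    finally have s: "(real (fst p))\<^sup>2 + (real (snd p))\<^sup>2 \<le> \<mu> * (M / pi)\<^sup>2" .
    have sq: "real n \<le> (real n)\<^sup>2" for n
      by (cases n) (auto simp: power2_eq_square)
    have "real (fst p) \<le> \<mu> * (M / pi)\<^sup>2" "real (snd p) \<le> \<mu> * (M / pi)\<^sup>2"
      using s sq[of "fst p"] sq[of "snd p"] zero_le_power2[of "real (fst p)"] zero_le_power2[of "real (snd p)"] by linarith+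
    then show "p \<in> {..nat \<lceil>\<mu> * (M / pi)\<^sup>2\<rceil>} \<times> {..nat \<lceil>\<mu> * (M / pi)\<^sup>2\<rceil>}"
      by (cases p) (auto simp: le_nat_iff le_ceiling_iff intro: order_trans) 
  qed
qed auto

text \<open>Only finitely many frequencies lie below \<open>\<mu> + 1\<close>, so those above
  \<open>\<mu>\<close> stay away from it. The strict gap later turns a weak Rayleigh bound into a
  contradiction.\<close>

lemma spectral_gap:
  "\<exists>\<rho>. \<rho> > \<mu> \<and> \<rho> \<ge> 0 \<and> (\<forall>p \<in> modes - {p \<in> modes. freq p \<le> \<mu>}. \<rho> \<le> freq p)"
proof (cases "\<mu> < 0")
  case True
  then show ?thesis by (intro exI[of _ 0]) (auto simp: freq_def)
next
  case False
  define S where "S = freq ` {p \<in> modes. freq p \<le> \<mu> + 1} \<inter> {\<mu><..}"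
  have S: "finite S" unfolding S_def using finite_modes_below by blast
  define \<rho> where "\<rho> = Min (insert (\<mu> + 1) S)"
  have "\<rho> \<in> insert (\<mu> + 1) S" unfolding \<rho>_def using S by (intro Min_in) auto
  then have \<rho>: "\<rho> > \<mu>" by (auto simp: S_def)
  show ?thesis
  proof (intro exI[of _ \<rho>] conjI ballI)
    show "\<rho> > \<mu>" by (rule \<rho>)
    show "\<rho> \<ge> 0" using \<rho> False by simp
    fix p assume p: "p \<in> modes - {p \<in> modes. freq p \<le> \<mu>}"
    show "\<rho> \<le> freq p"
    proof (cases "freq p \<le> \<mu> + 1")
      case True
      then have "freq p \<in> S" using p by (auto simp: S_def)
      then show ?thesis unfolding \<rho>_def using S by (intro Min_le) auto
    next
      case False
      have "\<rho> \<le> \<mu> + 1" unfolding \<rho>_def using S by (intro Min_le) auto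
      then show ?thesis using False by simp
    qed
  qed
qed

text \<open>The variational principle on the square: the copies of the given functions span a space on which the
  Rayleigh quotient is at most \<open>\<mu>\<close>, so it cannot contain a function orthogonal to all modes up to \<open>\<mu>\<close>.\<close>

lemma mode_count_lower_bound:
  fixes I :: "'i set" and b :: "'i \<Rightarrow> real^2 \<Rightarrow> real" and g :: "'i \<Rightarrow> 2 \<Rightarrow> real^2 \<Rightarrow> real" and \<phi> :: "'i \<Rightarrow> nat \<Rightarrow> real^2 \<Rightarrow> real"
  assumes I: "finite I" and b: "\<And>j. j \<in> I \<Longrightarrow> H10_approx \<Omega> (b j) (g j) (\<phi> j)"
    and ray: "\<And>c :: 'i \<Rightarrow> real. (\<Sum>j\<in>I. \<Sum>l\<in>I. c j * c l * ((\<integral>x. g j 1 x * g l 1 x \<partial>lebesgue_on \<Omega>) + (\<integral>x. g j 2 x * g l 2 x \<partial>lebesgue_on \<Omega>)))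
      \<le> \<mu> * (\<Sum>j\<in>I. \<Sum>l\<in>I. c j * c l * (\<integral>x. b j x * b l x \<partial>lebesgue_on \<Omega>))"
    and ind: "\<And>c :: 'i \<Rightarrow> real. (\<integral>x. (\<Sum>j\<in>I. c j * b j x)\<^sup>2 \<partial>lebesgue_on \<Omega>) = 0 \<Longrightarrow> \<forall>j\<in>I. c j = 0"
  shows "card J * card I \<le> card {p \<in> modes. freq p \<le> \<mu>}"
proof (rule ccontr)
  define N where "N = lebesgue_on \<Omega>"
  define F0 where "F0 = {p \<in> modes. freq p \<le> \<mu>}"
  assume "\<not> ?thesis"
  then have lt: "card F0 < card (J \<times> I)" by (simp add: F0_def card_cartesian_product)
  have F0: "finite F0" "F0 \<subseteq> modes" using finite_modes_below by (auto simp: F0_def)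
  have fin: "finite (J \<times> I)" using J I by simp
  define E where "E = (\<lambda>p m x. 2 / M * sin_sin M p (place m x))"
  \<comment> \<open>There is one equation for each low mode and one unknown for each copy and each
    function, so a nontrivial combination is orthogonal to all low modes.\<close>
  obtain c where c: "\<exists>i\<in>J \<times> I. c i \<noteq> 0"
    "\<forall>p\<in>F0. (\<Sum>i\<in>J \<times> I. (\<integral>x. b (snd i) x * E p (fst i) x \<partial>N) * c i) = 0"
    using homogeneous_system[OF F0(1) fin lt, of "\<lambda>p i. \<integral>x. b (snd i) x * E p (fst i) x \<partial>N"]
    by (elim exE conjE) (rule that)
  obtain \<rho> where \<rho>: "\<rho> > \<mu>" "\<rho> \<ge> 0" "\<forall>p\<in>modes - F0. \<rho> \<le> freq p"
    using spectral_gap[of \<mu>, folded F0_def] by (elim exE conjE) (rule that)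
  note B = H10_approxD[OF \<Omega> b, folded N_def]
  \<comment> \<open>What is glued are the test functions approximating the combination. Their low
    coefficients vanish only in the limit, hence the limits \<open>QA\<close>, \<open>QD\<close> and
    \<open>CO\<close>.\<close>
  define f where "f = (\<lambda>n m x. \<Sum>j\<in>I. c (m, j) * \<phi> j n x)"
  define f' where "f' = (\<lambda>n m i x. \<Sum>j\<in>I. c (m, j) * partial i (\<phi> j n) x)"
  have C1: "compact_C1 \<Omega> (f n m) (f' n m)" for n m
    unfolding f_def f'_def by (intro compact_C1_sum I test_function_compact_C1 B(3))
  have sE: "sq_integrable N (E p m)" for p m
  proof -
    have "continuous_on UNIV (E p m)" unfolding E_def
      using continuous_on_compose2[OF sin_sin_continuous(1)[of UNIV] continuous_place(1)[of UNIV m]]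
      by (intro continuous_intros) auto
    moreover have "bounded \<Omega>"
    proof -
      obtain m where m: "m \<in> J" using c(1) by auto
      have "bounded (unplace m ` square M)"
        by (intro compact_imp_bounded compact_continuous_image continuous_place) (simp add: square_def)
      moreover have "\<Omega> \<subseteq> unplace m ` square M"
      proof
        fix x assume "x \<in> \<Omega>"
        then have "place m x \<in> square M" using inside[OF m] interior_subset by (auto simp: place_def)
        then show "x \<in> unplace m ` square M" using unplace_place(1)[OF m, of x] by (metis image_eqI)
      qed
      ultimately show ?thesis using bounded_subset by blast
    qed
    ultimately show ?thesis unfolding N_def using \<Omega> by (intro continuous_sq_integrable_bounded) auto
  qed
  have QA: "(\<lambda>n. \<integral>x. (f n m x)\<^sup>2 \<partial>N) \<longlonglongrightarrow> (\<Sum>j\<in>I. \<Sum>l\<in>I. c (m, j) * c (m, l) * (\<integral>x. b j x * b l x \<partial>N))" for m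
  proof -
    have "(\<integral>x. (f n m x)\<^sup>2 \<partial>N) = (\<Sum>j\<in>I. \<Sum>l\<in>I. c (m, j) * c (m, l) * (\<integral>x. \<phi> j n x * \<phi> l n x \<partial>N))" for n
      unfolding f_def by (rule integral_square_sum) (rule B(4))
    then show ?thesis
      by (auto intro!: tendsto_sum tendsto_mult_left sq_integrable_tendsto_mult B)
  qed
  have QD: "(\<lambda>n. \<integral>x. (f' n m i x)\<^sup>2 \<partial>N) \<longlonglongrightarrow> (\<Sum>j\<in>I. \<Sum>l\<in>I. c (m, j) * c (m, l) * (\<integral>x. g j i x * g l i x \<partial>N))" for m i
  proof -
    have "(\<integral>x. (f' n m i x)\<^sup>2 \<partial>N) = (\<Sum>j\<in>I. \<Sum>l\<in>I. c (m, j) * c (m, l) * (\<integral>x. partial i (\<phi> j n) x * partial i (\<phi> l n) x \<partial>N))" for n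
      unfolding f'_def by (rule integral_square_sum) (rule B(5))
    then show ?thesis
      by (auto intro!: tendsto_sum tendsto_mult_left sq_integrable_tendsto_mult B)
  qed
  have CO: "(\<lambda>n. coeff (f n) p) \<longlonglongrightarrow> 0" if p: "p \<in> F0" for p
  proof -
    have "coeff (f n) p = (\<Sum>m\<in>J. \<Sum>j\<in>I. (\<integral>x. \<phi> j n x * E p m x \<partial>N) * c (m, j))" for n
    proof -
      have "(\<integral>x. f n m x * E p m x \<partial>N) = (\<Sum>j\<in>I. (\<integral>x. \<phi> j n x * E p m x \<partial>N) * c (m, j))" for m
      proof -
        have "(\<integral>x. f n m x * E p m x \<partial>N) = (\<integral>x. (\<Sum>j\<in>I. (\<phi> j n x * E p m x) * c (m, j)) \<partial>N)"
          by (intro Bochner_Integration.integral_cong) (auto simp: f_def sum_distrib_right sum_distrib_left algebra_simps)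
        also have "\<dots> = (\<Sum>j\<in>I. (\<integral>x. \<phi> j n x * E p m x \<partial>N) * c (m, j))"
          using sq_integrable_mult[OF B(4) sE] by (subst Bochner_Integration.integral_sum) auto
        finally show ?thesis .
      qed
      then show ?thesis by (simp add: coeff_def E_def N_def)
    qed
    moreover have "(\<lambda>n. \<Sum>m\<in>J. \<Sum>j\<in>I. (\<integral>x. \<phi> j n x * E p m x \<partial>N) * c (m, j))
       \<longlonglongrightarrow> (\<Sum>m\<in>J. \<Sum>j\<in>I. (\<integral>x. b j x * E p m x \<partial>N) * c (m, j))"
      by (intro tendsto_sum tendsto_mult_right sq_integrable_tendsto_mult[OF B(4) sE B(1) sE B(6) L2_const_tendsto])
    moreover have "(\<Sum>m\<in>J. \<Sum>j\<in>I. (\<integral>x. b j x * E p m x \<partial>N) * c (m, j)) = 0"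
      using c(2)[rule_format, OF p] by (simp add: sum.cartesian_product case_prod_beta)
    ultimately show ?thesis by simp
  qed
  define Q where "Q = (\<lambda>m. \<Sum>j\<in>I. \<Sum>l\<in>I. c (m, j) * c (m, l) * (\<integral>x. b j x * b l x \<partial>N))"
  define D where "D = (\<lambda>m i. \<Sum>j\<in>I. \<Sum>l\<in>I. c (m, j) * c (m, l) * (\<integral>x. g j i x * g l i x \<partial>N))"
  have "\<rho> * ((\<Sum>m\<in>J. Q m) - (\<Sum>p\<in>F0. 0\<^sup>2)) \<le> (\<Sum>m\<in>J. D m 1 + D m 2)"
  proof (rule LIMSEQ_le)
    show "(\<lambda>n. \<rho> * ((\<Sum>m\<in>J. \<integral>x. (f n m x)\<^sup>2 \<partial>N) - (\<Sum>p\<in>F0. (coeff (f n) p)\<^sup>2))) \<longlonglongrightarrow> \<rho> * ((\<Sum>m\<in>J. Q m) - (\<Sum>p\<in>F0. 0\<^sup>2))"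
      unfolding Q_def by (intro tendsto_mult_left tendsto_diff tendsto_sum tendsto_power QA CO)
    show "(\<lambda>n. \<Sum>m\<in>J. (\<integral>x. (f' n m 1 x)\<^sup>2 \<partial>N) + (\<integral>x. (f' n m 2 x)\<^sup>2 \<partial>N)) \<longlonglongrightarrow> (\<Sum>m\<in>J. D m 1 + D m 2)"
      unfolding D_def by (intro tendsto_sum tendsto_add QD)
    show "\<exists>N0. \<forall>n\<ge>N0. \<rho> * ((\<Sum>m\<in>J. \<integral>x. (f n m x)\<^sup>2 \<partial>N) - (\<Sum>p\<in>F0. (coeff (f n) p)\<^sup>2))
      \<le> (\<Sum>m\<in>J. (\<integral>x. (f' n m 1 x)\<^sup>2 \<partial>N) + (\<integral>x. (f' n m 2 x)\<^sup>2 \<partial>N))"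
      unfolding N_def using spectral_gap_inequality[OF C1 F0 \<rho>(2) \<rho>(3)[rule_format]] by (intro exI[of _ 0] allI impI)
  qed
  also have "\<dots> \<le> (\<Sum>m\<in>J. \<mu> * Q m)"
  proof (rule sum_mono)
    fix m
    show "D m 1 + D m 2 \<le> \<mu> * Q m"
      using ray[of "\<lambda>j. c (m, j)"] unfolding D_def Q_def N_def by (simp add: distrib_left sum.distrib)
  qed
  \<comment> \<open>Since \<open>\<rho> > \<mu>\<close>, all squared norms \<open>Q m\<close> must
    vanish.\<close>
  finally have "(\<rho> - \<mu>) * (\<Sum>m\<in>J. Q m) \<le> 0" by (simp add: sum_distrib_left[symmetric] algebra_simps)
  then have "(\<Sum>m\<in>J. Q m) \<le> 0" using \<rho>(1) by (simp add: mult_le_0_iff)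
  have Qeq: "Q m = (\<integral>x. (\<Sum>j\<in>I. c (m, j) * b j x)\<^sup>2 \<partial>N)" for m
    unfolding Q_def by (rule integral_square_sum[symmetric]) (rule B(1))
  have Q0: "Q m \<ge> 0" for m unfolding Qeq by simp
  have "Q m = 0" if "m \<in> J" for m
    using \<open>(\<Sum>m\<in>J. Q m) \<le> 0\<close> sum_nonneg_0[OF J, of Q m] Q0 that sum_nonneg[of J Q] by fastforce
  then have "c (m, j) = 0" if "m \<in> J" "j \<in> I" for m j
    using ind[of "\<lambda>j. c (m, j)"] that unfolding Qeq N_def by blast
  then show False using c(1) by auto
qed

end

section \<open>Counting eigenvalues\<close>

text \<open>The index \<open>j\<close> receives the basis vector of its eigenspace whose number is
  the rank \<open>r j\<close> of \<open>j\<close> among the indices with the same eigenvalue. There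
  are as many such indices as basis vectors. Independence is stated within one eigenspace; across
  eigenspaces it will come from orthogonality.\<close>

lemma eigenfunction_family:
  assumes \<Omega>: "open \<Omega>" and ev: "dirichlet_eigenvalues \<Omega> \<Lambda>"
  shows "\<exists>b. (\<forall>j\<in>{1..k}. b j \<in> dirichlet_eigenspace \<Omega> (\<Lambda> j)) \<and>
    (\<forall>\<nu> c :: nat \<Rightarrow> real. (AE x in lebesgue_on \<Omega>. (\<Sum>j\<in>{j\<in>{1..k}. \<Lambda> j = \<nu>}. c j * b j x) = 0) \<longrightarrow>
       (\<forall>j\<in>{j\<in>{1..k}. \<Lambda> j = \<nu>}. c j = 0))"
proof -
  define d where "d = (\<lambda>\<nu>. card {j. 1 \<le> j \<and> \<Lambda> j = \<nu>})"
  have fin: "finite {j. 1 \<le> j \<and> \<Lambda> j = \<nu>}" for \<nu> using ev by (simp add: dirichlet_eigenvalues_def)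
  have "\<forall>\<nu>. \<exists>b. (\<forall>i<d \<nu>. b i \<in> dirichlet_eigenspace \<Omega> \<nu>) \<and>
    (\<forall>c :: nat \<Rightarrow> real. (AE x in lebesgue_on \<Omega>. (\<Sum>i<d \<nu>. c i * b i x) = 0) \<longrightarrow> (\<forall>i<d \<nu>. c i = 0))"
    using ev unfolding dirichlet_eigenvalues_def has_ae_dim_def d_def by blast
  from choice[OF this] obtain bs where bs: "\<And>\<nu> i. i < d \<nu> \<Longrightarrow> bs \<nu> i \<in> dirichlet_eigenspace \<Omega> \<nu>"
    "\<And>\<nu> (c :: nat \<Rightarrow> real) i. (AE x in lebesgue_on \<Omega>. (\<Sum>i<d \<nu>. c i * bs \<nu> i x) = 0) \<Longrightarrow> i < d \<nu> \<Longrightarrow> c i = 0"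
    by blast
  define r where "r = (\<lambda>j. card {i. 1 \<le> i \<and> i < j \<and> \<Lambda> i = \<Lambda> j})"
  have r: "r j < d (\<Lambda> j)" if "j \<in> {1..k}" for j
    unfolding r_def d_def using that by (intro psubset_card_mono fin) auto
  have inj: "r j < r l" if "1 \<le> j" "j < l" "\<Lambda> j = \<Lambda> l" for j l
    unfolding r_def using that by (intro psubset_card_mono finite_subset[OF _ fin[of "\<Lambda> l"]]) auto
  define b where "b = (\<lambda>j. bs (\<Lambda> j) (r j))"
  have "c j0 = 0" if ae: "AE x in lebesgue_on \<Omega>. (\<Sum>j\<in>{j\<in>{1..k}. \<Lambda> j = \<nu>}. c j * b j x) = 0"
    and j0: "j0 \<in> {j\<in>{1..k}. \<Lambda> j = \<nu>}" for \<nu> and c :: "nat \<Rightarrow> real" and j0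
  proof -
    define G where "G = {j\<in>{1..k}. \<Lambda> j = \<nu>}"
    have G: "finite G" by (simp add: G_def)
    have rG: "inj_on r G"
    proof (rule inj_onI)
      fix j l assume "j \<in> G" "l \<in> G" "r j = r l"
      then show "j = l" using inj[of j l] inj[of l j] by (cases j l rule: linorder_cases) (auto simp: G_def)
    qed
    define C where "C = (\<lambda>i. \<Sum>j\<in>G. if r j = i then c j else 0)"
    have "(\<Sum>i<d \<nu>. C i * bs \<nu> i x) = (\<Sum>j\<in>G. c j * b j x)" for x
    proof -
      have "(\<Sum>i<d \<nu>. C i * bs \<nu> i x) = (\<Sum>i<d \<nu>. \<Sum>j\<in>G. if r j = i then c j * bs \<nu> i x else 0)"
        unfolding C_def sum_distrib_right by (intro sum.cong) auto
      also have "\<dots> = (\<Sum>j\<in>G. \<Sum>i<d \<nu>. if r j = i then c j * bs \<nu> i x else 0)" by (rule sum.swap)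
      also have "\<dots> = (\<Sum>j\<in>G. c j * b j x)"
        using r by (intro sum.cong) (auto simp: G_def b_def)
      finally show ?thesis .
    qed
    then have "AE x in lebesgue_on \<Omega>. (\<Sum>i<d \<nu>. C i * bs \<nu> i x) = 0" using ae by (simp add: G_def)
    then have "C (r j0) = 0" using bs(2)[of C \<nu> "r j0"] r[of j0] j0 by auto
    moreover have "C (r j0) = (\<Sum>j\<in>G. if j = j0 then c j else 0)"
      unfolding C_def using rG j0 by (intro sum.cong) (auto simp: inj_on_def G_def)
    ultimately show "c j0 = 0" using G j0 by (simp add: G_def)
  qed
  moreover have "b j \<in> dirichlet_eigenspace \<Omega> (\<Lambda> j)" if "j \<in> {1..k}" for j
    unfolding b_def by (rule bs(1)[OF r[OF that]])
  ultimately show ?thesis by (intro exI[of _ b]) blast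
qed

context disjoint_copies begin

text \<open>Both the Gram matrix \<open>A\<close> and the energy matrix \<open>D\<close> split into
  blocks belonging to equal eigenvalues, and within a block \<open>D\<close> is the eigenvalue times
  \<open>A\<close>. No eigenvalue involved exceeds \<open>\<Lambda> k\<close>.\<close>

lemma eigenvalue_count:
  assumes ev: "dirichlet_eigenvalues \<Omega> \<Lambda>"
  shows "card J * k \<le> card {p \<in> modes. freq p \<le> \<Lambda> k}"
proof -
  define N where "N = lebesgue_on \<Omega>"
  obtain b where b: "\<forall>j\<in>{1..k}. b j \<in> dirichlet_eigenspace \<Omega> (\<Lambda> j)"
    and li: "\<forall>\<nu> c :: nat \<Rightarrow> real. (AE x in N. (\<Sum>j\<in>{j\<in>{1..k}. \<Lambda> j = \<nu>}. c j * b j x) = 0) \<longrightarrow>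
       (\<forall>j\<in>{j\<in>{1..k}. \<Lambda> j = \<nu>}. c j = 0)"
    using eigenfunction_family[OF \<Omega> ev, of k, folded N_def] by (elim exE conjE) (rule that)
  have "\<forall>j. \<exists>p. j \<in> {1..k} \<longrightarrow> H10_approx \<Omega> (b j) (fst p) (snd p)"
    using b H10_approx_exists by (force simp: dirichlet_eigenspace_def)
  from choice[OF this] obtain P where P: "\<And>j. j \<in> {1..k} \<Longrightarrow> H10_approx \<Omega> (b j) (fst (P j)) (snd (P j))" by blast
  define g where "g = (\<lambda>j. fst (P j))"
  define A where "A = (\<lambda>j l. \<integral>x. b j x * b l x \<partial>N)"
  define D where "D = (\<lambda>j l. (\<integral>x. g j 1 x * g l 1 x \<partial>N) + (\<integral>x. g j 2 x * g l 2 x \<partial>N))"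
  have sym: "A j l = A l j" "D j l = D l j" for j l by (simp_all add: A_def D_def mult.commute)
  have DA: "D j l = \<Lambda> j * A j l" if "j \<in> {1..k}" "l \<in> {1..k}" for j l
    unfolding D_def A_def N_def g_def using b that by (intro eigenspace_green[OF \<Omega> _ P P]) auto
  \<comment> \<open>The symmetric form \<open>D\<close> equals both
    \<open>\<Lambda> j * A j l\<close> and \<open>\<Lambda> l * A j l\<close>.\<close>
  have orth: "A j l = 0" if "j \<in> {1..k}" "l \<in> {1..k}" "\<Lambda> j \<noteq> \<Lambda> l" for j l
    using DA[OF that(1,2)] DA[OF that(2,1)] sym[of j l] that(3) by auto
  have mono: "\<Lambda> j \<le> \<Lambda> k" if "j \<in> {1..k}" for j
    using ev that unfolding dirichlet_eigenvalues_def by (auto intro: mono_onD)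
  have sq: "sq_integrable N (b j)" if "j \<in> {1..k}" for j unfolding N_def by (rule H10_approxD(1)[OF \<Omega> P[OF that]])
  have quad: "(\<integral>x. (\<Sum>j\<in>{1..k}. c j * b j x)\<^sup>2 \<partial>N) = (\<Sum>j\<in>{1..k}. \<Sum>l\<in>{1..k}. c j * c l * A j l)" for c
    unfolding A_def by (rule integral_square_sum[OF sq])
  have "card J * card {1..k} \<le> card {p \<in> modes. freq p \<le> \<Lambda> k}"
  proof (rule mode_count_lower_bound)
    fix c :: "nat \<Rightarrow> real"
    \<comment> \<open>\<open>A\<close> vanishes unless the two eigenvalues agree, so this rescaling turns \<open>\<Lambda> k A - D\<close> into the form \<open>A\<close>.\<close>
    define c' where "c' = (\<lambda>j. sqrt (\<Lambda> k - \<Lambda> j) * c j)"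
    have "0 \<le> (\<integral>x. (\<Sum>j\<in>{1..k}. c' j * b j x)\<^sup>2 \<partial>N)" by simp
    also have "\<dots> = (\<Sum>j\<in>{1..k}. \<Sum>l\<in>{1..k}. \<Lambda> k * (c j * c l * A j l) - c j * c l * D j l)"
      unfolding quad
    proof (intro sum.cong refl)
      fix j l assume jl: "j \<in> {1..k}" "l \<in> {1..k}"
      show "c' j * c' l * A j l = \<Lambda> k * (c j * c l * A j l) - c j * c l * D j l"
      proof (cases "\<Lambda> j = \<Lambda> l")
        case True
        have "sqrt (\<Lambda> k - \<Lambda> j) * sqrt (\<Lambda> k - \<Lambda> j) = \<Lambda> k - \<Lambda> j" using mono[OF jl(1)] by simp
        then have "c' j * c' l = (\<Lambda> k - \<Lambda> j) * (c j * c l)"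
          unfolding c'_def True[symmetric] by (metis mult.assoc mult.left_commute)
        then have "c' j * c' l * A j l = (\<Lambda> k - \<Lambda> j) * (c j * c l) * A j l" by (simp only:)
        then show ?thesis by (simp only: DA[OF jl]) (simp add: algebra_simps)
      qed (simp add: orth[OF jl] DA[OF jl])
    qed
    also have "\<dots> = \<Lambda> k * (\<Sum>j\<in>{1..k}. \<Sum>l\<in>{1..k}. c j * c l * A j l) - (\<Sum>j\<in>{1..k}. \<Sum>l\<in>{1..k}. c j * c l * D j l)"
      by (simp add: sum_subtractf sum_distrib_left)
    finally show "(\<Sum>j\<in>{1..k}. \<Sum>l\<in>{1..k}. c j * c l * ((\<integral>x. g j 1 x * g l 1 x \<partial>lebesgue_on \<Omega>) + (\<integral>x. g j 2 x * g l 2 x \<partial>lebesgue_on \<Omega>)))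
      \<le> \<Lambda> k * (\<Sum>j\<in>{1..k}. \<Sum>l\<in>{1..k}. c j * c l * (\<integral>x. b j x * b l x \<partial>lebesgue_on \<Omega>))"
      unfolding D_def A_def N_def by linarith
  next
    fix c :: "nat \<Rightarrow> real"
    define S where "S = (\<lambda>x. \<Sum>j\<in>{1..k}. c j * b j x)"
    assume "(\<integral>x. (\<Sum>j\<in>{1..k}. c j * b j x)\<^sup>2 \<partial>lebesgue_on \<Omega>) = 0"
    then have S0: "(\<integral>x. (S x)\<^sup>2 \<partial>N) = 0" by (simp add: S_def N_def)
    have S: "sq_integrable N S" unfolding S_def by (intro sq_integrable_sum sq_integrable_cmult sq)
    have Sb: "(\<Sum>j\<in>{1..k}. c j * A j l) = 0" if l: "l \<in> {1..k}" for l
    proof -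
      have "(\<integral>x. S x * b l x \<partial>N) = (\<integral>x. (\<Sum>j\<in>{1..k}. c j * (b j x * b l x)) \<partial>N)"
        by (simp add: S_def sum_distrib_right mult.assoc)
      also have "\<dots> = (\<Sum>j\<in>{1..k}. c j * A j l)"
        using sq_integrable_mult[OF sq sq[OF l]] by (subst Bochner_Integration.integral_sum) (auto simp: A_def)
      finally show ?thesis using sq_integrable_Cauchy_Schwarz[OF S sq[OF l]] S0 by simp
    qed
    show "\<forall>j\<in>{1..k}. c j = 0"
    proof
      fix j0 assume j0: "j0 \<in> {1..k}"
      \<comment> \<open>The part of the combination in the eigenspace of
        \<open>\<Lambda> j0\<close>. By orthogonality to the other blocks it has norm 0 as well, and
        independence within the eigenspace applies to it.\<close>
      define c' where "c' = (\<lambda>j. if \<Lambda> j = \<Lambda> j0 then c j else 0)"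
      have "(\<Sum>j\<in>{1..k}. c' j * c' l * A j l) = 0" if l: "l \<in> {1..k}" for l
      proof (cases "\<Lambda> l = \<Lambda> j0")
        case True
        have "(\<Sum>j\<in>{1..k}. c' j * c' l * A j l) = (\<Sum>j\<in>{1..k}. c l * (c j * A j l))"
          using orth[OF _ l] True by (intro sum.cong) (auto simp: c'_def)
        also have "\<dots> = c l * (\<Sum>j\<in>{1..k}. c j * A j l)" by (rule sum_distrib_left[symmetric])
        finally show ?thesis using Sb[OF l] by simp
      qed (simp add: c'_def)
      then have "(\<Sum>l\<in>{1..k}. \<Sum>j\<in>{1..k}. c' j * c' l * A j l) = 0" by simp
      then have "(\<integral>x. (\<Sum>j\<in>{1..k}. c' j * b j x)\<^sup>2 \<partial>N) = 0"
        unfolding quad by (subst sum.swap)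
      moreover have "sq_integrable N (\<lambda>x. \<Sum>j\<in>{1..k}. c' j * b j x)" by (intro sq_integrable_sum sq_integrable_cmult sq)
      ultimately have "AE x in N. (\<Sum>j\<in>{1..k}. c' j * b j x)\<^sup>2 = 0"
        by (subst (asm) integral_nonneg_eq_0_iff_AE) (auto simp: sq_integrable_def)
      moreover have "(\<Sum>j\<in>{1..k}. c' j * b j x) = (\<Sum>j\<in>{j\<in>{1..k}. \<Lambda> j = \<Lambda> j0}. c j * b j x)" for x
        by (rule sum.mono_neutral_cong_right) (auto simp: c'_def)
      ultimately have "AE x in N. (\<Sum>j\<in>{j\<in>{1..k}. \<Lambda> j = \<Lambda> j0}. c j * b j x) = 0" by simp
      then show "c j0 = 0" using li j0 by blast
    qed
  qed (use P in \<open>auto simp: g_def\<close>)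
  then show ?thesis by simp
qed

text \<open>Each mode owns four unit squares, one per quadrant, inside the disc of radius \<open>M \<surd>\<mu> / \<pi>\<close>.\<close>

lemma mode_count_upper_bound:
  "4 * pi * real (card {p \<in> modes. freq p \<le> \<mu>}) \<le> max \<mu> 0 * M\<^sup>2"
proof (cases "\<mu> < 0")
  case True
  have "freq p \<ge> 0" for p by (simp add: freq_def)
  then have e: "{p \<in> modes. freq p \<le> \<mu>} = {}" using True by (auto simp: not_le intro: less_le_trans)
  show ?thesis unfolding e by simp
next
  case False
  define F where "F = {p \<in> modes. freq p \<le> \<mu>}"
  have F: "finite F" unfolding F_def by (rule finite_modes_below)
  define R where "R = sqrt \<mu> * (M / pi)"
  have R: "R \<ge> 0" "R\<^sup>2 = \<mu> * (M / pi)\<^sup>2"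
  proof -
    show "R \<ge> 0" using False M by (simp add: R_def)
    have "(sqrt \<mu>)\<^sup>2 = \<mu>" using False by simp
    then show "R\<^sup>2 = \<mu> * (M / pi)\<^sup>2" by (simp only: R_def power_mult_distrib)
  qed
  \<comment> \<open>The left end of the unit interval from \<open>i - 1\<close> to \<open>i\<close>,
    or of its mirror image.\<close>
  define lo where "lo = (\<lambda>(s :: bool) (i :: nat). if s then real i - 1 else - real i)"
  define Q where "Q = (\<lambda>(p :: nat \<times> nat, s, t). box (vector [lo s (fst p), lo t (snd p)] :: real^2) (vector [lo s (fst p) + 1, lo t (snd p) + 1]))"
  define T where "T = F \<times> (UNIV :: (bool \<times> bool) set)"
  have memQ: "z \<in> Q (p, s, t) \<longleftrightarrow> lo s (fst p) < z$1 \<and> z$1 < lo s (fst p) + 1 \<and> lo t (snd p) < z$2 \<and> z$2 < lo t (snd p) + 1" for z p s t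
    by (auto simp: Q_def mem_box_cart forall_2)
  have T: "finite T" "card T = 4 * card F"
    using F by (auto simp: T_def card_cartesian_product card_UNIV_bool UNIV_Times_UNIV[symmetric] simp del: UNIV_Times_UNIV)
  have meas: "measure lebesgue (Q q) = 1" "Q q \<in> lmeasurable" for q
  proof -
    obtain p s t where q: "q = (p, s, t)" by (cases q)
    have "measure lebesgue (Q q) = measure lborel (Q q)" unfolding q Q_def by (simp add: measure_completion)
    also have "\<dots> = 1"
      unfolding q Q_def using axis_12_neq by (simp add: measure_lborel_box_eq Basis_real2 inner_axis)
    finally show "measure lebesgue (Q q) = 1" .
    show "Q q \<in> lmeasurable" unfolding q Q_def by (simp add: lmeasurable_box)
  qed
  have one: "s = s' \<and> i = i'" if "lo s i < x" "x < lo s i + 1" "lo s' i' < x" "x < lo s' i' + 1" "i \<ge> 1" "i' \<ge> 1" for s s' i i' x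
  proof -
    have "\<bar>lo s i - lo s' i'\<bar> < 1" using that by linarith
    then show ?thesis using that(5,6) by (auto simp: lo_def split: if_splits)
  qed
  have disj: "pairwise (\<lambda>a b. disjnt (Q a) (Q b)) T"
  proof (rule pairwiseI)
    fix a b assume ab: "a \<in> T" "b \<in> T" "a \<noteq> b"
    obtain p s t p' s' t' where e: "a = (p, s, t)" "b = (p', s', t')" by (metis prod.exhaust)
    have pm: "p \<in> modes" "p' \<in> modes" using ab by (auto simp: T_def F_def e)
    show "disjnt (Q a) (Q b)"
    proof (rule ccontr)
      assume "\<not> disjnt (Q a) (Q b)"
      then obtain z where z: "z \<in> Q (p, s, t)" "z \<in> Q (p', s', t')" by (auto simp: disjnt_def e)
      have "s = s' \<and> fst p = fst p'" using z pm unfolding memQ by (intro one[of _ _ "z$1"]) auto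
      moreover have "t = t' \<and> snd p = snd p'" using z pm unfolding memQ by (intro one[of _ _ "z$2"]) auto
      ultimately show False using ab(3) by (simp add: e prod_eq_iff)
    qed
  qed
  have sub: "(\<Union>q\<in>T. Q q) \<subseteq> cball 0 R"
  proof
    fix z assume "z \<in> (\<Union>q\<in>T. Q q)"
    then obtain p s t where p: "p \<in> F" "z \<in> Q (p, s, t)" by (auto simp: T_def)
    have b: "x\<^sup>2 \<le> (real i)\<^sup>2" if "lo s i < x" "x < lo s i + 1" "i \<ge> 1" for s i x
      using that by (intro abs_le_square_iff[THEN iffD1]) (auto simp: lo_def split: if_splits)
    have pm: "fst p \<ge> 1" "snd p \<ge> 1" "freq p \<le> \<mu>" using p(1) by (auto simp: F_def)
    have "(real (fst p))\<^sup>2 + (real (snd p))\<^sup>2 = freq p * (M / pi)\<^sup>2"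
      using M by (simp add: freq_def power_divide)
    also have "\<dots> \<le> R\<^sup>2" unfolding R(2) using pm by (intro mult_right_mono) auto
    finally have "(z$1)\<^sup>2 + (z$2)\<^sup>2 \<le> R\<^sup>2"
      using b[of s "fst p" "z$1"] b[of t "snd p" "z$2"] p(2) pm unfolding memQ by linarith
    then have "(norm z)\<^sup>2 \<le> R\<^sup>2"
      by (simp only: power2_norm_eq_inner) (simp add: inner_vec_def sum_2 power2_eq_square)
    then show "z \<in> cball 0 R" using R(1) by (simp add: power2_le_iff_abs_le)
  qed
  have "real (card T) = measure lebesgue (\<Union>q\<in>T. Q q)"
    using measure_UNION'[OF T(1) meas(2) disj] meas(1) by simp
  also have "\<dots> \<le> measure lebesgue (cball (0 :: real^2) R)"
    using sub meas(2) T(1) by (intro measure_mono_fmeasurable) (auto intro!: sets.finite_UN)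
  also have "\<dots> = pi * R\<^sup>2"
  proof -
    have "measure lebesgue (cball (0 :: real^2) R) = measure lborel (cball (0 :: real^2) R)"
      by (intro measure_completion) simp
    also have "\<dots> = unit_ball_vol 2 * R\<^sup>2" using content_cball[OF R(1), of "0 :: real^2"] by simp
    finally show ?thesis by (simp add: unit_ball_vol_2)
  qed
  also have "\<dots> = \<mu> * M\<^sup>2 / pi" unfolding R(2) by (simp add: power_divide power2_eq_square)
  finally have "4 * real (card F) * pi \<le> \<mu> * M\<^sup>2" using T(2) by (simp add: pos_le_divide_eq)
  then show ?thesis using False by (simp add: F_def mult_ac max_def)
qed

end

section \<open>Lattice points in large squares and the limit\<close>

text \<open>The period parallelograms based at the lattice points of the box cover the box shrunk on
  each side by \<open>norm v + norm w\<close>, which bounds the extent of one parallelogram.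
  Comparing areas gives the count.\<close>

lemma lattice_points_in_square:
  fixes v w :: "real^2"
  assumes D: "cross2 v w > 0"
  defines "G \<equiv> \<lambda>r s. {(i :: int, j :: int). \<forall>n. r \<le> (of_int i *\<^sub>R v + of_int j *\<^sub>R w) $ n \<and> (of_int i *\<^sub>R v + of_int j *\<^sub>R w) $ n \<le> s}"
  shows "finite (G r s)"
    and "r + 2 * (norm v + norm w) \<le> s \<Longrightarrow> (s - r - 2 * (norm v + norm w))\<^sup>2 \<le> real (card (G r s)) * cross2 v w"
proof -
  define L where "L = (\<lambda>(i :: int, j :: int). of_int i *\<^sub>R v + of_int j *\<^sub>R w)"
  define B where "B = (cbox (\<chi> n. r) (\<chi> n. s) :: (real^2) set)"
  have memG: "p \<in> G r s \<longleftrightarrow> L p \<in> B" for p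
    by (cases p) (auto simp: G_def L_def B_def mem_box_cart)
  have coord: "of_int (fst p) = cross2 (L p) w / cross2 v w" "of_int (snd p) = cross2 v (L p) / cross2 v w" for p
    using D by (simp_all add: L_def case_prod_beta cross2_commute[of w v])
  have "\<exists>b. \<forall>p\<in>G r s. \<bar>of_int (fst p) :: real\<bar> \<le> b \<and> \<bar>of_int (snd p) :: real\<bar> \<le> b"
  proof -
    have "compact ((\<lambda>z. cross2 z w / cross2 v w) ` B)" "compact ((\<lambda>z. cross2 v z / cross2 v w) ` B)"
      unfolding B_def using D by (auto intro!: compact_continuous_image continuous_intros)
    then obtain b1 b2 where "\<forall>z\<in>B. \<bar>cross2 z w / cross2 v w\<bar> \<le> b1" "\<forall>z\<in>B. \<bar>cross2 v z / cross2 v w\<bar> \<le> b2"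
      by (metis (no_types, lifting) bounded_iff compact_imp_bounded imageI real_norm_def)
    then show ?thesis unfolding coord using memG by (intro exI[of _ "max b1 b2"]) (auto simp: le_max_iff_disj)
  qed
  then obtain b where b: "\<And>p. p \<in> G r s \<Longrightarrow> \<bar>of_int (fst p) :: real\<bar> \<le> b \<and> \<bar>of_int (snd p) :: real\<bar> \<le> b" by blast
  have "G r s \<subseteq> {- \<lceil>b\<rceil>..\<lceil>b\<rceil>} \<times> {- \<lceil>b\<rceil>..\<lceil>b\<rceil>}"
  proof
    fix p assume p: "p \<in> G r s"
    have *: "i \<in> {- \<lceil>b\<rceil>..\<lceil>b\<rceil>}" if "\<bar>real_of_int i\<bar> \<le> b" for i
    proof -
      have "real_of_int i \<le> real_of_int \<lceil>b\<rceil>" "real_of_int (- \<lceil>b\<rceil>) \<le> real_of_int i"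
        using that le_of_int_ceiling[of b] by linarith+
      then show ?thesis by (simp only: of_int_le_iff atLeastAtMost_iff)
    qed
    show "p \<in> {- \<lceil>b\<rceil>..\<lceil>b\<rceil>} \<times> {- \<lceil>b\<rceil>..\<lceil>b\<rceil>}" using *[of "fst p"] *[of "snd p"] b[OF p] by (simp add: mem_Times_iff)
  qed
  then show fin: "finite (G r s)" by (rule finite_subset) auto
  define \<rho> where "\<rho> = norm v + norm w"
  assume le: "r + 2 * (norm v + norm w) \<le> s"
  define S where "S = (cbox (\<chi> n. r + \<rho>) (\<chi> n. s - \<rho>) :: (real^2) set)"
  \<comment> \<open>The period parallelogram as two triangles, one for each order of the fractional
    coordinates.\<close>
  define T1 where "T1 = convex hull {0, v, v + w}"
  define T2 where "T2 = convex hull {0, w, v + w}"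
  have Tc: "compact (T1 \<union> T2)" unfolding T1_def T2_def by (intro compact_Un compact_convex_hull) auto
  have mT: "measure lebesgue (T1 \<union> T2) \<le> cross2 v w"
  proof -
    have "measure lebesgue (T1 \<union> T2) \<le> measure lebesgue T1 + measure lebesgue T2"
      unfolding T1_def T2_def by (intro measure_Un_le) (auto intro!: fmeasurableD lmeasurable_compact compact_convex_hull)
    also have "\<dots> = cross2 v w"
      unfolding T1_def T2_def content_triangle_cross2 using D cross2_commute[of w v] by simp
    finally show ?thesis .
  qed
  have cover: "S \<subseteq> (\<Union>p\<in>G r s. (+) (L p) ` (T1 \<union> T2))"
  proof
    fix y assume y: "y \<in> S"
    define \<alpha> where "\<alpha> = cross2 y w / cross2 v w"
    define \<beta> where "\<beta> = cross2 v y / cross2 v w"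
    have yd: "y = \<alpha> *\<^sub>R v + \<beta> *\<^sub>R w" unfolding \<alpha>_def \<beta>_def using D by (intro cross2_decompose) auto
    \<comment> \<open>Rounding the lattice coordinates of \<open>y\<close> down gives the base
      point; the fractional parts give the place in the parallelogram.\<close>
    define p where "p = (\<lfloor>\<alpha>\<rfloor>, \<lfloor>\<beta>\<rfloor>)"
    define x where "x = frac \<alpha> *\<^sub>R v + frac \<beta> *\<^sub>R w"
    have yx: "y = L p + x" by (simp add: yd L_def p_def x_def frac_def algebra_simps)
    have f: "0 \<le> frac \<alpha>" "frac \<alpha> < 1" "0 \<le> frac \<beta>" "frac \<beta> < 1" by (auto simp: frac_lt_1)
    have "norm x \<le> norm (frac \<alpha> *\<^sub>R v) + norm (frac \<beta> *\<^sub>R w)" unfolding x_def by (rule norm_triangle_ineq)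
    also have "\<dots> \<le> 1 * norm v + 1 * norm w"
      using f by (auto intro!: add_mono mult_left_le_one_le)
    finally have nx: "\<bar>x $ n\<bar> \<le> \<rho>" for n using component_le_norm_cart[of x n] by (simp add: \<rho>_def)
    have "L p \<in> B"
      unfolding B_def mem_box_cart
    proof (intro allI)
      fix n
      have "r + \<rho> \<le> y $ n \<and> y $ n \<le> s - \<rho>" using y by (simp add: S_def mem_box_cart)
      then have "r \<le> L p $ n \<and> L p $ n \<le> s" using nx[of n] unfolding yx vector_add_component abs_le_iff by linarith
      then show "(\<chi> n. r) $ n \<le> L p $ n \<and> L p $ n \<le> (\<chi> n. s) $ n" by simp
    qed
    moreover have "x \<in> T1 \<union> T2"
    proof (cases "frac \<beta> \<le> frac \<alpha>")
      case True
      have "(1 - frac \<alpha>) *\<^sub>R 0 + (frac \<alpha> - frac \<beta>) *\<^sub>R v + frac \<beta> *\<^sub>R (v + w) \<in> T1"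
        unfolding T1_def convex_hull_3 mem_Collect_eq
        by (rule exI[of _ "1 - frac \<alpha>"], rule exI[of _ "frac \<alpha> - frac \<beta>"], rule exI[of _ "frac \<beta>"]) (use f True in auto)
      then show ?thesis by (simp add: x_def algebra_simps)
    next
      case False
      have "(1 - frac \<beta>) *\<^sub>R 0 + (frac \<beta> - frac \<alpha>) *\<^sub>R w + frac \<alpha> *\<^sub>R (v + w) \<in> T2"
        unfolding T2_def convex_hull_3 mem_Collect_eq
        by (rule exI[of _ "1 - frac \<beta>"], rule exI[of _ "frac \<beta> - frac \<alpha>"], rule exI[of _ "frac \<alpha>"]) (use f False in auto)
      then show ?thesis by (simp add: x_def algebra_simps)
    qed
    ultimately show "y \<in> (\<Union>p\<in>G r s. (+) (L p) ` (T1 \<union> T2))" using memG yx by blast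
  qed
  have tm: "(+) (L p) ` (T1 \<union> T2) \<in> lmeasurable" for p
    by (intro lmeasurable_compact compact_translation Tc)
  have "(s - r - 2 * \<rho>)\<^sup>2 = measure lebesgue S"
  proof -
    have "measure lebesgue S = measure lborel S" unfolding S_def by (intro measure_completion) simp
    also have "\<dots> = (\<Prod>n\<in>(UNIV :: 2 set). (s - \<rho>) - (r + \<rho>))"
      unfolding S_def using le axis_12_neq by (simp add: measure_lborel_cbox_eq Basis_real2 inner_axis UNIV_2 \<rho>_def)
    also have "\<dots> = (s - r - 2 * \<rho>)\<^sup>2" by (simp add: UNIV_2 power2_eq_square algebra_simps)
    finally show ?thesis by simp
  qed
  also have "\<dots> \<le> measure lebesgue (\<Union>p\<in>G r s. (+) (L p) ` (T1 \<union> T2))"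
    using cover tm fin by (intro measure_mono_fmeasurable) (auto simp: S_def)
  also have "\<dots> \<le> (\<Sum>p\<in>G r s. measure lebesgue ((+) (L p) ` (T1 \<union> T2)))"
    using tm fin by (intro measure_UNION_le) auto
  also have "\<dots> \<le> (\<Sum>p\<in>G r s. cross2 v w)" using mT by (intro sum_mono) (simp only: measure_translation)
  finally show "(s - r - 2 * (norm v + norm w))\<^sup>2 \<le> real (card (G r s)) * cross2 v w" by (simp add: \<rho>_def)
qed

text \<open>Two copies per lattice point together with the \<open>4 * pi\<close> of the mode count
  make \<open>8 * pi\<close>. The copies lost along the boundary shrink the side by the constant
  \<open>c\<close> only, which disappears after division by \<open>M\<^sup>2\<close>. The maximum
  with 0 is inherited from the mode count.\<close>

lemma packing_eigenvalue_bound: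
  fixes \<Omega> :: "(real^2) set" and v w z :: "real^2"
  assumes \<Omega>: "open \<Omega>" "bounded \<Omega>" and D: "cross2 v w > 0"
    and p1: "\<And>x i j. \<lbrakk>x \<in> \<Omega>; (i, j) \<noteq> (0, 0)\<rbrakk> \<Longrightarrow> x + of_int i *\<^sub>R v + of_int j *\<^sub>R w \<notin> \<Omega>"
    and p2: "\<And>x y i j. \<lbrakk>x \<in> \<Omega>; y \<in> \<Omega>\<rbrakk> \<Longrightarrow> x + y \<noteq> z + of_int i *\<^sub>R v + of_int j *\<^sub>R w"
    and ev: "dirichlet_eigenvalues \<Omega> \<Lambda>"
  shows "8 * pi * real k / cross2 v w \<le> max (\<Lambda> k) 0"
proof -
  obtain r where r: "\<And>x. x \<in> \<Omega> \<Longrightarrow> norm x \<le> r" using \<Omega>(2) unfolding bounded_iff by blast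
  \<comment> \<open>Every copy, including the shift by \<open>z\<close> of the reflected ones, stays
    within \<open>R\<close> of its lattice point in each coordinate; the 1 keeps it in the interior
    of the square.\<close>
  define R where "R = \<bar>r\<bar> + norm z + 1"
  define c where "c = 2 * R + 2 * (norm v + norm w)"
  have R: "R > 0" by (simp add: R_def add_nonneg_pos)
  have c0: "c > 0" using R by (simp add: c_def add_pos_nonneg)
  have bound: "8 * pi * real k / cross2 v w * (M - c)\<^sup>2 \<le> max (\<Lambda> k) 0 * M\<^sup>2" if Mc: "M \<ge> c" for M
  proof -
    define G where "G = {(i :: int, j :: int). \<forall>n. R \<le> (of_int i *\<^sub>R v + of_int j *\<^sub>R w) $ n \<and> (of_int i *\<^sub>R v + of_int j *\<^sub>R w) $ n \<le> M - R}"
    note lat = lattice_points_in_square[OF D, of R "M - R", folded G_def]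
    define l where "l = (\<lambda>p :: int \<times> int. of_int (fst p) *\<^sub>R v + of_int (snd p) *\<^sub>R w)"
    \<comment> \<open>The Boolean chooses between a translate of \<open>\<Omega>\<close> and a
      translate of \<open>z - \<Omega>\<close>.\<close>
    define \<sigma> where "\<sigma> = (\<lambda>q :: bool \<times> int \<times> int. if fst q then 1 else - 1 :: real)"
    define \<tau> where "\<tau> = (\<lambda>q :: bool \<times> int \<times> int. (if fst q then 0 else z) + l (snd q))"
    define J where "J = (UNIV :: bool set) \<times> G"
    interpret disjoint_copies \<Omega> J \<sigma> \<tau> M
    proof
      show "open \<Omega>" by fact
      show "finite J" using lat(1) by (simp add: J_def)
      show "M > 0" using Mc c0 by simp
      show "\<bar>\<sigma> m\<bar> = 1" for m by (simp add: \<sigma>_def)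
      fix m x assume m: "m \<in> J" and x: "x \<in> \<Omega>"
      have "\<bar>(\<sigma> m *\<^sub>R x + (if fst m then 0 else z)) $ n\<bar> < R" for n
      proof -
        have "\<bar>x $ n\<bar> \<le> \<bar>r\<bar>" using component_le_norm_cart[of x n] r[OF x] by linarith
        moreover have "\<bar>z $ n\<bar> \<le> norm z" by (rule component_le_norm_cart)
        ultimately show ?thesis using norm_ge_zero[of z] by (auto simp: \<sigma>_def R_def)
      qed
      moreover have "R \<le> l (snd m) $ n \<and> l (snd m) $ n \<le> M - R" for n
        using m by (auto simp: J_def G_def l_def)
      moreover have "(\<sigma> m *\<^sub>R x + \<tau> m) $ n = (\<sigma> m *\<^sub>R x + (if fst m then 0 else z)) $ n + l (snd m) $ n" for n
        by (simp add: \<tau>_def)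
      ultimately have "0 < (\<sigma> m *\<^sub>R x + \<tau> m) $ n \<and> (\<sigma> m *\<^sub>R x + \<tau> m) $ n < M" for n by (smt (verit))
      then show "\<sigma> m *\<^sub>R x + \<tau> m \<in> interior (square M)" by (simp add: interior_square)
    next
      fix m n x y assume mn: "m \<in> J" "n \<in> J" and xy: "x \<in> \<Omega>" "y \<in> \<Omega>" and eq: "\<sigma> m *\<^sub>R x + \<tau> m = \<sigma> n *\<^sub>R y + \<tau> n"
      obtain s i j where m: "m = (s, i, j)" by (cases m)
      obtain t i' j' where n: "n = (t, i', j')" by (cases n)
      have d: "l (i, j) - l (i', j') = of_int (i - i') *\<^sub>R v + of_int (j - j') *\<^sub>R w"
        for i j i' j' by (simp add: l_def algebra_simps)
      consider "s" "t" | "\<not> s" "\<not> t" | "s" "\<not> t" | "\<not> s" "t" by blast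
      then show "m = n"
      proof cases
        case 1
        then have "y = x + (l (i, j) - l (i', j'))" using eq by (simp add: m n \<sigma>_def \<tau>_def algebra_simps)
        then have "(i - i', j - j') = (0, 0)" using p1[OF xy(1), of "i - i'" "j - j'"] xy(2) unfolding d by (metis add.assoc)
        then show ?thesis using 1 by (simp add: m n)
      next
        case 2
        then have "x = y + (l (i, j) - l (i', j'))" using eq by (simp add: m n \<sigma>_def \<tau>_def algebra_simps)
        then have "(i - i', j - j') = (0, 0)" using p1[OF xy(2), of "i - i'" "j - j'"] xy(1) unfolding d by (metis add.assoc)
        then show ?thesis using 2 by (simp add: m n)
      next
        case 3
        then have "x + y = z + (l (i', j') - l (i, j))" using eq by (simp add: m n \<sigma>_def \<tau>_def algebra_simps)
        then show ?thesis using p2[OF xy, of "i' - i" "j' - j"] unfolding d by (simp add: add.assoc)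
      next
        case 4
        then have "x + y = z + (l (i, j) - l (i', j'))" using eq by (simp add: m n \<sigma>_def \<tau>_def algebra_simps)
        then show ?thesis using p2[OF xy, of "i - i'" "j - j'"] unfolding d by (simp add: add.assoc)
      qed
    qed
    have "R + 2 * (norm v + norm w) \<le> M - R" using Mc by (simp add: c_def)
    from lat(2)[OF this] have a: "(M - c)\<^sup>2 \<le> real (card G) * cross2 v w" by (simp add: c_def algebra_simps)
    have "8 * pi * real k / cross2 v w * (M - c)\<^sup>2 \<le> 8 * pi * real k / cross2 v w * (real (card G) * cross2 v w)"
      using D by (intro mult_left_mono a) auto
    also have "\<dots> = 4 * pi * real (card J * k)" using D by (simp add: J_def card_cartesian_product)
    also have "\<dots> \<le> 4 * pi * real (card {p \<in> modes. freq p \<le> \<Lambda> k})"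
      using eigenvalue_count[OF ev, of k] by (intro mult_left_mono of_nat_mono) auto
    also have "\<dots> \<le> max (\<Lambda> k) 0 * M\<^sup>2" by (rule mode_count_upper_bound)
    finally show ?thesis .
  qed
  have lim: "(\<lambda>n. 8 * pi * real k / cross2 v w * (1 - c / real (Suc n))\<^sup>2) \<longlonglongrightarrow> 8 * pi * real k / cross2 v w * (1 - 0)\<^sup>2"
    by (intro tendsto_intros LIMSEQ_Suc[OF lim_const_over_n])
  have "8 * pi * real k / cross2 v w * (1 - 0)\<^sup>2 \<le> max (\<Lambda> k) 0"
  proof (rule LIMSEQ_le_const2[OF lim], intro exI allI impI)
    fix n assume n: "nat \<lceil>c\<rceil> \<le> n"
    then have nc: "c \<le> real (Suc n)" by linarith
    have "1 - c / real (Suc n) = (real (Suc n) - c) / real (Suc n)" by (simp add: diff_divide_distrib)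
    then have "8 * pi * real k / cross2 v w * (1 - c / real (Suc n))\<^sup>2 = 8 * pi * real k / cross2 v w * (real (Suc n) - c)\<^sup>2 / (real (Suc n))\<^sup>2"
      by (simp only: power_divide times_divide_eq_right)
    also have "\<dots> \<le> max (\<Lambda> k) 0" using bound[OF nc] by (simp only: pos_divide_le_eq zero_less_power of_nat_0_less_iff zero_less_Suc)
    finally show "8 * pi * real k / cross2 v w * (1 - c / real (Suc n))\<^sup>2 \<le> max (\<Lambda> k) 0" .
  qed
  then show ?thesis by simp
qed

theorem corollary1:
  fixes \<Omega> :: "(real^2) set" and V :: real and \<Lambda> :: "nat \<Rightarrow> real" and k :: nat
  assumes "open \<Omega>" and "connected \<Omega>" and "\<Omega> \<noteq> {}"
    and "bounded \<Omega>" and "convex \<Omega>"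
    and "V = measure lebesgue \<Omega>"
    and "dirichlet_eigenvalues \<Omega> \<Lambda>"
    and "k \<ge> 1"
  shows "\<Lambda> k > 2 * sqrt 3 * pi * (real k / V)"
proof -
  have V: "V > 0" using measure_open_pos assms by blast
  obtain v w z where p: "0 < cross2 v w" "cross2 v w < 4 * measure lebesgue \<Omega> / sqrt 3"
    "\<And>x i j. \<lbrakk>x \<in> \<Omega>; (i, j) \<noteq> (0, 0)\<rbrakk> \<Longrightarrow> x + of_int i *\<^sub>R v + of_int j *\<^sub>R w \<notin> \<Omega>"
    "\<And>x y i j. \<lbrakk>x \<in> \<Omega>; y \<in> \<Omega>\<rbrakk> \<Longrightarrow> x + y \<noteq> z + of_int i *\<^sub>R v + of_int j *\<^sub>R w"
    by (rule double_lattice_packing[OF assms(1,5,4,3)]) blast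
  have "2 * sqrt 3 * pi * (real k / V) = 8 * pi * real k / (4 * V / sqrt 3)"
    using V by (simp add: field_simps)
  \<comment> \<open>The only strict step: the packing is strictly better than
    \<open>4 V / sqrt 3\<close>, and \<open>k \<ge> 1\<close> makes the numerator positive.\<close>
  also have "\<dots> < 8 * pi * real k / cross2 v w"
    using p(1,2) assms(8) V unfolding assms(6) by (intro divide_strict_left_mono) auto
  also have "\<dots> \<le> max (\<Lambda> k) 0"
    by (rule packing_eigenvalue_bound[OF assms(1,4) p(1,3,4) assms(7)])
  finally have "2 * sqrt 3 * pi * (real k / V) < max (\<Lambda> k) 0" .
  \<comment> \<open>A nonnegative number lies strictly below the maximum, so the maximum is not 0
    and must be \<open>\<Lambda> k\<close>.\<close>
  moreover have "2 * sqrt 3 * pi * (real k / V) \<ge> 0" using V by simp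
  ultimately show ?thesis by linarith
qed

end
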